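(* Fix $c>0$ and $k\in(0,\sqrt c/2)$, and let $\mathcal{L}$ be the operator on $L^2(\mathbb{R})$ defined in the context. The essential spectrum of $\mathcal{L}$ is positive, bounded away from the origin, and given by the interval $$\sigma_{\rm ess}(\mathcal{L})=[\sigma_0,\infty),\qquad \sigma_0:=\frac{8(c-4k^2)}{k^{8/3}(c-k^2)}>0.$$
   Context: Setting: for fixed $c>0$ and $k\in(0,\sqrt c/2)$, set $a=k(c-k^2)^{3/2}$ and $E=\frac{k^2(c-2k^2)}{2c}$; $\phi=\phi(\cdot;k)$ denotes the unique nonconstant smooth even function on $\mathbb{R}$ with $\phi'(0)=0$, $\phi(x)\to k$ as $x\to\pm\infty$ (exponentially fast, together with decay of all derivatives), $\phi^2<c$, and $\phi-\phi''=a(c-\phi^2)^{-3/2}$; it is the profile of a smooth solitary wave $u(x,t)=\phi(x-ct)$ of the Novikov equation $u_t-u_{xxt}=u^2u_{xxx}-4u^2u_x+3uu_xu_{xx}$. Put $\mu=\phi-\phi''>0$, $\omega_0=-9a^{-2/3}$, $\omega_1=9c\,a^{-4/3}(2E+c)$. The operator $\mathcal{L}$ on $L^2(\mathbb{R})$ with domain $H^2(\mathbb{R})$ is $$\mathcal{L}=\frac23\left(-3\,\partial_x\left(\mu^{-8/3}\partial_x\right)+8\mu''\mu^{-11/3}-\frac{44}{3}(\mu')^2\mu^{-14/3}+15\mu^{-8/3}\right)-\frac{2\omega_1}{9}\mu^{-4/3}+2\omega_0(1-\partial_x^2)^{-1},$$ where $(1-\partial_x^2)^{-1}$ is convolution with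 $\frac12e^{-|x|}$. The essential spectrum is the set of $\lambda\in\mathbb{C}$ for which $\mathcal{L}-\lambda I$ is either not Fredholm or is Fredholm with nonzero index. *)

theory Defs
  imports "HOL-Analysis.Analysis"
begin

section \<open>The complex Hilbert space of square-integrable functions on the line\<close>

definition square_integrable :: "(real \<Rightarrow> complex) \<Rightarrow> bool" where
  "square_integrable f \<longleftrightarrow>
     f \<in> borel_measurable lborel \<and> integrable lborel (\<lambda>x. (cmod (f x))\<^sup>2)"

definition L2_eq :: "(real \<Rightarrow> complex) \<Rightarrow> (real \<Rightarrow> complex) \<Rightarrow> bool" where
  "L2_eq f g \<longleftrightarrow> square_integrable f \<and> square_integrable g \<and> (AE x in lborel. f x = g x)"

lemma square_integrable_zero: "square_integrable (\<lambda>x. 0)"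
  by (simp add: square_integrable_def)

lemma square_integrable_scale:
  "square_integrable f \<Longrightarrow> square_integrable (\<lambda>x. z * f x)"
  by (auto simp: square_integrable_def norm_mult power_mult_distrib)

lemma square_integrable_add:
  assumes "square_integrable f" "square_integrable g"
  shows "square_integrable (\<lambda>x. f x + g x)"
proof -
  have [measurable]: "f \<in> borel_measurable borel" "g \<in> borel_measurable borel"
    using assms by (auto simp: square_integrable_def)
  have "integrable lborel (\<lambda>x. 2 * (cmod (f x))\<^sup>2 + 2 * (cmod (g x))\<^sup>2)"
    using assms by (auto simp: square_integrable_def)
  moreover have "(cmod (f x + g x))\<^sup>2 \<le> 2 * (cmod (f x))\<^sup>2 + 2 * (cmod (g x))\<^sup>2" for x
  proof -
    have "(cmod (f x + g x))\<^sup>2 \<le> (cmod (f x) + cmod (g x))\<^sup>2"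
      by (intro power_mono norm_triangle_ineq) auto
    also have "\<dots> \<le> 2 * (cmod (f x))\<^sup>2 + 2 * (cmod (g x))\<^sup>2"
      using sum_squares_bound[of "cmod (f x)" "cmod (g x)"] by (simp add: power2_sum)
    finally show ?thesis .
  qed
  ultimately have "integrable lborel (\<lambda>x. (cmod (f x + g x))\<^sup>2)"
    by (intro Bochner_Integration.integrable_bound
        [where g = "\<lambda>x. (cmod (f x + g x))\<^sup>2"]) (auto intro!: AE_I2)
  then show ?thesis by (simp add: square_integrable_def)
qed

lemma square_integrable_minus:
  "square_integrable f \<Longrightarrow> square_integrable (\<lambda>x. - f x)"
  using square_integrable_scale[of f "-1"] by simp

lemma square_integrable_diff:
  "square_integrable f \<Longrightarrow> square_integrable g \<Longrightarrow> square_integrable (\<lambda>x. f x - g x)"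
  using square_integrable_add[OF _ square_integrable_minus, of f g] by simp

lemma integrable_Re_mult_cnj:
  assumes "square_integrable f" "square_integrable g"
  shows "integrable lborel (\<lambda>x. Re (f x * cnj (g x)))"
proof -
  have [measurable]: "f \<in> borel_measurable borel" "g \<in> borel_measurable borel"
    using assms by (auto simp: square_integrable_def)
  have meas: "(\<lambda>x. Re (f x * cnj (g x))) \<in> borel_measurable borel"
    by simp
  have "integrable lborel (\<lambda>x. (cmod (f x))\<^sup>2 + (cmod (g x))\<^sup>2)"
    using assms by (auto simp: square_integrable_def)
  moreover have "\<bar>Re (f x * cnj (g x))\<bar> \<le> (cmod (f x))\<^sup>2 + (cmod (g x))\<^sup>2" for x
  proof -
    have "\<bar>Re (f x * cnj (g x))\<bar> \<le> cmod (f x) * cmod (g x)"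
      using abs_Re_le_cmod[of "f x * cnj (g x)"] by (simp add: norm_mult)
    moreover have "2 * cmod (f x) * cmod (g x) \<le> (cmod (f x))\<^sup>2 + (cmod (g x))\<^sup>2"
      by (rule sum_squares_bound)
    moreover have "0 \<le> cmod (f x) * cmod (g x)" by simp
    ultimately show ?thesis by linarith
  qed
  ultimately show ?thesis
    by (intro Bochner_Integration.integrable_bound
        [where g = "\<lambda>x. Re (f x * cnj (g x))"])
      (auto intro!: AE_I2 meas simp del: times_complex.simps)
qed

quotient_type L2 = "real \<Rightarrow> complex" / partial: L2_eq
proof (rule part_equivpI)
  show "\<exists>f. L2_eq f f"
    by (rule exI[of _ "\<lambda>x. 0"]) (simp add: L2_eq_def square_integrable_zero)
  show "symp L2_eq"
    by (rule sympI) (auto simp: L2_eq_def elim: AE_mp)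
  show "transp L2_eq"
    by (rule transpI) (auto simp: L2_eq_def elim: AE_mp)
qed

lift_definition scaleC :: "complex \<Rightarrow> L2 \<Rightarrow> L2" (infixr \<open>*\<^sub>C\<close> 75) is "\<lambda>z f x. z * f x"
  by (auto simp: L2_eq_def square_integrable_scale elim: AE_mp)

instantiation L2 :: real_vector
begin

lift_definition zero_L2 :: L2 is "\<lambda>x. 0"
  by (simp add: L2_eq_def square_integrable_zero)

lift_definition plus_L2 :: "L2 \<Rightarrow> L2 \<Rightarrow> L2" is "\<lambda>f g x. f x + g x"
  by (auto simp: L2_eq_def square_integrable_add)

lift_definition uminus_L2 :: "L2 \<Rightarrow> L2" is "\<lambda>f x. - f x"
  by (auto simp: L2_eq_def square_integrable_minus)

lift_definition minus_L2 :: "L2 \<Rightarrow> L2 \<Rightarrow> L2" is "\<lambda>f g x. f x - g x"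
  by (auto simp: L2_eq_def square_integrable_diff)

definition scaleR_L2 :: "real \<Rightarrow> L2 \<Rightarrow> L2" where
  "scaleR_L2 r u = scaleC (complex_of_real r) u"

instance
proof
  fix u v w :: L2 and r s :: real
  show "u + v + w = u + (v + w)"
    by transfer (auto simp: L2_eq_def add.assoc intro!: square_integrable_add)
  show "u + v = v + u"
    by transfer (auto simp: L2_eq_def add.commute intro!: square_integrable_add)
  show "0 + u = u"
    by transfer (auto simp: L2_eq_def)
  show "- u + u = 0"
    by transfer (auto simp: L2_eq_def square_integrable_zero)
  show "u - v = u + - v"
    by transfer (auto simp: L2_eq_def intro!: square_integrable_diff)
  show "r *\<^sub>R (u + v) = r *\<^sub>R u + r *\<^sub>R v"
    unfolding scaleR_L2_def
    by transfer (auto simp: L2_eq_def distrib_left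
        intro!: square_integrable_scale square_integrable_add)
  show "(r + s) *\<^sub>R u = r *\<^sub>R u + s *\<^sub>R u"
    unfolding scaleR_L2_def
    by transfer (auto simp: L2_eq_def distrib_right
        intro!: square_integrable_scale square_integrable_add)
  show "r *\<^sub>R s *\<^sub>R u = (r * s) *\<^sub>R u"
    unfolding scaleR_L2_def
    by transfer (auto simp: L2_eq_def mult.assoc intro!: square_integrable_scale)
  show "1 *\<^sub>R u = u"
    unfolding scaleR_L2_def by transfer (auto simp: L2_eq_def)
qed

end

instantiation L2 :: real_inner
begin

text \<open>The real part of the complex inner product, so that \<open>norm\<close> is the \<open>L\<^sup>2\<close> norm.\<close>

lift_definition inner_L2 :: "L2 \<Rightarrow> L2 \<Rightarrow> real" is
  "\<lambda>f g. \<integral>x. Re (f x * cnj (g x)) \<partial>lborel"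
  by (rule integral_cong_AE) (auto simp: L2_eq_def square_integrable_def)

definition norm_L2 :: "L2 \<Rightarrow> real" where
  "norm_L2 u = sqrt (inner u u)"

definition sgn_L2 :: "L2 \<Rightarrow> L2" where
  "sgn_L2 u = u /\<^sub>R norm u"

definition dist_L2 :: "L2 \<Rightarrow> L2 \<Rightarrow> real" where
  "dist_L2 u v = norm (u - v)"

definition uniformity_L2 :: "(L2 \<times> L2) filter" where
  "uniformity_L2 = (INF e\<in>{0<..}. principal {(u, v). dist u v < e})"

definition open_L2 :: "L2 set \<Rightarrow> bool" where
  "open_L2 U \<longleftrightarrow> (\<forall>u\<in>U. eventually (\<lambda>(u', v). u' = u \<longrightarrow> v \<in> U) uniformity)"

instance
proof
  fix u v w :: L2 and r :: real and U :: "L2 set"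
  show "dist u v = norm (u - v)" by (rule dist_L2_def)
  show "sgn u = u /\<^sub>R norm u" by (rule sgn_L2_def)
  show "uniformity = (INF e\<in>{0<..}. principal {(u, v :: L2). dist u v < e})"
    by (rule uniformity_L2_def)
  show "open U \<longleftrightarrow> (\<forall>u\<in>U. eventually (\<lambda>(u', v). u' = u \<longrightarrow> v \<in> U) uniformity)"
    by (rule open_L2_def)
  show "inner u v = inner v u"
    by transfer (simp add: algebra_simps)
  show "inner (u + v) w = inner u w + inner v w"
  proof transfer
    fix f g h assume "L2_eq f f" "L2_eq g g" "L2_eq h h"
    then have "integrable lborel (\<lambda>x. Re (f x * cnj (h x)))"
      "integrable lborel (\<lambda>x. Re (g x * cnj (h x)))"
      by (auto simp: L2_eq_def simp del: times_complex.simps intro: integrable_Re_mult_cnj)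
    then show "(\<integral>x. Re ((f x + g x) * cnj (h x)) \<partial>lborel) =
       (\<integral>x. Re (f x * cnj (h x)) \<partial>lborel) + (\<integral>x. Re (g x * cnj (h x)) \<partial>lborel)"
      by (simp add: distrib_right del: times_complex.simps)
  qed
  show "inner (r *\<^sub>R u) v = r * inner u v"
    unfolding scaleR_L2_def
  proof transfer
    fix r :: real and f g :: "real \<Rightarrow> complex"
    have "Re (complex_of_real r * f x * cnj (g x)) = r * Re (f x * cnj (g x))" for x
      by (simp add: algebra_simps)
    then show "(\<integral>x. Re (complex_of_real r * f x * cnj (g x)) \<partial>lborel) =
        r * (\<integral>x. Re (f x * cnj (g x)) \<partial>lborel)"
      by (simp del: times_complex.simps)
  qed
  show "0 \<le> inner u u"
    by transfer (auto intro!: integral_nonneg_AE)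
  show "inner u u = 0 \<longleftrightarrow> u = 0"
  proof transfer
    fix f assume f: "L2_eq f f"
    then have sq: "integrable lborel (\<lambda>x. (cmod (f x))\<^sup>2)"
      by (simp add: L2_eq_def square_integrable_def)
    have "Re (f x * cnj (f x)) = (cmod (f x))\<^sup>2" for x
      by (simp add: complex_mult_cnj cmod_power2)
    then have "(\<integral>x. Re (f x * cnj (f x)) \<partial>lborel) = 0 \<longleftrightarrow> (AE x in lborel. f x = 0)"
      using integral_nonneg_eq_0_iff_AE[OF sq] by (simp del: times_complex.simps)
    then show "(\<integral>x. Re (f x * cnj (f x)) \<partial>lborel) = 0 \<longleftrightarrow> L2_eq f (\<lambda>x. 0)"
      using f by (auto simp: L2_eq_def square_integrable_zero)
  qed
  show "norm u = sqrt (inner u u)" by (rule norm_L2_def)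
qed

end

interpretation L2: vector_space scaleC
proof
  fix u v :: L2 and z w :: complex
  show "z *\<^sub>C (u + v) = z *\<^sub>C u + z *\<^sub>C v"
    by transfer (auto simp: L2_eq_def distrib_left
        intro!: square_integrable_scale square_integrable_add)
  show "(z + w) *\<^sub>C u = z *\<^sub>C u + w *\<^sub>C u"
    by transfer (auto simp: L2_eq_def distrib_right
        intro!: square_integrable_scale square_integrable_add)
  show "z *\<^sub>C w *\<^sub>C u = (z * w) *\<^sub>C u"
    by transfer (auto simp: L2_eq_def mult.assoc intro!: square_integrable_scale)
  show "1 *\<^sub>C u = u"
    by transfer (auto simp: L2_eq_def)
qed


section \<open>Fredholm operators and the essential spectrum\<close>

definition finite_dim :: "L2 set \<Rightarrow> bool" where
  "finite_dim S \<longleftrightarrow> (\<exists>B. finite B \<and> S \<subseteq> L2.span B)"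

definition complement :: "L2 set \<Rightarrow> L2 set \<Rightarrow> bool" where
  "complement V W \<longleftrightarrow>
     L2.subspace W \<and> V \<inter> W = {0} \<and> (\<forall>u. \<exists>v\<in>V. \<exists>w\<in>W. u = v + w)"

definition has_codim :: "L2 set \<Rightarrow> nat \<Rightarrow> bool" where
  "has_codim V n \<longleftrightarrow> (\<exists>W. complement V W \<and> finite_dim W \<and> L2.dim W = n)"

definition codim :: "L2 set \<Rightarrow> nat" where
  "codim V = (THE n. has_codim V n)"

text \<open>An unbounded operator is a pair of its domain \<open>D\<close> and a map \<open>A\<close>, whose values outside \<open>D\<close>
  are irrelevant.\<close>

definition ker_on :: "L2 set \<Rightarrow> (L2 \<Rightarrow> L2) \<Rightarrow> L2 set" where
  "ker_on D A = {u \<in> D. A u = 0}"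

definition fredholm :: "L2 set \<Rightarrow> (L2 \<Rightarrow> L2) \<Rightarrow> bool" where
  "fredholm D A \<longleftrightarrow>
     finite_dim (ker_on D A) \<and> closed (A ` D) \<and> (\<exists>n. has_codim (A ` D) n)"

definition fredholm_index :: "L2 set \<Rightarrow> (L2 \<Rightarrow> L2) \<Rightarrow> int" where
  "fredholm_index D A = int (L2.dim (ker_on D A)) - int (codim (A ` D))"

definition ess_spectrum :: "L2 set \<Rightarrow> (L2 \<Rightarrow> L2) \<Rightarrow> complex set" where
  "ess_spectrum D A =
     {z. \<not> fredholm D (\<lambda>u. A u - z *\<^sub>C u) \<or>
         fredholm D (\<lambda>u. A u - z *\<^sub>C u) \<and> fredholm_index D (\<lambda>u. A u - z *\<^sub>C u) \<noteq> 0}"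


section \<open>Weak derivatives, multiplication and convolution operators\<close>

definition smooth :: "(real \<Rightarrow> real) \<Rightarrow> bool" where
  "smooth f \<longleftrightarrow> (\<forall>n x. (deriv ^^ n) f differentiable (at x))"

definition test_function :: "(real \<Rightarrow> real) \<Rightarrow> bool" where
  "test_function \<psi> \<longleftrightarrow> smooth \<psi> \<and> compact (closure {x. \<psi> x \<noteq> 0})"

definition weak_deriv :: "L2 \<Rightarrow> L2 \<Rightarrow> bool" where
  "weak_deriv u v \<longleftrightarrow>
     (\<forall>\<psi>. test_function \<psi> \<longrightarrow>
        (\<integral>x. complex_of_real (deriv \<psi> x) * rep_L2 u x \<partial>lborel) =
        - (\<integral>x. complex_of_real (\<psi> x) * rep_L2 v x \<partial>lborel))"

definition H2 :: "L2 set" where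
  "H2 = {u. \<exists>v w. weak_deriv u v \<and> weak_deriv v w}"

definition Dx :: "L2 \<Rightarrow> L2" where
  "Dx u = (THE v. weak_deriv u v)"

text \<open>Only used for bounded measurable \<open>m\<close>, for which the product is square integrable.\<close>

definition mult_op :: "(real \<Rightarrow> real) \<Rightarrow> L2 \<Rightarrow> L2" where
  "mult_op m u = abs_L2 (\<lambda>x. complex_of_real (m x) * rep_L2 u x)"

text \<open>The operator \<open>(1 - \<partial>\<^sub>x\<^sup>2)\<^sup>-\<^sup>1\<close>.\<close>

definition inv_helmholtz :: "L2 \<Rightarrow> L2" where
  "inv_helmholtz u =
     abs_L2 (\<lambda>x. \<integral>y. complex_of_real (exp (- \<bar>x - y\<bar>) / 2) * rep_L2 u y \<partial>lborel)"


section \<open>The solitary wave profile and the linearized operator\<close>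

definition par_a :: "real \<Rightarrow> real \<Rightarrow> real" where
  "par_a c k = k * (c - k\<^sup>2) powr (3/2)"

definition par_E :: "real \<Rightarrow> real \<Rightarrow> real" where
  "par_E c k = k\<^sup>2 * (c - 2 * k\<^sup>2) / (2 * c)"

definition omega0 :: "real \<Rightarrow> real \<Rightarrow> real" where
  "omega0 c k = - 9 * par_a c k powr (-2/3)"

definition omega1 :: "real \<Rightarrow> real \<Rightarrow> real" where
  "omega1 c k = 9 * c * par_a c k powr (-4/3) * (2 * par_E c k + c)"

definition solitary_profile :: "real \<Rightarrow> real \<Rightarrow> (real \<Rightarrow> real) \<Rightarrow> bool" where
  "solitary_profile c k \<phi> \<longleftrightarrow>
     smooth \<phi> \<and>
     \<not> (\<exists>d. \<forall>x. \<phi> x = d) \<and>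
     (\<forall>x. \<phi> (- x) = \<phi> x) \<and>
     deriv \<phi> 0 = 0 \<and>
     (\<exists>C \<delta>. \<delta> > 0 \<and> (\<forall>x. \<bar>\<phi> x - k\<bar> \<le> C * exp (- \<delta> * \<bar>x\<bar>))) \<and>
     (\<forall>n\<ge>1. ((deriv ^^ n) \<phi> \<longlongrightarrow> 0) at_top \<and> ((deriv ^^ n) \<phi> \<longlongrightarrow> 0) at_bot) \<and>
     (\<forall>x. (\<phi> x)\<^sup>2 < c) \<and>
     (\<forall>x. \<phi> x - deriv (deriv \<phi>) x = par_a c k * (c - (\<phi> x)\<^sup>2) powr (-3/2))"

definition momentum :: "(real \<Rightarrow> real) \<Rightarrow> real \<Rightarrow> real" where
  "momentum \<phi> x = \<phi> x - deriv (deriv \<phi>) x"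

definition novikov_L :: "real \<Rightarrow> real \<Rightarrow> (real \<Rightarrow> real) \<Rightarrow> L2 \<Rightarrow> L2" where
  "novikov_L c k \<phi> u =
     (let \<mu> = momentum \<phi>; \<mu>' = deriv \<mu>; \<mu>'' = deriv (deriv \<mu>) in
      (2/3) *\<^sub>R
        ((-3) *\<^sub>R Dx (mult_op (\<lambda>x. \<mu> x powr (-8/3)) (Dx u))
         + mult_op (\<lambda>x. 8 * \<mu>'' x * \<mu> x powr (-11/3)
                        - 44/3 * (\<mu>' x)\<^sup>2 * \<mu> x powr (-14/3)
                        + 15 * \<mu> x powr (-8/3)) u)
      - (2 * omega1 c k / 9) *\<^sub>R mult_op (\<lambda>x. \<mu> x powr (-4/3)) u
      + (2 * omega0 c k) *\<^sub>R inv_helmholtz u)"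

definition sigma0 :: "real \<Rightarrow> real \<Rightarrow> real" where
  "sigma0 c k = 8 * (c - 4 * k\<^sup>2) / (k powr (8/3) * (c - k\<^sup>2))"

end

theory Submission
  imports Defs
begin

text \<open>
  Let \<open>G = (1 - \<partial>\<^sub>x\<^sup>2)\<^sup>-\<^sup>1\<close>, which maps \<open>L\<^sup>2\<close> bijectively onto \<open>H\<^sup>2\<close>. Writing \<open>u = G f\<close> and
  \<open>p = \<mu> powr (-8/3)\<close> turns \<open>(L - z) u\<close> into \<open>2 p (f + \<beta> G f + \<gamma> G\<^sup>2 f + K f)\<close>, where \<open>\<beta>\<close> and \<open>\<gamma>\<close> come
  from the limits of the coefficients at infinity and \<open>K\<close> is a sum of operators
  ``coefficient vanishing at infinity times convolution'', hence a norm limit of operators of finite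
  rank. Factoring \<open>1 + \<beta> t + \<gamma> t\<^sup>2 = (1 - r\<^sub>1 t) (1 - r\<^sub>2 t)\<close>, each \<open>1 - r G\<close> has the explicit inverse
  \<open>1 + r (1 - r - \<partial>\<^sub>x\<^sup>2)\<^sup>-\<^sup>1\<close> unless \<open>r\<close> is real and at least \<open>1\<close>, and a root \<open>r = 1 + \<xi>\<^sup>2\<close> means that \<open>z\<close> is
  the value at \<open>\<xi>\<close> of the symbol \<open>2 k powr (-8/3) \<xi>\<^sup>2 + q\<^sub>\<infinity> + 2 \<omega>\<^sub>0 / (1 + \<xi>\<^sup>2)\<close>, whose range is \<open>[\<sigma>\<^sub>0, \<infinity>)\<close>.
  So off that half-line \<open>L - z\<close> is Fredholm of index zero. On it, translated wave packets form a Weyl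
  sequence; they can be moved far enough out to be almost orthogonal to any given finite set, so by
  symmetry of \<open>L\<close> and uniform boundedness the range of \<open>L - z\<close> has infinite codimension.
\<close>

section \<open>The space \<open>L\<^sup>2\<close>\<close>

text \<open>No Fourier transform enters. Since the coefficients vary, \<open>L - z\<close> is not a
  Fourier multiplier; its constant-coefficient limit is one, and it is inverted by Green kernels
  \<open>exp (- s |t|) / (2 s)\<close> with complex \<open>s\<close>. The duality used throughout is
  a bilinear pairing without conjugation: test functions and coefficients are real, so
  multiplications and \<open>L\<close> are symmetric for it, while kernels and \<open>z\<close> may
  be complex. As a function of \<open>x = 1 + \<xi>^2\<close> the symbol is
  \<open>2 p_inf (x - 1) + q_inf + 2 omega0 / x\<close>. Because \<open>omega0 < 0\<close> it
  increases on \<open>x \<ge> 1\<close>, and its value at \<open>x = 1\<close> is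
  \<open>sigma0\<close>; this is where the constant of the theorem comes from. Codimension is
  algebraic, so the index has to be read off from complements. Parametrizing the domain by a
  bijection from \<open>L2\<close> and correcting that bijection until only a finite-rank operator
  is added to the identity leaves a problem in finite dimension. In the converse direction a Weyl
  sequence alone would leave open which Fredholm condition fails; aiming at infinite codimension
  settles this without deciding whether the range is closed.\<close>

lemma square_integrable_rep_L2: "square_integrable (rep_L2 u)"
  using Quotient3_rep_reflp[OF Quotient3_L2] by (simp add: L2_eq_def)

lemma abs_rep_L2 [simp]: "abs_L2 (rep_L2 u) = u"
  using Quotient3_abs_rep[OF Quotient3_L2] .

lemma L2_eq_iff_abs:
  "L2_eq f g \<longleftrightarrow> square_integrable f \<and> square_integrable g \<and> abs_L2 f = abs_L2 g"
  using Quotient3_rel[OF Quotient3_L2, of f g] by (auto simp: L2_eq_def)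

lemma AE_rep_abs_L2:
  assumes "square_integrable f"
  shows "AE x in lborel. rep_L2 (abs_L2 f) x = f x"
  using L2_eq_iff_abs[of "rep_L2 (abs_L2 f)" f] assms square_integrable_rep_L2
  by (auto simp: L2_eq_def)

lemma abs_L2_eqI:
  assumes "square_integrable f" "square_integrable g" "AE x in lborel. f x = g x"
  shows "abs_L2 f = abs_L2 g"
  using assms L2_eq_iff_abs by (auto simp: L2_eq_def)

lemma L2_eqI: "AE x in lborel. rep_L2 u x = rep_L2 v x \<Longrightarrow> u = v"
  using abs_L2_eqI[OF square_integrable_rep_L2 square_integrable_rep_L2, of u v] by simp

lemma square_integrable_measurable [measurable_dest]:
  "square_integrable f \<Longrightarrow> f \<in> borel_measurable borel"
  by (simp add: square_integrable_def)

lemma rep_L2_measurable [measurable]: "rep_L2 u \<in> borel_measurable borel"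
  using square_integrable_rep_L2 square_integrable_measurable by blast

lemma integrable_square_rep_L2: "integrable lborel (\<lambda>x. (cmod (rep_L2 u x))\<^sup>2)"
  using square_integrable_rep_L2[of u] by (simp add: square_integrable_def)

lemma abs_L2_add:
  "square_integrable f \<Longrightarrow> square_integrable g \<Longrightarrow> abs_L2 f + abs_L2 g = abs_L2 (\<lambda>x. f x + g x)"
  by (rule plus_L2.abs_eq) (auto simp: L2_eq_def)

lemma abs_L2_diff:
  "square_integrable f \<Longrightarrow> square_integrable g \<Longrightarrow> abs_L2 f - abs_L2 g = abs_L2 (\<lambda>x. f x - g x)"
  by (rule minus_L2.abs_eq) (auto simp: L2_eq_def)

lemma abs_L2_scaleC: "square_integrable f \<Longrightarrow> z *\<^sub>C abs_L2 f = abs_L2 (\<lambda>x. z * f x)"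
  by (rule scaleC.abs_eq) (auto simp: L2_eq_def)

lemma abs_L2_zero: "abs_L2 (\<lambda>x. 0) = 0"
  by (simp add: zero_L2.abs_eq)

lemma AE_rep_L2_add: "AE x in lborel. rep_L2 (u + v) x = rep_L2 u x + rep_L2 v x"
  using AE_rep_abs_L2[OF square_integrable_add[OF square_integrable_rep_L2 square_integrable_rep_L2], of u v]
  by (simp add: abs_L2_add[symmetric] square_integrable_rep_L2)

lemma AE_rep_L2_diff: "AE x in lborel. rep_L2 (u - v) x = rep_L2 u x - rep_L2 v x"
  using AE_rep_abs_L2[OF square_integrable_diff[OF square_integrable_rep_L2 square_integrable_rep_L2], of u v]
  by (simp add: abs_L2_diff[symmetric] square_integrable_rep_L2)

lemma AE_rep_L2_scaleC: "AE x in lborel. rep_L2 (z *\<^sub>C u) x = z * rep_L2 u x"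
  using AE_rep_abs_L2[OF square_integrable_scale[OF square_integrable_rep_L2], of z u]
  by (simp add: abs_L2_scaleC[symmetric] square_integrable_rep_L2)

lemma AE_rep_L2_zero: "AE x in lborel. rep_L2 0 x = 0"
  using AE_rep_abs_L2[OF square_integrable_zero] by (simp add: abs_L2_zero)

lemma scaleR_L2_eq: "r *\<^sub>R (u :: L2) = complex_of_real r *\<^sub>C u"
  by (rule scaleR_L2_def)

lemma norm_L2_square: "(norm u)\<^sup>2 = (\<integral>x. (cmod (rep_L2 u x))\<^sup>2 \<partial>lborel)"
proof -
  have "(norm u)\<^sup>2 = inner u u" by (simp add: power2_norm_eq_inner)
  also have "\<dots> = (\<integral>x. Re (rep_L2 u x * cnj (rep_L2 u x)) \<partial>lborel)"
    by (simp add: inner_L2.rep_eq)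
  also have "\<dots> = (\<integral>x. (cmod (rep_L2 u x))\<^sup>2 \<partial>lborel)"
    by (rule Bochner_Integration.integral_cong) (auto simp: cmod_power2 simp flip: power2_eq_square)
  finally show ?thesis .
qed

lemma norm_abs_L2_square:
  assumes "square_integrable f"
  shows "(norm (abs_L2 f))\<^sup>2 = (\<integral>x. (cmod (f x))\<^sup>2 \<partial>lborel)"
  unfolding norm_L2_square
proof (rule integral_cong_AE)
  show "AE x in lborel. (cmod (rep_L2 (abs_L2 f) x))\<^sup>2 = (cmod (f x))\<^sup>2"
    using AE_rep_abs_L2[OF assms] by eventually_elim simp
qed (use assms in \<open>auto simp: square_integrable_def\<close>)

lemma norm_scaleC [simp]: "norm (z *\<^sub>C u) = cmod z * norm (u :: L2)"
proof -
  have "(norm (z *\<^sub>C u))\<^sup>2 = (norm (abs_L2 (\<lambda>x. z * rep_L2 u x)))\<^sup>2"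
    by (simp add: abs_L2_scaleC[symmetric] square_integrable_rep_L2)
  also have "\<dots> = (\<integral>x. (cmod (z * rep_L2 u x))\<^sup>2 \<partial>lborel)"
    by (rule norm_abs_L2_square) (simp add: square_integrable_scale square_integrable_rep_L2)
  also have "\<dots> = (cmod z * norm u)\<^sup>2"
    by (simp add: norm_mult power_mult_distrib norm_L2_square)
  finally show ?thesis by (simp add: power2_eq_iff_nonneg)
qed

lemma square_integrable_bound:
  assumes "square_integrable g" "f \<in> borel_measurable borel"
    and "AE x in lborel. cmod (f x) \<le> C * cmod (g x)"
  shows "square_integrable f"
proof -
  have [measurable]: "g \<in> borel_measurable borel" "f \<in> borel_measurable borel" using assms by auto
  have "integrable lborel (\<lambda>x. (cmod (f x))\<^sup>2)"
  proof (rule Bochner_Integration.integrable_bound)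
    show "integrable lborel (\<lambda>x. C\<^sup>2 * (cmod (g x))\<^sup>2)"
      using assms(1) by (simp add: square_integrable_def)
    show "AE x in lborel. norm ((cmod (f x))\<^sup>2) \<le> norm (C\<^sup>2 * (cmod (g x))\<^sup>2)"
      using assms(3)
    proof eventually_elim
      case (elim x)
      then have "(cmod (f x))\<^sup>2 \<le> (C * cmod (g x))\<^sup>2" by (intro power_mono) auto
      then show ?case by (simp add: power_mult_distrib)
    qed
  qed simp
  then show ?thesis using assms by (simp add: square_integrable_def)
qed

lemma norm_abs_L2_le:
  assumes "square_integrable f" "square_integrable g" "C \<ge> 0"
    and "AE x in lborel. cmod (f x) \<le> C * cmod (g x)"
  shows "norm (abs_L2 f) \<le> C * norm (abs_L2 g)"
proof -
  have [measurable]: "f \<in> borel_measurable borel" "g \<in> borel_measurable borel"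
    using assms by auto
  have "(norm (abs_L2 f))\<^sup>2 \<le> (C * norm (abs_L2 g))\<^sup>2"
    unfolding norm_abs_L2_square[OF assms(1)] power_mult_distrib norm_abs_L2_square[OF assms(2)]
      integral_mult_right_zero[symmetric]
  proof (rule integral_mono_AE)
    show "AE x in lborel. (cmod (f x))\<^sup>2 \<le> C\<^sup>2 * (cmod (g x))\<^sup>2"
      using assms(4) by eventually_elim (metis norm_ge_zero power_mono power_mult_distrib)
  qed (use assms in \<open>auto simp: square_integrable_def\<close>)
  then show ?thesis using assms(3) by (simp add: power2_le_iff_abs_le)
qed

lemma nn_integral_square_integrable:
  assumes "square_integrable f"
  shows "(\<integral>\<^sup>+x. ennreal ((cmod (f x))\<^sup>2) \<partial>lborel) = ennreal ((norm (abs_L2 f))\<^sup>2)"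
  using assms by (simp add: norm_abs_L2_square nn_integral_eq_integral square_integrable_def)

lemma square_integrable_nn_integral:
  assumes "f \<in> borel_measurable borel" "(\<integral>\<^sup>+x. ennreal ((cmod (f x))\<^sup>2) \<partial>lborel) \<le> ennreal C"
  shows "square_integrable f"
proof -
  have "(\<integral>\<^sup>+x. ennreal ((cmod (f x))\<^sup>2) \<partial>lborel) < \<infinity>" using assms(2) by (simp add: le_less_trans)
  with assms(1) show ?thesis
    by (auto simp: square_integrable_def intro!: integrableI_bounded)
qed

lemma norm_abs_L2_le_nn_integral:
  assumes "f \<in> borel_measurable borel" "C \<ge> 0"
    and "(\<integral>\<^sup>+x. ennreal ((cmod (f x))\<^sup>2) \<partial>lborel) \<le> ennreal (C\<^sup>2)"
  shows "square_integrable f" "norm (abs_L2 f) \<le> C"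
proof -
  show "square_integrable f" using square_integrable_nn_integral[OF assms(1,3)] .
  from nn_integral_square_integrable[OF this] assms(3)
  have "(norm (abs_L2 f))\<^sup>2 \<le> C\<^sup>2" by simp
  then show "norm (abs_L2 f) \<le> C" using assms(2) by (simp add: power2_le_iff_abs_le)
qed

text \<open>The Riesz-Fischer theorem. Completeness is used twice later: for the contraction
  principle in \<open>one_plus_small_invertible\<close> and for Baire's theorem in
  \<open>uniform_boundedness_inner\<close>.\<close>

instance L2 :: banach
proof
  fix X :: "nat \<Rightarrow> L2"
  assume X: "Cauchy X"
  have "\<exists>N. \<forall>m\<ge>N. \<forall>n\<ge>N. norm (X m - X n) < (1/4)^j" for j :: nat
    using X by (rule CauchyD) simp
  then obtain N where N: "\<And>j m n. m \<ge> N j \<Longrightarrow> n \<ge> N j \<Longrightarrow> norm (X m - X n) < (1/4)^j"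
    by metis
  \<comment> \<open>Partial sums dominate each \<open>N j\<close> and are monotone, which the chosen
    indices \<open>N j\<close> need not be.\<close>
  define r where "r j = (\<Sum>i\<le>j. N i)" for j
  have r_ge: "r j \<ge> N j" for j
    unfolding r_def by (rule member_le_sum) auto
  have r_mono: "r i \<le> r j" if "i \<le> j" for i j
    unfolding r_def using that by (intro sum_mono2) auto
  have rb: "norm (X (r j) - X (r i)) < (1/4)^i" if "i \<le> j" for i j
    using N[of i "r j" "r i"] r_ge[of i] r_mono[OF that] by linarith
  define f where "f j = rep_L2 (X (r j))" for j
  have sqf: "square_integrable (f j)" for j
    unfolding f_def by (rule square_integrable_rep_L2)
  have [measurable]: "f j \<in> borel_measurable borel" for j using sqf by auto
  have absf: "abs_L2 (f j) = X (r j)" for j by (simp add: f_def)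
  have nf: "(\<integral>\<^sup>+x. ennreal ((cmod (f j x - f i x))\<^sup>2) \<partial>lborel) \<le> ennreal ((1/16)^i)" if "i \<le> j" for i j
  proof -
    have "(\<integral>\<^sup>+x. ennreal ((cmod (f j x - f i x))\<^sup>2) \<partial>lborel) = ennreal ((norm (X (r j) - X (r i)))\<^sup>2)"
      using nn_integral_square_integrable[OF square_integrable_diff[OF sqf sqf], of j i]
      by (simp add: abs_L2_diff[symmetric] sqf absf)
    also have "\<dots> \<le> ennreal (((1/4)^i)\<^sup>2)"
      using rb[OF that] by (intro ennreal_leI power_mono) auto
    also have "((1/4)^i)\<^sup>2 = ((1/16)^i :: real)" by (simp add: power_mult_distrib[symmetric] power2_eq_square)
    finally show ?thesis .
  qed
  \<comment> \<open>the weights \<open>4^i\<close> make the increments at almost every point geometrically small\<close>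
  have "(\<integral>\<^sup>+x. (\<Sum>i. ennreal (4^i * (cmod (f (Suc i) x - f i x))\<^sup>2)) \<partial>lborel)
      = (\<Sum>i. \<integral>\<^sup>+x. ennreal (4^i * (cmod (f (Suc i) x - f i x))\<^sup>2) \<partial>lborel)"
    by (rule nn_integral_suminf) simp
  also have "\<dots> \<le> (\<Sum>i. ennreal ((1/4)^i))"
  proof (rule suminf_le)
    fix i
    have "(\<integral>\<^sup>+x. ennreal (4^i * (cmod (f (Suc i) x - f i x))\<^sup>2) \<partial>lborel)
        = ennreal (4^i) * (\<integral>\<^sup>+x. ennreal ((cmod (f (Suc i) x - f i x))\<^sup>2) \<partial>lborel)"
      by (subst nn_integral_cmult[symmetric]) (auto simp: ennreal_mult)
    also have "\<dots> \<le> ennreal (4^i) * ennreal ((1/16)^i)"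
      by (intro mult_left_mono nf) auto
    also have "\<dots> = ennreal ((1/4)^i)"
      by (simp add: ennreal_mult[symmetric] power_mult_distrib[symmetric])
    finally show "(\<integral>\<^sup>+x. ennreal (4^i * (cmod (f (Suc i) x - f i x))\<^sup>2) \<partial>lborel) \<le> ennreal ((1/4)^i)" .
  qed auto
  also have "\<dots> = ennreal (\<Sum>i. (1/4)^i)"
    by (rule suminf_ennreal2) (auto intro!: summable_geometric)
  finally have "(\<integral>\<^sup>+x. (\<Sum>i. ennreal (4^i * (cmod (f (Suc i) x - f i x))\<^sup>2)) \<partial>lborel) \<noteq> \<infinity>"
    by (auto simp: top_unique)
  then have "AE x in lborel. (\<Sum>i. ennreal (4^i * (cmod (f (Suc i) x - f i x))\<^sup>2)) \<noteq> \<infinity>"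
    by (intro nn_integral_PInf_AE) auto
  then have conv: "AE x in lborel. convergent (\<lambda>j. f j x)"
  proof eventually_elim
    case (elim x)
    have s: "summable (\<lambda>i. 4^i * (cmod (f (Suc i) x - f i x))\<^sup>2)"
      using elim by (intro summable_suminf_not_top) auto
    have "summable (\<lambda>i. f (Suc i) x - f i x)"
    proof (rule summable_comparison_test_ev)
      have "(\<lambda>i. 4^i * (cmod (f (Suc i) x - f i x))\<^sup>2) \<longlonglongrightarrow> 0" using s by (rule summable_LIMSEQ_zero)
      then have "eventually (\<lambda>i. 4^i * (cmod (f (Suc i) x - f i x))\<^sup>2 < 1) sequentially"
        by (rule order_tendstoD) simp
      then show "eventually (\<lambda>i. norm (f (Suc i) x - f i x) \<le> (1/2)^i) sequentially"
      proof eventually_elim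
        case (elim i)
        have "(4::real)^i = (2^i)\<^sup>2" by (simp add: power2_eq_square power_mult_distrib[symmetric])
        then have "(2^i * cmod (f (Suc i) x - f i x))\<^sup>2 \<le> 1\<^sup>2" using elim by (simp add: power_mult_distrib)
        then have "2^i * cmod (f (Suc i) x - f i x) \<le> 1" by (rule power2_le_imp_le) simp
        then show ?case by (simp add: power_one_over field_simps)
      qed
    qed (auto intro!: summable_geometric)
    then have "convergent (\<lambda>n. \<Sum>i<n. f (Suc i) x - f i x)" by (simp add: summable_iff_convergent)
    then have "convergent (\<lambda>n. f n x - f 0 x)"
      by (simp only: sum_lessThan_telescope[of "\<lambda>i. f i x"])
    then show ?case by (simp only: convergent_diff_const_right_iff)
  qed
  \<comment> \<open>Where the sequence diverges, \<open>lim\<close> is some unspecified value; this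
    concerns only a null set.\<close>
  define F where "F x = lim (\<lambda>j. f j x)" for x
  have [measurable]: "F \<in> borel_measurable borel"
    unfolding F_def by (rule borel_measurable_lim_metric) simp
  have lim: "AE x in lborel. (\<lambda>j. f j x) \<longlonglongrightarrow> F x"
    using conv by eventually_elim (simp add: F_def convergent_LIMSEQ_iff)
  \<comment> \<open>Fatou's lemma carries the Cauchy estimate over to the limit in
    \<open>j\<close>.\<close>
  have b: "(\<integral>\<^sup>+x. ennreal ((cmod (F x - f i x))\<^sup>2) \<partial>lborel) \<le> ennreal (((1/4)^i)\<^sup>2)" for i
  proof -
    have "(\<integral>\<^sup>+x. ennreal ((cmod (F x - f i x))\<^sup>2) \<partial>lborel)
        = (\<integral>\<^sup>+x. liminf (\<lambda>j. ennreal ((cmod (f j x - f i x))\<^sup>2)) \<partial>lborel)"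
    proof (rule nn_integral_cong_AE)
      show "AE x in lborel. ennreal ((cmod (F x - f i x))\<^sup>2) = liminf (\<lambda>j. ennreal ((cmod (f j x - f i x))\<^sup>2))"
        using lim
      proof eventually_elim
        case (elim x)
        have "(\<lambda>j. ennreal ((cmod (f j x - f i x))\<^sup>2)) \<longlonglongrightarrow> ennreal ((cmod (F x - f i x))\<^sup>2)"
          by (intro tendsto_ennrealI tendsto_intros elim)
        from lim_imp_Liminf[OF _ this] show ?case by simp
      qed
    qed
    also have "\<dots> \<le> liminf (\<lambda>j. \<integral>\<^sup>+x. ennreal ((cmod (f j x - f i x))\<^sup>2) \<partial>lborel)"
      by (rule nn_integral_liminf) simp
    also have "\<dots> \<le> ennreal ((1/16)^i)"
    proof (rule Liminf_le)
      show "eventually (\<lambda>j. (\<integral>\<^sup>+x. ennreal ((cmod (f j x - f i x))\<^sup>2) \<partial>lborel) \<le> ennreal ((1/16)^i)) sequentially"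
        using eventually_ge_at_top[of i] by eventually_elim (rule nf)
    qed simp
    also have "(1/16)^i = (((1/4)^i)\<^sup>2 :: real)" by (simp add: power_mult_distrib[symmetric] power2_eq_square)
    finally show ?thesis .
  qed
  have d: "square_integrable (\<lambda>x. F x - f i x)" "norm (abs_L2 (\<lambda>x. F x - f i x)) \<le> (1/4)^i" for i
    using norm_abs_L2_le_nn_integral[OF _ _ b] by auto
  have sqF: "square_integrable F"
    using square_integrable_add[OF d(1) sqf, of 0 0] by simp
  have "norm (X (r i) - abs_L2 F) \<le> (1/4)^i" for i
    using d(2)[of i] by (simp add: abs_L2_diff[symmetric] sqf sqF absf norm_minus_commute)
  have "X \<longlonglongrightarrow> abs_L2 F"
  proof (rule LIMSEQ_I)
    fix e :: real assume "e > 0"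
    obtain i where i: "(1/4)^i < e/2" using real_arch_pow_inv[of "e/2" "1/4"] \<open>e > 0\<close> by auto
    have "norm (X n - abs_L2 F) < e" if "n \<ge> r i" for n
    proof -
      have "norm (X n - X (r i)) < (1/4)^i" using N[of i n "r i"] r_ge[of i] that by linarith
      moreover have "norm (X (r i) - abs_L2 F) \<le> (1/4)^i" by fact
      moreover have "norm (X n - abs_L2 F) \<le> norm (X n - X (r i)) + norm (X (r i) - abs_L2 F)"
        using norm_triangle_ineq[of "X n - X (r i)" "X (r i) - abs_L2 F"] by simp
      ultimately show ?thesis using i by linarith
    qed
    then show "\<exists>n0. \<forall>n\<ge>n0. norm (X n - abs_L2 F) < e" by blast
  qed
  then show "convergent X" by (rule convergentI)
qed


section \<open>Bounded operators and the bilinear pairing\<close>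

text \<open>The type class structure of \<open>L2\<close> is real, whereas spans, dimensions and
  complements are taken over the complex numbers, so complex linearity is asked for
  separately.\<close>

definition bounded_clinear :: "(L2 \<Rightarrow> L2) \<Rightarrow> bool" where
  "bounded_clinear A \<longleftrightarrow>
     (\<forall>u v. A (u + v) = A u + A v) \<and> (\<forall>z u. A (z *\<^sub>C u) = z *\<^sub>C A u) \<and>
     (\<exists>C. \<forall>u. norm (A u) \<le> C * norm u)"

lemma bounded_clinearI:
  assumes "\<And>u v. A (u + v) = A u + A v" "\<And>z u. A (z *\<^sub>C u) = z *\<^sub>C A u"
    "\<And>u. norm (A u) \<le> C * norm u"
  shows "bounded_clinear A"
  using assms unfolding bounded_clinear_def by blast

lemma bounded_clinear_add: "bounded_clinear A \<Longrightarrow> A (u + v) = A u + A v"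
  and bounded_clinear_scaleC: "bounded_clinear A \<Longrightarrow> A (z *\<^sub>C u) = z *\<^sub>C A u"
  by (auto simp: bounded_clinear_def)

lemma bounded_clinear_bounded_linear: "bounded_clinear A \<Longrightarrow> bounded_linear A"
  unfolding bounded_clinear_def
  by (metis bounded_linear_intro scaleR_L2_eq mult.commute)

lemma bounded_clinear_diff: "bounded_clinear A \<Longrightarrow> A (u - v) = A u - A v"
  by (simp add: bounded_clinear_bounded_linear linear_diff bounded_linear.linear)

lemma bounded_clinear_zero: "bounded_clinear A \<Longrightarrow> A 0 = 0"
  by (simp add: bounded_clinear_bounded_linear linear_0 bounded_linear.linear)

lemma bounded_clinear_linear: "bounded_clinear A \<Longrightarrow> Vector_Spaces.linear scaleC scaleC A"
  by unfold_locales (auto simp: bounded_clinear_def)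

lemma bounded_clinear_bound:
  assumes "bounded_clinear A"
  obtains C where "C > 0" "\<And>u. norm (A u) \<le> C * norm u"
proof -
  from assms obtain C where C: "\<And>u. norm (A u) \<le> C * norm u" by (auto simp: bounded_clinear_def)
  have "norm (A u) \<le> (\<bar>C\<bar> + 1) * norm u" for u
    by (rule order_trans[OF C]) (intro mult_right_mono, auto)
  then show ?thesis by (rule that[rotated]) simp
qed

lemma bounded_clinear_id: "bounded_clinear (\<lambda>u. u)"
  by (rule bounded_clinearI[of _ 1]) auto

lemma bounded_clinear_compose:
  assumes "bounded_clinear A" "bounded_clinear B"
  shows "bounded_clinear (\<lambda>u. A (B u))"
proof -
  obtain C where C: "C > 0" "\<And>u. norm (A u) \<le> C * norm u" by (rule bounded_clinear_bound[OF assms(1)]) blast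
  obtain D where D: "D > 0" "\<And>u. norm (B u) \<le> D * norm u" by (rule bounded_clinear_bound[OF assms(2)]) blast
  show ?thesis
  proof (rule bounded_clinearI)
    show "norm (A (B u)) \<le> (C * D) * norm u" for u
      using C(2)[of "B u"] mult_left_mono[OF D(2)[of u], of C] C(1) by (simp only: mult.assoc) linarith
  qed (use assms in \<open>auto simp: bounded_clinear_add bounded_clinear_scaleC\<close>)
qed

lemma bounded_clinear_plus:
  assumes "bounded_clinear A" "bounded_clinear B"
  shows "bounded_clinear (\<lambda>u. A u + B u)"
proof -
  obtain C where C: "C > 0" "\<And>u. norm (A u) \<le> C * norm u" by (rule bounded_clinear_bound[OF assms(1)]) blast
  obtain D where D: "D > 0" "\<And>u. norm (B u) \<le> D * norm u" by (rule bounded_clinear_bound[OF assms(2)]) blast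
  show ?thesis
  proof (rule bounded_clinearI)
    show "norm (A u + B u) \<le> (C + D) * norm u" for u
      using C(2)[of u] D(2)[of u] norm_triangle_ineq[of "A u" "B u"] by (simp add: distrib_right)
  qed (use assms in \<open>auto simp: bounded_clinear_add bounded_clinear_scaleC L2.scale_right_distrib\<close>)
qed

lemma bounded_clinear_cmult: "bounded_clinear (\<lambda>u. z *\<^sub>C u)"
  by (rule bounded_clinearI[of _ "cmod z"]) (auto simp: L2.scale_right_distrib L2.scale_left_commute)

lemma bounded_clinear_scale: "bounded_clinear A \<Longrightarrow> bounded_clinear (\<lambda>u. z *\<^sub>C A u)"
  using bounded_clinear_compose[OF bounded_clinear_cmult] .

lemma bounded_clinear_minus:
  assumes "bounded_clinear A" "bounded_clinear B"
  shows "bounded_clinear (\<lambda>u. A u - B u)"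
  using bounded_clinear_plus[OF assms(1) bounded_clinear_scale[OF assms(2), of "-1"]] by simp

text \<open>Bilinear on purpose: it is the pairing that occurs in \<open>weak_deriv\<close>, real
  multiplications are symmetric for it, and the transpose of a convolution only reflects the
  kernel.\<close>

definition cpair :: "L2 \<Rightarrow> L2 \<Rightarrow> complex" where
  "cpair u v = (\<integral>x. rep_L2 u x * rep_L2 v x \<partial>lborel)"

lemma integrable_mult_square_integrable:
  fixes f g :: "real \<Rightarrow> complex"
  assumes "square_integrable f" "square_integrable g"
  shows "integrable lborel (\<lambda>x. f x * g x)"
proof (rule Bochner_Integration.integrable_bound)
  show "integrable lborel (\<lambda>x. (cmod (f x))\<^sup>2 + (cmod (g x))\<^sup>2)"
    using assms by (auto simp: square_integrable_def)
  show "(\<lambda>x. f x * g x) \<in> borel_measurable lborel"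
    using assms by (auto simp: square_integrable_def)
  have "cmod (f x) * cmod (g x) \<le> (cmod (f x))\<^sup>2 + (cmod (g x))\<^sup>2" for x
    using sum_squares_bound[of "cmod (f x)" "cmod (g x)"]
      mult_nonneg_nonneg[OF norm_ge_zero norm_ge_zero, of "f x" "g x"] by linarith
  then show "AE x in lborel. norm (f x * g x) \<le> norm ((cmod (f x))\<^sup>2 + (cmod (g x))\<^sup>2)"
    by (auto simp: norm_mult)
qed

text \<open>The real inner product applied to the moduli. The integral of moduli, rather than the
  modulus of the integral, is what the weighted kernel estimate for convolutions needs.\<close>

lemma Cauchy_Schwarz_abs_L2:
  assumes "square_integrable f" "square_integrable g"
  shows "(\<integral>x. cmod (f x) * cmod (g x) \<partial>lborel) \<le> norm (abs_L2 f) * norm (abs_L2 g)"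
proof -
  have s: "square_integrable (\<lambda>x. complex_of_real (cmod (h x)))"
    "norm (abs_L2 (\<lambda>x. complex_of_real (cmod (h x)))) = norm (abs_L2 h)" if "square_integrable h" for h
  proof -
    have [measurable]: "h \<in> borel_measurable borel" using that by auto
    show 1: "square_integrable (\<lambda>x. complex_of_real (cmod (h x)))"
      using that by (auto simp: square_integrable_def)
    have "(norm (abs_L2 (\<lambda>x. complex_of_real (cmod (h x)))))\<^sup>2 = (norm (abs_L2 h))\<^sup>2"
      by (simp add: norm_abs_L2_square[OF 1] norm_abs_L2_square[OF that])
    then show "norm (abs_L2 (\<lambda>x. complex_of_real (cmod (h x)))) = norm (abs_L2 h)"
      by (simp add: power2_eq_iff_nonneg)
  qed
  have "inner (abs_L2 (\<lambda>x. complex_of_real (cmod (f x)))) (abs_L2 (\<lambda>x. complex_of_real (cmod (g x))))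
    = (\<integral>x. cmod (f x) * cmod (g x) \<partial>lborel)"
    by (subst inner_L2.abs_eq) (auto simp: L2_eq_def s assms)
  then show ?thesis
    using norm_cauchy_schwarz[of "abs_L2 (\<lambda>x. complex_of_real (cmod (f x)))" "abs_L2 (\<lambda>x. complex_of_real (cmod (g x)))"]
    by (simp add: s assms)
qed

lemma norm_integral_mult_le:
  assumes "square_integrable f" "square_integrable g"
  shows "cmod (\<integral>x. f x * g x \<partial>lborel) \<le> norm (abs_L2 f) * norm (abs_L2 g)"
  using integral_norm_bound[of lborel "\<lambda>x. f x * g x"] Cauchy_Schwarz_abs_L2[OF assms]
  by (simp add: norm_mult)

lemma norm_cpair_le: "cmod (cpair u v) \<le> norm u * norm v"
  using norm_integral_mult_le[OF square_integrable_rep_L2 square_integrable_rep_L2, of u v]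
  by (simp add: cpair_def)

lemma cpair_abs_left:
  assumes "square_integrable f"
  shows "cpair (abs_L2 f) v = (\<integral>x. f x * rep_L2 v x \<partial>lborel)"
  unfolding cpair_def
proof (rule integral_cong_AE)
  show "AE x in lborel. rep_L2 (abs_L2 f) x * rep_L2 v x = f x * rep_L2 v x"
    using AE_rep_abs_L2[OF assms] by eventually_elim simp
qed (use assms in auto)

lemma cpair_commute: "cpair u v = cpair v u"
  by (simp add: cpair_def mult.commute)

lemma cpair_abs_abs:
  assumes "square_integrable f" "square_integrable g"
  shows "cpair (abs_L2 f) (abs_L2 g) = (\<integral>x. f x * g x \<partial>lborel)"
proof -
  have "cpair (abs_L2 f) (abs_L2 g) = (\<integral>x. f x * rep_L2 (abs_L2 g) x \<partial>lborel)"
    by (rule cpair_abs_left[OF assms(1)])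
  also have "\<dots> = (\<integral>x. f x * g x \<partial>lborel)"
  proof (rule integral_cong_AE)
    show "AE x in lborel. f x * rep_L2 (abs_L2 g) x = f x * g x"
      using AE_rep_abs_L2[OF assms(2)] by eventually_elim simp
  qed (use assms in auto)
  finally show ?thesis .
qed

lemma cpair_add_right: "cpair u (v + w) = cpair u v + cpair u w"
proof -
  have "cpair u (v + w) = (\<integral>x. rep_L2 u x * rep_L2 v x + rep_L2 u x * rep_L2 w x \<partial>lborel)"
    unfolding cpair_def
  proof (rule integral_cong_AE)
    show "AE x in lborel. rep_L2 u x * rep_L2 (v + w) x = rep_L2 u x * rep_L2 v x + rep_L2 u x * rep_L2 w x"
      using AE_rep_L2_add[of v w] by eventually_elim (simp add: distrib_left)
  qed auto
  then show ?thesis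
    by (simp add: cpair_def integrable_mult_square_integrable square_integrable_rep_L2)
qed

lemma cpair_scaleC_right: "cpair u (z *\<^sub>C v) = z * cpair u v"
proof -
  have "cpair u (z *\<^sub>C v) = (\<integral>x. z * (rep_L2 u x * rep_L2 v x) \<partial>lborel)"
    unfolding cpair_def
  proof (rule integral_cong_AE)
    show "AE x in lborel. rep_L2 u x * rep_L2 (z *\<^sub>C v) x = z * (rep_L2 u x * rep_L2 v x)"
      using AE_rep_L2_scaleC[of z v] by eventually_elim simp
  qed auto
  then show ?thesis by (simp add: cpair_def)
qed

lemma cpair_diff_right: "cpair u (v - w) = cpair u v - cpair u w"
  using cpair_add_right[of u v "(-1) *\<^sub>C w"] by (simp only: cpair_scaleC_right) simp

lemma cpair_add_left: "cpair (u + v) w = cpair u w + cpair v w"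
  and cpair_scaleC_left: "cpair (z *\<^sub>C u) w = z * cpair u w"
  and cpair_diff_left: "cpair (u - v) w = cpair u w - cpair v w"
  by (simp_all add: cpair_commute[of _ w] cpair_add_right cpair_scaleC_right cpair_diff_right)

lemmas cpair_simps = cpair_add_left cpair_add_right cpair_diff_left cpair_diff_right
  cpair_scaleC_left cpair_scaleC_right

section \<open>Multiplication by bounded real functions\<close>

definition multiplier :: "(real \<Rightarrow> real) \<Rightarrow> bool" where
  "multiplier m \<longleftrightarrow> m \<in> borel_measurable borel \<and> (\<exists>C. \<forall>x. \<bar>m x\<bar> \<le> C)"

lemma multiplierE:
  assumes "multiplier m"
  obtains C where "C > 0" "\<And>x. \<bar>m x\<bar> \<le> C"
proof -
  from assms obtain C where C: "\<And>x. \<bar>m x\<bar> \<le> C" by (auto simp: multiplier_def)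
  have "\<bar>m x\<bar> \<le> \<bar>C\<bar> + 1" for x using C[of x] by linarith
  then show ?thesis by (rule that[rotated]) simp
qed

lemma multiplier_measurable [measurable_dest]: "multiplier m \<Longrightarrow> m \<in> borel_measurable borel"
  by (simp add: multiplier_def)

lemma multiplier_const: "multiplier (\<lambda>x. r)"
  by (auto simp: multiplier_def)

lemma multiplier_indicator: "A \<in> sets borel \<Longrightarrow> multiplier (indicator A)"
  unfolding multiplier_def by (intro conjI exI[of _ 1]) (auto simp: indicator_def)

lemma multiplier_add: "multiplier m \<Longrightarrow> multiplier n \<Longrightarrow> multiplier (\<lambda>x. m x + n x)"
proof -
  assume m: "multiplier m" "multiplier n"
  then obtain C D where "\<And>x. \<bar>m x\<bar> \<le> C" "\<And>x. \<bar>n x\<bar> \<le> D" by (auto simp: multiplier_def)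
  then have "\<bar>m x + n x\<bar> \<le> C + D" for x by (meson abs_triangle_ineq add_mono order_trans)
  then show ?thesis using m by (auto simp: multiplier_def)
qed

lemma multiplier_mult: "multiplier m \<Longrightarrow> multiplier n \<Longrightarrow> multiplier (\<lambda>x. m x * n x)"
proof -
  assume m: "multiplier m" "multiplier n"
  then obtain C D where "C > 0" "\<And>x. \<bar>m x\<bar> \<le> C" "\<And>x. \<bar>n x\<bar> \<le> D" by (metis multiplierE)
  then have "\<bar>m x * n x\<bar> \<le> C * D" for x unfolding abs_mult by (intro mult_mono) auto
  then show ?thesis using m by (auto simp: multiplier_def)
qed

lemma multiplier_diff: "multiplier m \<Longrightarrow> multiplier n \<Longrightarrow> multiplier (\<lambda>x. m x - n x)"
  using multiplier_add[OF _ multiplier_mult[OF multiplier_const, of n "-1"]] by simp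

lemma square_integrable_multiplier:
  assumes "multiplier m" "square_integrable f"
  shows "square_integrable (\<lambda>x. complex_of_real (m x) * f x)"
proof -
  have [measurable]: "m \<in> borel_measurable borel" "f \<in> borel_measurable borel" using assms by auto
  obtain C where "C > 0" "\<And>x. \<bar>m x\<bar> \<le> C" by (rule multiplierE[OF assms(1)]) blast
  then show ?thesis
    by (intro square_integrable_bound[OF assms(2), of _ C]) (auto simp: norm_mult intro!: mult_right_mono)
qed

lemma AE_rep_mult_op:
  "multiplier m \<Longrightarrow> AE x in lborel. rep_L2 (mult_op m u) x = complex_of_real (m x) * rep_L2 u x"
  unfolding mult_op_def
  by (intro AE_rep_abs_L2 square_integrable_multiplier square_integrable_rep_L2)

lemma mult_op_abs:
  assumes "multiplier m" "square_integrable f"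
  shows "mult_op m (abs_L2 f) = abs_L2 (\<lambda>x. complex_of_real (m x) * f x)"
  unfolding mult_op_def
proof (rule abs_L2_eqI)
  show "AE x in lborel. complex_of_real (m x) * rep_L2 (abs_L2 f) x = complex_of_real (m x) * f x"
    using AE_rep_abs_L2[OF assms(2)] by eventually_elim simp
qed (auto intro!: square_integrable_multiplier assms square_integrable_rep_L2)

lemma norm_mult_op_le:
  assumes "multiplier m" "C \<ge> 0" "\<And>x. \<bar>m x\<bar> \<le> C"
  shows "norm (mult_op m u) \<le> C * norm u"
  using norm_abs_L2_le[OF square_integrable_multiplier[OF assms(1) square_integrable_rep_L2[of u]]
      square_integrable_rep_L2[of u] assms(2)] assms(3)
  by (simp add: mult_op_def norm_mult mult_right_mono)

lemma bounded_clinear_mult_op: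
  assumes "multiplier m"
  shows "bounded_clinear (mult_op m)"
proof -
  obtain C where C: "C > 0" "\<And>x. \<bar>m x\<bar> \<le> C" by (rule multiplierE[OF assms(1)]) blast
  show ?thesis
  proof (rule bounded_clinearI)
    show "norm (mult_op m u) \<le> C * norm u" for u
      using C by (intro norm_mult_op_le assms) auto
    show "mult_op m (u + v) = mult_op m u + mult_op m v" for u v
    proof (rule L2_eqI)
      show "AE x in lborel. rep_L2 (mult_op m (u + v)) x = rep_L2 (mult_op m u + mult_op m v) x"
        using AE_rep_mult_op[OF assms, of "u + v"] AE_rep_mult_op[OF assms, of u]
          AE_rep_mult_op[OF assms, of v] AE_rep_L2_add[of u v] AE_rep_L2_add[of "mult_op m u" "mult_op m v"]
        by eventually_elim (simp add: distrib_left)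
    qed
    show "mult_op m (z *\<^sub>C u) = z *\<^sub>C mult_op m u" for z u
    proof (rule L2_eqI)
      show "AE x in lborel. rep_L2 (mult_op m (z *\<^sub>C u)) x = rep_L2 (z *\<^sub>C mult_op m u) x"
        using AE_rep_mult_op[OF assms, of "z *\<^sub>C u"] AE_rep_mult_op[OF assms, of u]
          AE_rep_L2_scaleC[of z u] AE_rep_L2_scaleC[of z "mult_op m u"]
        by eventually_elim simp
    qed
  qed
qed

lemma mult_op_mult_op:
  assumes "multiplier m" "multiplier n"
  shows "mult_op m (mult_op n u) = mult_op (\<lambda>x. m x * n x) u"
proof (rule L2_eqI)
  show "AE x in lborel. rep_L2 (mult_op m (mult_op n u)) x = rep_L2 (mult_op (\<lambda>x. m x * n x) u) x"
    using AE_rep_mult_op[OF assms(1), of "mult_op n u"] AE_rep_mult_op[OF assms(2), of u]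
      AE_rep_mult_op[OF multiplier_mult[OF assms], of u]
    by eventually_elim simp
qed

lemma mult_op_add_left:
  assumes "multiplier m" "multiplier n"
  shows "mult_op (\<lambda>x. m x + n x) u = mult_op m u + mult_op n u"
proof (rule L2_eqI)
  show "AE x in lborel. rep_L2 (mult_op (\<lambda>x. m x + n x) u) x = rep_L2 (mult_op m u + mult_op n u) x"
    using AE_rep_mult_op[OF assms(1), of u] AE_rep_mult_op[OF assms(2), of u]
      AE_rep_mult_op[OF multiplier_add[OF assms], of u] AE_rep_L2_add[of "mult_op m u" "mult_op n u"]
    by eventually_elim (simp add: distrib_right)
qed

lemma mult_op_const: "mult_op (\<lambda>x. r) u = complex_of_real r *\<^sub>C u"
  by (simp add: mult_op_def abs_L2_scaleC[symmetric] square_integrable_rep_L2)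

lemma cpair_mult_op:
  assumes "multiplier m"
  shows "cpair (mult_op m u) v = cpair u (mult_op m v)"
  unfolding cpair_def
proof (rule integral_cong_AE)
  show "AE x in lborel. rep_L2 (mult_op m u) x * rep_L2 v x = rep_L2 u x * rep_L2 (mult_op m v) x"
    using AE_rep_mult_op[OF assms, of u] AE_rep_mult_op[OF assms, of v]
    by eventually_elim (simp add: ac_simps)
qed auto

section \<open>Smooth functions and test functions\<close>

text \<open>To show smoothness it suffices to exhibit a class of differentiable functions that
  contains \<open>f\<close> and is closed under \<open>deriv\<close>; no formula for higher
  derivatives is needed.\<close>

lemma smooth_coinduct:
  assumes "P f" and "\<And>f x. P f \<Longrightarrow> f differentiable (at x)" and "\<And>f. P f \<Longrightarrow> P (deriv f)"
  shows "smooth f"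
proof -
  have "P ((deriv ^^ n) f)" for n by (induction n) (auto intro: assms)
  then show ?thesis using assms(2) unfolding smooth_def by blast
qed

lemma smooth_deriv: "smooth f \<Longrightarrow> smooth (deriv f)"
  unfolding smooth_def
proof (intro allI)
  fix n x assume "\<forall>n x. (deriv ^^ n) f differentiable (at x)"
  then show "(deriv ^^ n) (deriv f) differentiable (at x)"
    using funpow_Suc_right[of n deriv] by (metis comp_apply)
qed

lemma smooth_has_deriv: "smooth f \<Longrightarrow> (f has_real_derivative deriv f x) (at x)"
  unfolding smooth_def by (metis DERIV_deriv_iff_real_differentiable funpow_0)

lemma smooth_continuous: "smooth f \<Longrightarrow> continuous_on A f"
  by (meson DERIV_isCont continuous_at_imp_continuous_on smooth_has_deriv)

lemma smooth_measurable [measurable_dest]: "smooth f \<Longrightarrow> f \<in> borel_measurable borel"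
  by (intro borel_measurable_continuous_onI smooth_continuous)

lemma deriv_eqI:
  assumes "\<And>x. (f has_real_derivative f' x) (at x)"
  shows "deriv f = f'"
  using assms by (intro ext DERIV_imp_deriv) auto

lemma smooth_add:
  assumes "smooth f" "smooth g"
  shows "smooth (\<lambda>x. f x + g x)"
proof (rule smooth_coinduct[where P = "\<lambda>h. \<exists>f g. smooth f \<and> smooth g \<and> h = (\<lambda>x. f x + g x)"])
  fix h assume "\<exists>f g. smooth f \<and> smooth g \<and> h = (\<lambda>x. f x + g x)"
  then obtain f g where h: "smooth f" "smooth g" "h = (\<lambda>x. f x + g x)" by blast
  have d: "(h has_real_derivative deriv f x + deriv g x) (at x)" for x
    unfolding h(3) by (intro derivative_intros smooth_has_deriv h)
  then show "h differentiable (at x)" for x using real_differentiable_def by blast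
  show "\<exists>f g. smooth f \<and> smooth g \<and> deriv h = (\<lambda>x. f x + g x)"
    using deriv_eqI[OF d] smooth_deriv h by blast
qed (use assms in blast)

text \<open>Products alone are not closed under differentiation, but finite sums of products are.
  This is the invariant for \<open>smooth_coinduct\<close> and replaces the general Leibniz
  formula.\<close>

inductive sum_of_products :: "(real \<Rightarrow> real) \<Rightarrow> bool" where
  prod: "smooth f \<Longrightarrow> smooth g \<Longrightarrow> sum_of_products (\<lambda>x. f x * g x)"
| add: "sum_of_products f \<Longrightarrow> sum_of_products g \<Longrightarrow> sum_of_products (\<lambda>x. f x + g x)"

lemma sum_of_products_deriv:
  assumes "sum_of_products h"
  shows "\<exists>h'. (\<forall>x. (h has_real_derivative h' x) (at x)) \<and> sum_of_products h'"
  using assms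
proof induction
  case (prod f g)
  have "((\<lambda>x. f x * g x) has_real_derivative deriv f x * g x + f x * deriv g x) (at x)" for x
    using DERIV_mult[OF smooth_has_deriv[OF prod(1)] smooth_has_deriv[OF prod(2)]]
    by (simp add: mult.commute)
  moreover have "sum_of_products (\<lambda>x. deriv f x * g x + f x * deriv g x)"
    by (intro sum_of_products.intros smooth_deriv prod)
  ultimately show ?case by (intro exI conjI allI)
next
  case (add f g)
  then obtain f' g' where "\<And>x. (f has_real_derivative f' x) (at x)" "\<And>x. (g has_real_derivative g' x) (at x)"
    "sum_of_products f'" "sum_of_products g'" by blast
  then show ?case by (intro exI[of _ "\<lambda>x. f' x + g' x"]) (auto intro!: DERIV_add sum_of_products.add)
qed

lemma smooth_mult:
  assumes "smooth f" "smooth g"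
  shows "smooth (\<lambda>x. f x * g x)"
proof (rule smooth_coinduct[where P = sum_of_products])
  fix h assume "sum_of_products h"
  then obtain h' where h': "\<And>x. (h has_real_derivative h' x) (at x)" "sum_of_products h'"
    using sum_of_products_deriv by blast
  show "h differentiable (at x)" for x using h'(1) real_differentiable_def by blast
  show "sum_of_products (deriv h)" using deriv_eqI[OF h'(1)] h'(2) by simp
qed (intro prod assms)

lemma smooth_const: "smooth (\<lambda>x. r)"
proof (rule smooth_coinduct[where P = "\<lambda>h. \<exists>r. h = (\<lambda>x. r)"])
  show "\<exists>r. deriv h = (\<lambda>x. r)" if "\<exists>r. h = (\<lambda>x. r)" for h :: "real \<Rightarrow> real"
    using that by (auto intro!: exI[of _ 0] deriv_eqI)
qed auto

lemma smooth_cmult: "smooth f \<Longrightarrow> smooth (\<lambda>x. r * f x)"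
  by (rule smooth_mult[OF smooth_const])

lemma smooth_diff: "smooth f \<Longrightarrow> smooth g \<Longrightarrow> smooth (\<lambda>x. f x - g x)"
  using smooth_add[OF _ smooth_cmult[of g "-1"], of f] by simp

lemma has_deriv_affine:
  assumes "smooth f"
  shows "((\<lambda>x. f (a * x + b)) has_real_derivative a * deriv f (a * x + b)) (at x)"
proof -
  have "((\<lambda>x. a * x + b) has_real_derivative a) (at x)"
    by (auto intro!: derivative_eq_intros)
  from DERIV_chain2[OF smooth_has_deriv[OF assms] this] show ?thesis by (simp add: mult.commute)
qed

lemma smooth_affine:
  assumes "smooth f"
  shows "smooth (\<lambda>x. f (a * x + b))"
\<comment> \<open>The scalar \<open>r\<close> collects the factor \<open>a\<close> that each
  differentiation produces.\<close>
proof (rule smooth_coinduct[where P = "\<lambda>h. \<exists>r f. smooth f \<and> h = (\<lambda>x. r * f (a * x + b))"])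
  show "\<exists>r g. smooth g \<and> (\<lambda>x. f (a * x + b)) = (\<lambda>x. r * g (a * x + b))"
    using assms by (intro exI[of _ 1] exI[of _ f]) auto
  fix h assume "\<exists>r f. smooth f \<and> h = (\<lambda>x. r * f (a * x + b))"
  then obtain r f where f: "smooth f" and h: "h = (\<lambda>x. r * f (a * x + b))" by blast
  have d: "(h has_real_derivative (r * a) * deriv f (a * x + b)) (at x)" for x
    unfolding h using DERIV_cmult[OF has_deriv_affine[OF f]] by (simp add: mult.assoc)
  then show "h differentiable (at x)" for x using real_differentiable_def by blast
  show "\<exists>r f. smooth f \<and> deriv h = (\<lambda>x. r * f (a * x + b))"
    using deriv_eqI[OF d] smooth_deriv[OF f] by blast
qed

lemma smooth_shift: "smooth f \<Longrightarrow> smooth (\<lambda>x. f (x - t))"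
  using smooth_affine[of f 1 "-t"] by simp

lemma deriv_shift: "smooth f \<Longrightarrow> deriv (\<lambda>x. f (x - t)) = (\<lambda>x. deriv f (x - t))"
  using has_deriv_affine[of f 1 "-t"] by (intro deriv_eqI) simp

lemma smooth_cos: "smooth (\<lambda>x. cos (w * x - t))"
proof (rule smooth_coinduct[where P = "\<lambda>h. \<exists>A B. h = (\<lambda>x. A * cos (w * x - t) + B * sin (w * x - t))"])
  show "\<exists>A B. (\<lambda>x. cos (w * x - t)) = (\<lambda>x. A * cos (w * x - t) + B * sin (w * x - t))"
    by (intro exI[of _ 1] exI[of _ 0]) auto
  fix h :: "real \<Rightarrow> real" assume "\<exists>A B. h = (\<lambda>x. A * cos (w * x - t) + B * sin (w * x - t))"
  then obtain A B where h: "h = (\<lambda>x. A * cos (w * x - t) + B * sin (w * x - t))" by blast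
  have d: "(h has_real_derivative (B * w) * cos (w * x - t) + (- A * w) * sin (w * x - t)) (at x)" for x
    unfolding h by (auto intro!: derivative_eq_intros)
  then show "h differentiable (at x)" for x using real_differentiable_def by blast
  show "\<exists>A B. deriv h = (\<lambda>x. A * cos (w * x - t) + B * sin (w * x - t))"
    using deriv_eqI[OF d] by blast
qed

text \<open>The one-sided functions \<open>p(1/x) exp(-1/x)\<close>. The family is closed under
  differentiation, with \<open>p\<close> replaced by \<open>X^2 (p - p')\<close>, so it serves as
  invariant for the smoothness of the basic cutoff \<open>exp(-1/x)\<close>.\<close>

definition flat_poly :: "real poly \<Rightarrow> real \<Rightarrow> real" where
  "flat_poly p x = (if x > 0 then poly p (1 / x) * exp (- (1 / x)) else 0)"

lemma poly_div_exp_tendsto_0: "((\<lambda>y::real. poly p y * exp (- y)) \<longlongrightarrow> 0) at_top"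
proof -
  have "((\<lambda>y::real. \<Sum>i\<le>degree p. coeff p i * (y ^ i / exp y)) \<longlongrightarrow> (\<Sum>i\<le>degree p. coeff p i * 0)) at_top"
    by (intro tendsto_sum tendsto_mult tendsto_const tendsto_power_div_exp_0)
  moreover have "(\<Sum>i\<le>degree p. coeff p i * (y ^ i / exp y)) = poly p y * exp (- y)" for y :: real
    by (simp add: poly_altdef sum_distrib_right exp_minus field_simps sum_divide_distrib)
  ultimately show ?thesis by simp
qed

lemma flat_poly_has_deriv:
  "(flat_poly p has_real_derivative flat_poly ([:0, 0, 1:] * (p - pderiv p)) x) (at x)"
proof -
  consider "x > 0" | "x < 0" | "x = 0" by linarith
  then show ?thesis
  proof cases
    case 1
    have "((\<lambda>x. poly p (1 / x) * exp (- (1 / x))) has_real_derivative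
        poly ([:0, 0, 1:] * (p - pderiv p)) (1 / x) * exp (- (1 / x))) (at x)"
      using 1 by (auto intro!: derivative_eq_intros DERIV_chain2[OF poly_DERIV]
          simp: field_simps power2_eq_square)
    then have "(flat_poly p has_real_derivative
        poly ([:0, 0, 1:] * (p - pderiv p)) (1 / x) * exp (- (1 / x))) (at x)"
      by (rule has_field_derivative_transform_within_open[where S = "{0<..}"])
        (use 1 in \<open>auto simp: flat_poly_def\<close>)
    then show ?thesis using 1 by (simp add: flat_poly_def)
  next
    case 2
    have "(flat_poly p has_real_derivative 0) (at x)"
      by (rule has_field_derivative_transform_within_open[where S = "{..<0}" and f = "\<lambda>x. 0"])
        (use 2 in \<open>auto simp: flat_poly_def\<close>)
    then show ?thesis using 2 by (simp add: flat_poly_def)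
  next
    case 3
    have "((\<lambda>h. flat_poly p h / h) \<longlongrightarrow> 0) (at 0)"
    proof (rule filterlim_split_at)
      have "((\<lambda>h. flat_poly p h / h) \<longlongrightarrow> 0) (at_left (0::real)) \<longleftrightarrow> ((\<lambda>h. 0) \<longlongrightarrow> (0::real)) (at_left (0::real))"
        by (intro filterlim_cong refl) (auto simp: eventually_at_filter flat_poly_def)
      then show "((\<lambda>h. flat_poly p h / h) \<longlongrightarrow> 0) (at_left (0::real))" by simp
      \<comment> \<open>\<open>pCons 0\<close> multiplies the polynomial by its variable and so
        absorbs the \<open>1/h\<close> of the difference quotient; the exponential beats every
        polynomial.\<close>
      have "((\<lambda>h. poly (pCons 0 p) (inverse h) * exp (- inverse h)) \<longlongrightarrow> 0) (at_right (0::real))"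
        using poly_div_exp_tendsto_0 filterlim_inverse_at_top_right by (rule filterlim_compose)
      moreover have "eventually (\<lambda>h. poly (pCons 0 p) (inverse h) * exp (- inverse h) = flat_poly p h / h) (at_right (0::real))"
        by (auto simp: eventually_at_filter flat_poly_def field_simps)
      ultimately show "((\<lambda>h. flat_poly p h / h) \<longlongrightarrow> 0) (at_right (0::real))"
        by (rule Lim_transform_eventually)
    qed
    then show ?thesis using 3 by (simp add: has_field_derivative_iff flat_poly_def)
  qed
qed

definition bump_ramp :: "real \<Rightarrow> real" where
  "bump_ramp = flat_poly 1"

lemma smooth_bump_ramp: "smooth bump_ramp"
proof (rule smooth_coinduct[where P = "\<lambda>h. \<exists>p. h = flat_poly p"])
  show "\<exists>p. bump_ramp = flat_poly p" by (auto simp: bump_ramp_def)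
  show "h differentiable (at x)" if "\<exists>p. h = flat_poly p" for h x
    using that flat_poly_has_deriv real_differentiable_def by blast
  show "\<exists>p. deriv h = flat_poly p" if "\<exists>p. h = flat_poly p" for h
    using that deriv_eqI[OF flat_poly_has_deriv] by blast
qed

lemma bump_ramp_eq: "bump_ramp x = (if x > 0 then exp (- (1 / x)) else 0)"
  by (simp add: bump_ramp_def flat_poly_def)

lemma bump_ramp_bounds: "0 \<le> bump_ramp x" "bump_ramp x \<le> 1"
  by (auto simp: bump_ramp_eq)

section \<open>Test functions as elements of \<open>L2\<close>\<close>

lemma test_function_iff: "test_function \<psi> \<longleftrightarrow> smooth \<psi> \<and> (\<exists>R. \<forall>x. \<bar>x\<bar> > R \<longrightarrow> \<psi> x = 0)"
proof -
  have "compact (closure {x. \<psi> x \<noteq> 0}) \<longleftrightarrow> bounded {x. \<psi> x \<noteq> 0}" by simp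
  also have "\<dots> \<longleftrightarrow> (\<exists>R. \<forall>x. \<bar>x\<bar> > R \<longrightarrow> \<psi> x = 0)"
    by (simp add: bounded_iff) (meson linorder_not_less)
  finally show ?thesis by (simp add: test_function_def)
qed

lemma test_smooth: "test_function \<psi> \<Longrightarrow> smooth \<psi>"
  by (simp add: test_function_def)

lemma test_mult_smooth: "test_function \<psi> \<Longrightarrow> smooth f \<Longrightarrow> test_function (\<lambda>x. f x * \<psi> x)"
  by (auto simp: test_function_iff intro!: smooth_mult)

lemma test_deriv:
  assumes "test_function \<psi>"
  shows "test_function (deriv \<psi>)"
proof -
  obtain R where R: "\<And>x. \<bar>x\<bar> > R \<Longrightarrow> \<psi> x = 0" using assms by (auto simp: test_function_iff)
  have "deriv \<psi> x = 0" if "\<bar>x\<bar> > R" for x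
  proof (rule DERIV_imp_deriv)
    have "open {x::real. \<bar>x\<bar> > R}" by (intro open_Collect_less continuous_intros)
    show "(\<psi> has_real_derivative 0) (at x)"
      by (rule has_field_derivative_transform_within_open[where S = "{x. \<bar>x\<bar> > R}" and f = "\<lambda>x. 0"])
        (use that R \<open>open {x::real. \<bar>x\<bar> > R}\<close> in auto)
  qed
  then show ?thesis using assms smooth_deriv by (auto simp: test_function_iff)
qed

lemma test_shift:
  assumes "test_function \<psi>"
  shows "test_function (\<lambda>x. \<psi> (x - t))"
proof -
  obtain R where R: "\<And>x. \<bar>x\<bar> > R \<Longrightarrow> \<psi> x = 0" using assms by (auto simp: test_function_iff)
  have "\<psi> (x - t) = 0" if "\<bar>x\<bar> > R + \<bar>t\<bar>" for x using that by (intro R) linarith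
  then show ?thesis using assms smooth_shift by (auto simp: test_function_iff)
qed

lemma test_bounded:
  assumes "test_function \<psi>"
  obtains M R where "M > 0" "R > 0" "\<And>x. \<bar>\<psi> x\<bar> \<le> M" "\<And>x. \<bar>x\<bar> > R \<Longrightarrow> \<psi> x = 0"
proof -
  obtain R where R: "\<And>x. \<bar>x\<bar> > R \<Longrightarrow> \<psi> x = 0" using assms by (auto simp: test_function_iff)
  have "compact (\<psi> ` {-R..R})"
    using assms by (intro compact_continuous_image smooth_continuous) (auto simp: test_function_def)
  then obtain M where M: "\<And>x. x \<in> {-R..R} \<Longrightarrow> \<bar>\<psi> x\<bar> \<le> M"
    using compact_imp_bounded[THEN bounded_iff[THEN iffD1]] by (metis image_eqI real_norm_def)
  have "\<bar>\<psi> x\<bar> \<le> \<bar>M\<bar> + 1" for x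
    using M[of x] R[of x] by (cases "\<bar>x\<bar> > R") force+
  moreover have "\<psi> x = 0" if "\<bar>x\<bar> > \<bar>R\<bar> + 1" for x using that by (intro R) linarith
  ultimately show ?thesis by (intro that[of "\<bar>M\<bar> + 1" "\<bar>R\<bar> + 1"]) auto
qed

lemma square_integrable_compact_support:
  assumes "f \<in> borel_measurable borel" "\<And>x. cmod (f x) \<le> M" "\<And>x. x \<notin> {a..b} \<Longrightarrow> f x = 0"
  shows "square_integrable f"
proof (rule square_integrable_bound[where g = "indicator {a..b}"])
  show "square_integrable (indicator {a..b})"
  proof -
    have "(cmod (indicator {a..b} x))\<^sup>2 = (indicator {a..b} x :: real)" for x
      by (auto simp: indicator_def)
    moreover have "integrable lborel (indicator {a..b} :: real \<Rightarrow> real)"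
      by (rule integrable_real_indicator) (auto simp: emeasure_lborel_Icc_eq)
    ultimately show ?thesis by (simp add: square_integrable_def)
  qed
  show "AE x in lborel. cmod (f x) \<le> M * cmod (indicator {a..b} x)"
    using assms(2,3) by (auto simp: indicator_def)
qed (fact assms)

lemma test_square_integrable:
  assumes "test_function \<psi>"
  shows "square_integrable (\<lambda>x. complex_of_real (\<psi> x))"
proof -
  obtain M R where MR: "\<And>x. \<bar>\<psi> x\<bar> \<le> M" "\<And>x. \<bar>x\<bar> > R \<Longrightarrow> \<psi> x = 0"
    by (rule test_bounded[OF assms]) blast
  have [measurable]: "\<psi> \<in> borel_measurable borel" using test_smooth[OF assms] by auto
  show ?thesis
    by (rule square_integrable_compact_support[where M = M and a = "-R" and b = R]) (auto intro: MR)
qed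

definition of_test :: "(real \<Rightarrow> real) \<Rightarrow> L2" where
  "of_test \<psi> = abs_L2 (\<lambda>x. complex_of_real (\<psi> x))"

lemma weak_deriv_iff:
  "weak_deriv u v \<longleftrightarrow>
     (\<forall>\<psi>. test_function \<psi> \<longrightarrow> cpair (of_test (deriv \<psi>)) u = - cpair (of_test \<psi>) v)"
  unfolding weak_deriv_def of_test_def
  by (simp add: cpair_abs_left test_square_integrable test_deriv)

section \<open>Uniqueness of weak derivatives\<close>

text \<open>The positive and negative parts of \<open>g\<close> are densities of two finite measures
  that agree on all open rays. Rays determine such measures, and equal measures have almost
  everywhere equal densities.\<close>

lemma AE_zero_if_ray_integrals_zero:
  fixes g :: "real \<Rightarrow> real"
  assumes g: "integrable lborel g" and z: "\<And>a. (\<integral>x. indicator {a<..} x * g x \<partial>lborel) = 0"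
  shows "AE x in lborel. g x = 0"
proof -
  have [measurable]: "g \<in> borel_measurable borel" using g by auto
  let ?p = "\<lambda>x. max 0 (g x)" and ?n = "\<lambda>x. max 0 (- g x)"
  have ip: "integrable lborel (\<lambda>x. indicator {a<..} x * ?p x)" "integrable lborel ?p" for a :: real
    by (rule Bochner_Integration.integrable_bound[OF g]; auto simp: indicator_def)+
  have im: "integrable lborel (\<lambda>x. indicator {a<..} x * ?n x)" for a :: real
    by (rule Bochner_Integration.integrable_bound[OF g]) (auto simp: indicator_def)
  have ep: "emeasure (density lborel ?p) {a<..} = ennreal (\<integral>x. indicator {a<..} x * ?p x \<partial>lborel)" for a
  proof -
    have "emeasure (density lborel ?p) {a<..} = (\<integral>\<^sup>+x. ennreal (indicator {a<..} x * ?p x) \<partial>lborel)"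
      by (subst emeasure_density) (auto intro!: nn_integral_cong simp: indicator_def)
    also have "\<dots> = ennreal (\<integral>x. indicator {a<..} x * ?p x \<partial>lborel)"
      by (rule nn_integral_eq_integral[OF ip(1)]) auto
    finally show ?thesis .
  qed
  have em: "emeasure (density lborel ?n) {a<..} = ennreal (\<integral>x. indicator {a<..} x * ?n x \<partial>lborel)" for a
  proof -
    have "emeasure (density lborel ?n) {a<..} = (\<integral>\<^sup>+x. ennreal (indicator {a<..} x * ?n x) \<partial>lborel)"
      by (subst emeasure_density) (auto intro!: nn_integral_cong simp: indicator_def)
    also have "\<dots> = ennreal (\<integral>x. indicator {a<..} x * ?n x \<partial>lborel)"
      by (rule nn_integral_eq_integral[OF im]) auto
    finally show ?thesis .
  qed
  have "(\<integral>x. indicator {a<..} x * ?p x \<partial>lborel) = (\<integral>x. indicator {a<..} x * ?n x \<partial>lborel)" for a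
  proof -
    have "(\<integral>x. indicator {a<..} x * ?p x \<partial>lborel) - (\<integral>x. indicator {a<..} x * ?n x \<partial>lborel)
        = (\<integral>x. indicator {a<..} x * ?p x - indicator {a<..} x * ?n x \<partial>lborel)"
      by (rule Bochner_Integration.integral_diff[symmetric]) (fact ip im)+
    also have "\<dots> = (\<integral>x. indicator {a<..} x * g x \<partial>lborel)"
      by (rule Bochner_Integration.integral_cong) (auto simp: indicator_def)
    finally show ?thesis using z by simp
  qed
  then have "density lborel ?p = density lborel ?n"
    by (intro measure_eqI_lessThan) (auto simp: ep em)
  moreover have "(\<integral>\<^sup>+x. ennreal (?p x) \<partial>lborel) \<noteq> \<infinity>"
    by (subst nn_integral_eq_integral[OF ip(2)]) auto
  ultimately have "AE x in lborel. ennreal (?p x) = ennreal (?n x)"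
    by (subst (asm) finite_density_unique) auto
  then show ?thesis by eventually_elim (auto simp: max_def split: if_splits)
qed

lemma interval_integral_zero_if_test_zero:
  assumes "\<And>\<psi>. test_function \<psi> \<Longrightarrow> cpair (of_test \<psi>) u = 0"
  shows "(\<integral>x. indicator {a<..<b} x * rep_L2 u x \<partial>lborel) = 0"
proof -
  \<comment> \<open>A product of two ramps that vanishes exactly off the interval. Stretching by
    \<open>n\<close> drives \<open>exp(-1/(n r))\<close> to 1 for every \<open>r > 0\<close>, so the
    functions converge to the indicator and stay below it.\<close>
  define \<eta> where "\<eta> n x = bump_ramp (real n * x + - real n * a) * bump_ramp (- real n * x + real n * b)" for n x
  have sm: "smooth (\<eta> n)" for n
    unfolding \<eta>_def by (intro smooth_mult smooth_affine smooth_bump_ramp)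
  have ze: "\<eta> n x = 0" if "x \<notin> {a<..<b}" for n x
  proof -
    have "real n * x + - real n * a = real n * (x - a)" "- real n * x + real n * b = real n * (b - x)"
      by (auto simp: algebra_simps)
    then show ?thesis using that by (auto simp: \<eta>_def bump_ramp_eq zero_less_mult_iff)
  qed
  have test: "test_function (\<eta> n)" for n
  proof -
    have "\<eta> n x = 0" if "\<bar>x\<bar> > max \<bar>a\<bar> \<bar>b\<bar>" for x using that by (intro ze) auto
    then show ?thesis using sm unfolding test_function_iff by blast
  qed
  have [measurable]: "\<eta> n \<in> borel_measurable borel" for n using sm by auto
  have le: "\<bar>\<eta> n x\<bar> \<le> indicator {a<..<b} x" for n x
  proof (cases "x \<in> {a<..<b}")
    case True
    have "\<bar>\<eta> n x\<bar> \<le> 1" unfolding \<eta>_def abs_mult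
      by (intro mult_le_one) (auto simp: bump_ramp_bounds)
    then show ?thesis using True by simp
  qed (simp add: ze)
  have lim: "(\<lambda>n. \<eta> n x) \<longlonglongrightarrow> indicator {a<..<b} x" for x
  proof (cases "x \<in> {a<..<b}")
    case True
    have l: "(\<lambda>n. bump_ramp (real n * r)) \<longlonglongrightarrow> 1" if "r > 0" for r
    proof -
      have "(\<lambda>n. exp (- (1 / r) * inverse (real n))) \<longlonglongrightarrow> exp (- (1 / r) * 0)"
        by (intro tendsto_intros LIMSEQ_inverse_real_of_nat[THEN LIMSEQ_imp_Suc] lim_inverse_n)
      moreover have "eventually (\<lambda>n. exp (- (1 / r) * inverse (real n)) = bump_ramp (real n * r)) sequentially"
        using eventually_gt_at_top[of 0] by eventually_elim (use that in \<open>auto simp: bump_ramp_eq field_simps\<close>)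
      ultimately show ?thesis by (simp add: Lim_transform_eventually)
    qed
    have "(\<lambda>n. bump_ramp (real n * (x - a)) * bump_ramp (real n * (b - x))) \<longlonglongrightarrow> 1 * 1"
      using True by (intro tendsto_mult l) auto
    moreover have "bump_ramp (real n * (x - a)) * bump_ramp (real n * (b - x)) = \<eta> n x" for n
      by (simp add: \<eta>_def algebra_simps)
    ultimately show ?thesis using True by simp
  qed (simp add: ze)
  have "(\<lambda>n. \<integral>x. complex_of_real (\<eta> n x) * rep_L2 u x \<partial>lborel) \<longlonglongrightarrow>
      (\<integral>x. complex_of_real (indicator {a<..<b} x) * rep_L2 u x \<partial>lborel)"
  proof (rule integral_dominated_convergence)
    have "square_integrable (\<lambda>x. complex_of_real (indicator {a<..<b} x))"
      by (rule square_integrable_compact_support[of _ 1 a b]) (auto simp: indicator_def)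
    from integrable_mult_square_integrable[OF this square_integrable_rep_L2[of u]]
    show "integrable lborel (\<lambda>x. norm (complex_of_real (indicator {a<..<b} x) * rep_L2 u x))"
      by (rule integrable_norm)
    show "AE x in lborel. (\<lambda>n. complex_of_real (\<eta> n x) * rep_L2 u x) \<longlonglongrightarrow> complex_of_real (indicator {a<..<b} x) * rep_L2 u x"
      by (intro AE_I2 tendsto_mult tendsto_of_real lim tendsto_const)
    show "AE x in lborel. norm (complex_of_real (\<eta> n x) * rep_L2 u x)
        \<le> norm (complex_of_real (indicator {a<..<b} x) * rep_L2 u x)" for n
      using le by (auto simp: norm_mult intro!: mult_right_mono)
  qed auto
  moreover have "(\<integral>x. complex_of_real (\<eta> n x) * rep_L2 u x \<partial>lborel) = 0" for n
    using assms[OF test[of n]] by (simp add: of_test_def cpair_abs_left test_square_integrable test)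
  moreover have "complex_of_real (indicator {a<..<b} x) = indicator {a<..<b} x" for x
    by (auto simp: indicator_def)
  ultimately show ?thesis by (simp add: LIMSEQ_const_iff)
qed

text \<open>The fundamental lemma of the calculus of variations, by way of vanishing integrals over
  all intervals, for real and imaginary part separately.\<close>

lemma L2_zero_if_test_zero:
  assumes "\<And>\<psi>. test_function \<psi> \<Longrightarrow> cpair (of_test \<psi>) u = 0"
  shows "u = 0"
proof -
  \<comment> \<open>Functions in \<open>L2\<close> need not be integrable on the line, so the
    argument is made on bounded intervals and then on their countable union.\<close>
  have loc: "AE x in lborel. indicator {-real n<..<real n} x * rep_L2 u x = 0" for n
  proof -
    let ?I = "{-real n<..<real n}"
    have "square_integrable (indicator ?I)"
      by (rule square_integrable_compact_support[of _ 1 "-real n" "real n"]) (auto simp: indicator_def)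
    from integrable_mult_square_integrable[OF this square_integrable_rep_L2[of u]]
    have int: "integrable lborel (\<lambda>x. indicator ?I x * rep_L2 u x)" .
    have ray: "(\<integral>x. indicator {a<..} x * (indicator ?I x * rep_L2 u x) \<partial>lborel) = 0" for a
    proof -
      have "indicator {a<..} x * (indicator ?I x * rep_L2 u x) = indicator {max a (-real n)<..<real n} x * rep_L2 u x" for x
        by (auto simp: indicator_def)
      then show ?thesis by (simp only: interval_integral_zero_if_test_zero[OF assms])
    qed
    have inta: "integrable lborel (\<lambda>x. indicator {a<..} x * (indicator ?I x * rep_L2 u x))" for a
      by (rule Bochner_Integration.integrable_bound[OF int]) (auto simp: indicator_def)
    have "AE x in lborel. Re (indicator ?I x * rep_L2 u x) = 0"
    proof (rule AE_zero_if_ray_integrals_zero)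
      have "indicator {a<..} x * Re (indicator ?I x * rep_L2 u x) = Re (indicator {a<..} x * (indicator ?I x * rep_L2 u x))" for x a
        by (auto simp: indicator_def)
      then show "(\<integral>x. indicator {a<..} x * Re (indicator ?I x * rep_L2 u x) \<partial>lborel) = 0" for a
        using ray[of a] integral_Re[OF inta[of a]] by simp
    qed (rule integrable_Re[OF int])
    moreover have "AE x in lborel. Im (indicator ?I x * rep_L2 u x) = 0"
    proof (rule AE_zero_if_ray_integrals_zero)
      have "indicator {a<..} x * Im (indicator ?I x * rep_L2 u x) = Im (indicator {a<..} x * (indicator ?I x * rep_L2 u x))" for x a
        by (auto simp: indicator_def)
      then show "(\<integral>x. indicator {a<..} x * Im (indicator ?I x * rep_L2 u x) \<partial>lborel) = 0" for a
        using ray[of a] integral_Im[OF inta[of a]] by simp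
    qed (rule integrable_Im[OF int])
    ultimately show ?thesis by eventually_elim (simp add: complex_eq_iff)
  qed
  then have "AE x in lborel. \<forall>n. indicator {-real n<..<real n} x * rep_L2 u x = 0"
    unfolding AE_all_countable ..
  then have "AE x in lborel. rep_L2 u x = 0"
  proof eventually_elim
    case (elim x)
    obtain n where "\<bar>x\<bar> < real n" using reals_Archimedean2 by blast
    then show ?case using elim[rule_format, of n] by (simp add: indicator_def abs_less_iff split: if_splits)
  qed
  then show ?thesis
    using AE_rep_L2_zero by (intro L2_eqI) auto
qed

lemma weak_deriv_unique:
  assumes "weak_deriv u v" "weak_deriv u w"
  shows "v = w"
proof -
  have "v - w = 0"
    using assms by (intro L2_zero_if_test_zero) (auto simp: weak_deriv_iff cpair_simps)
  then show ?thesis by simp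
qed

section \<open>Calculus of weak derivatives\<close>

lemma Dx_eq: "weak_deriv u v \<Longrightarrow> Dx u = v"
  unfolding Dx_def using weak_deriv_unique by blast

lemma weak_deriv_diff: "weak_deriv u u' \<Longrightarrow> weak_deriv v v' \<Longrightarrow> weak_deriv (u - v) (u' - v')"
  by (auto simp: weak_deriv_iff cpair_simps)

lemma mult_op_of_test:
  assumes "test_function \<psi>" "multiplier m"
  shows "mult_op m (of_test \<psi>) = of_test (\<lambda>x. m x * \<psi> x)"
  using assms by (simp add: of_test_def mult_op_abs test_square_integrable)

lemma of_test_add:
  assumes "test_function \<psi>" "test_function \<theta>"
  shows "of_test (\<lambda>x. \<psi> x + \<theta> x) = of_test \<psi> + of_test \<theta>"
  using assms by (simp add: of_test_def abs_L2_add test_square_integrable)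

text \<open>Because \<open>m\<close> is smooth, \<open>m \<psi>\<close> is again a test function,
  and the classical product rule for it transposes to the weak one.\<close>

lemma weak_deriv_mult_op:
  assumes "smooth m" "multiplier m" "multiplier (deriv m)" "weak_deriv u v"
  shows "weak_deriv (mult_op m u) (mult_op m v + mult_op (deriv m) u)"
  unfolding weak_deriv_iff
proof (intro allI impI)
  fix \<psi> assume t: "test_function \<psi>"
  have t1: "test_function (\<lambda>x. m x * \<psi> x)" "test_function (\<lambda>x. m x * deriv \<psi> x)" "test_function (\<lambda>x. deriv m x * \<psi> x)"
    by (auto intro!: test_mult_smooth test_deriv smooth_deriv t assms(1))
  have "deriv (\<lambda>x. m x * \<psi> x) = (\<lambda>x. m x * deriv \<psi> x + deriv m x * \<psi> x)"
    using DERIV_mult[OF smooth_has_deriv[OF assms(1)] smooth_has_deriv[OF test_smooth[OF t]]]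
    by (intro deriv_eqI) (simp add: algebra_simps)
  then have "of_test (deriv (\<lambda>x. m x * \<psi> x)) = mult_op m (of_test (deriv \<psi>)) + mult_op (deriv m) (of_test \<psi>)"
    using t t1 assms(2,3) by (simp add: of_test_add mult_op_of_test test_deriv)
  moreover have "cpair (of_test (deriv (\<lambda>x. m x * \<psi> x))) u = - cpair (of_test (\<lambda>x. m x * \<psi> x)) v"
    using assms(4) t1(1) by (simp add: weak_deriv_iff)
  ultimately show "cpair (of_test (deriv \<psi>)) (mult_op m u) = - cpair (of_test \<psi>) (mult_op m v + mult_op (deriv m) u)"
    using t assms(2,3) by (simp add: cpair_simps cpair_mult_op[symmetric] mult_op_of_test[symmetric])
      (simp add: algebra_simps)
qed

text \<open>The product of two test functions vanishes at both ends of a large interval, so the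
  integral of its derivative is zero.\<close>

lemma weak_deriv_of_test:
  assumes "test_function \<psi>"
  shows "weak_deriv (of_test \<psi>) (of_test (deriv \<psi>))"
  unfolding weak_deriv_iff
proof (intro allI impI)
  fix \<theta> assume t: "test_function \<theta>"
  have t2: "test_function (\<lambda>x. \<psi> x * \<theta> x)" using assms t by (intro test_mult_smooth) (auto intro: test_smooth)
  have e: "deriv (\<lambda>x. \<psi> x * \<theta> x) = (\<lambda>x. deriv \<theta> x * \<psi> x + \<theta> x * deriv \<psi> x)"
    using DERIV_mult[OF smooth_has_deriv[OF test_smooth[OF assms]] smooth_has_deriv[OF test_smooth[OF t]]]
    by (intro deriv_eqI) (simp add: algebra_simps)
  obtain R where R: "R > 0" "\<And>x. \<bar>x\<bar> > R \<Longrightarrow> \<psi> x * \<theta> x = 0"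
    by (rule test_bounded[OF t2]) blast
  obtain S where S: "S > 0" "\<And>x. \<bar>x\<bar> > S \<Longrightarrow> deriv (\<lambda>x. \<psi> x * \<theta> x) x = 0"
    by (rule test_bounded[OF test_deriv[OF t2]]) blast
  let ?T = "R + S"
  have "(\<integral>x. indicator {-?T..?T} x *\<^sub>R deriv (\<lambda>x. \<psi> x * \<theta> x) x \<partial>lborel) = \<psi> ?T * \<theta> ?T - \<psi> (-?T) * \<theta> (-?T)"
    using R S by (intro integral_FTC_Icc[where F = "\<lambda>x. \<psi> x * \<theta> x"])
      (auto intro!: has_field_derivative_at_within smooth_has_deriv test_smooth t2
         smooth_continuous test_deriv simp flip: has_real_derivative_iff_has_vector_derivative)
  also have "\<dots> = 0" using R(2)[of ?T] R(2)[of "- ?T"] R(1) S(1) by (auto simp del: minus_add_distrib)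
  also have "(\<lambda>x. indicator {-?T..?T} x *\<^sub>R deriv (\<lambda>x. \<psi> x * \<theta> x) x) = deriv (\<lambda>x. \<psi> x * \<theta> x)"
  proof
    fix x
    show "indicator {-?T..?T} x *\<^sub>R deriv (\<lambda>x. \<psi> x * \<theta> x) x = deriv (\<lambda>x. \<psi> x * \<theta> x) x"
      using S(2)[of x] R(1) by (cases "\<bar>x\<bar> > S") (auto simp: indicator_def abs_le_iff not_less)
  qed
  finally have z: "(\<integral>x. deriv \<theta> x * \<psi> x + \<theta> x * deriv \<psi> x \<partial>lborel) = 0" by (simp add: e)
  have i: "integrable lborel (\<lambda>x. f x * g x)" if "test_function f" "test_function g" for f g
    using integrable_mult_square_integrable[OF test_square_integrable[OF that(1)] test_square_integrable[OF that(2)]]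
    by (simp flip: of_real_mult add: complex_of_real_integrable_eq)
  have "cpair (of_test (deriv \<theta>)) (of_test \<psi>) + cpair (of_test \<theta>) (of_test (deriv \<psi>))
     = complex_of_real ((\<integral>x. deriv \<theta> x * \<psi> x \<partial>lborel) + (\<integral>x. \<theta> x * deriv \<psi> x \<partial>lborel))"
    using t assms by (simp add: of_test_def cpair_abs_abs test_square_integrable test_deriv
      flip: of_real_mult)
  also have "\<dots> = 0"
    using z t assms by (simp add: i test_deriv)
  finally show "cpair (of_test (deriv \<theta>)) (of_test \<psi>) = - cpair (of_test \<theta>) (of_test (deriv \<psi>))"
    by (simp add: add_eq_0_iff2)
qed

section \<open>Convolution with exponentially decaying kernels\<close>

lemma integrable_exp_neg_abs:
  assumes "\<sigma> > 0"
  shows "integrable lborel (\<lambda>t::real. exp (- \<sigma> * \<bar>t\<bar>))"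
proof -
  have "(\<integral>\<^sup>+t. ennreal (exp (- \<sigma> * t)) * indicator {0..} t \<partial>lborel) = ennreal (0 - (- exp (- \<sigma> * 0) / \<sigma>))"
  proof (rule nn_integral_FTC_atLeast)
    have "((\<lambda>t. exp (- \<sigma> * t)) \<longlongrightarrow> 0) at_top"
      by (rule filterlim_compose[OF exp_at_bot])
        (use filterlim_tendsto_pos_mult_at_top[OF tendsto_const assms filterlim_ident]
          in \<open>simp add: filterlim_uminus_at_top\<close>)
    then have "((\<lambda>t. - exp (- \<sigma> * t) / \<sigma>) \<longlongrightarrow> - 0 / \<sigma>) at_top"
      by (intro tendsto_intros) (use assms in auto)
    then show "((\<lambda>t. - exp (- \<sigma> * t) / \<sigma>) \<longlongrightarrow> 0) at_top" by simp
  qed (use assms in \<open>auto intro!: derivative_eq_intros\<close>)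
  then have fin: "(\<integral>\<^sup>+t. ennreal (exp (- \<sigma> * t)) * indicator {0..} t \<partial>lborel) < \<infinity>" by simp
  have i: "integrable lborel (\<lambda>t. exp (- \<sigma> * t) * indicator {0..} t)"
    using fin by (intro integrableI_bounded) (auto simp: ennreal_mult' ennreal_indicator)
  have "integrable lborel (\<lambda>t. exp (- \<sigma> * (- t)) * indicator {0..} (- t))"
    using lborel_integrable_real_affine[OF i, of "-1" 0] by simp
  with i have "integrable lborel (\<lambda>t. exp (- \<sigma> * t) * indicator {0..} t + exp (- \<sigma> * (- t)) * indicator {0..} (- t))"
    by (rule Bochner_Integration.integrable_add)
  then show ?thesis
    by (rule Bochner_Integration.integrable_bound) (auto simp: indicator_def abs_real_def)
qed

text \<open>Such kernels are integrable and square integrable at once: the first makes convolution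
  bounded on \<open>L2\<close>, the second makes each of its values a pairing with an element of
  \<open>L2\<close>.\<close>

definition exp_decaying :: "(real \<Rightarrow> complex) \<Rightarrow> bool" where
  "exp_decaying \<kappa> \<longleftrightarrow> \<kappa> \<in> borel_measurable borel \<and>
     (\<exists>A \<sigma>. \<sigma> > 0 \<and> (\<forall>t. cmod (\<kappa> t) \<le> A * exp (- \<sigma> * \<bar>t\<bar>)))"

lemma exp_decayingE:
  assumes "exp_decaying \<kappa>"
  obtains A \<sigma> where "A > 0" "\<sigma> > 0" "\<And>t. cmod (\<kappa> t) \<le> A * exp (- \<sigma> * \<bar>t\<bar>)"
proof -
  obtain A \<sigma> where *: "\<sigma> > 0" "\<And>t. cmod (\<kappa> t) \<le> A * exp (- \<sigma> * \<bar>t\<bar>)"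
    using assms by (auto simp: exp_decaying_def)
  have "cmod (\<kappa> t) \<le> (\<bar>A\<bar> + 1) * exp (- \<sigma> * \<bar>t\<bar>)" for t
    by (rule order_trans[OF *(2)]) (intro mult_right_mono, auto)
  then show ?thesis using *(1) by (intro that[of "\<bar>A\<bar> + 1" \<sigma>]) auto
qed

lemma exp_decaying_measurable [measurable_dest]: "exp_decaying \<kappa> \<Longrightarrow> \<kappa> \<in> borel_measurable borel"
  by (simp add: exp_decaying_def)

lemma exp_decayingI:
  assumes "\<kappa> \<in> borel_measurable borel" "\<sigma> > 0" "\<And>t. cmod (\<kappa> t) \<le> A * exp (- \<sigma> * \<bar>t\<bar>)"
  shows "exp_decaying \<kappa>"
  using assms unfolding exp_decaying_def by blast

lemma exp_decaying_reflect:
  assumes "exp_decaying \<kappa>"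
  shows "exp_decaying (\<lambda>t. \<kappa> (- t))"
proof -
  have [measurable]: "\<kappa> \<in> borel_measurable borel" using assms by auto
  obtain A \<sigma> where "\<sigma> > 0" "\<And>t. cmod (\<kappa> t) \<le> A * exp (- \<sigma> * \<bar>t\<bar>)"
    by (rule exp_decayingE[OF assms]) blast
  from this(1) this(2)[of "- t" for t] show ?thesis
    by (intro exp_decayingI[where A = A and \<sigma> = \<sigma>]) auto
qed

lemma square_integrable_exp_decaying:
  assumes "exp_decaying \<kappa>"
  shows "square_integrable \<kappa>"
proof -
  obtain A \<sigma> where *: "\<sigma> > 0" "\<And>t. cmod (\<kappa> t) \<le> A * exp (- \<sigma> * \<bar>t\<bar>)"
    by (rule exp_decayingE[OF assms]) blast
  have "square_integrable (\<lambda>t. complex_of_real (exp (- \<sigma> * \<bar>t\<bar>)))"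
  proof -
    have "(exp (- \<sigma> * \<bar>t\<bar>))\<^sup>2 = exp (- (2 * \<sigma>) * \<bar>t\<bar>)" for t
      by (simp add: power2_eq_square flip: exp_add)
    then show ?thesis
      using integrable_exp_neg_abs[of "2 * \<sigma>"] *(1) by (simp add: square_integrable_def)
  qed
  then show ?thesis
  proof (rule square_integrable_bound)
    show "AE t in lborel. cmod (\<kappa> t) \<le> A * cmod (complex_of_real (exp (- \<sigma> * \<bar>t\<bar>)))"
      using *(2) by simp
  qed (rule exp_decaying_measurable[OF assms])
qed

lemma square_integrable_reflect_shift:
  assumes "square_integrable f"
  shows "square_integrable (\<lambda>y. f (x - y))"
  using assms lborel_integrable_real_affine[of "\<lambda>y. (cmod (f y))\<^sup>2" "-1" x]
  by (auto simp: square_integrable_def)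

text \<open>Seeing the reflected translate of the kernel as an element of \<open>L2\<close> turns
  the value of a convolution at \<open>x\<close> into a pairing. Linearity is then inherited from
  \<open>cpair\<close>, and continuity in \<open>x\<close> becomes norm continuity of
  translates.\<close>

definition kernel_at :: "(real \<Rightarrow> complex) \<Rightarrow> real \<Rightarrow> L2" where
  "kernel_at \<kappa> x = abs_L2 (\<lambda>y. \<kappa> (x - y))"

definition conv_op :: "(real \<Rightarrow> complex) \<Rightarrow> L2 \<Rightarrow> L2" where
  "conv_op \<kappa> u = abs_L2 (\<lambda>x. cpair (kernel_at \<kappa> x) u)"

lemma cpair_kernel_at:
  "exp_decaying \<kappa> \<Longrightarrow> cpair (kernel_at \<kappa> x) u = (\<integral>y. \<kappa> (x - y) * rep_L2 u y \<partial>lborel)"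
  unfolding kernel_at_def
  by (intro cpair_abs_left square_integrable_reflect_shift square_integrable_exp_decaying)

lemma nn_integral_exp_kernel:
  fixes h :: "real \<Rightarrow> ennreal"
  assumes "\<sigma> > 0" and [measurable]: "h \<in> borel_measurable borel"
  shows "(\<integral>\<^sup>+x. \<integral>\<^sup>+y. ennreal (exp (- \<sigma> * \<bar>x - y\<bar>)) * h y \<partial>lborel \<partial>lborel)
       = ennreal (\<integral>t. exp (- \<sigma> * \<bar>t\<bar>) \<partial>lborel) * (\<integral>\<^sup>+y. h y \<partial>lborel)" (is ?A)
    and "(\<integral>\<^sup>+x. \<integral>\<^sup>+y. ennreal (exp (- \<sigma> * \<bar>x - y\<bar>)) * h x \<partial>lborel \<partial>lborel)
       = ennreal (\<integral>t. exp (- \<sigma> * \<bar>t\<bar>) \<partial>lborel) * (\<integral>\<^sup>+y. h y \<partial>lborel)" (is ?B)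
proof -
  let ?N = "ennreal (\<integral>t. exp (- \<sigma> * \<bar>t\<bar>) \<partial>lborel)"
  have N: "(\<integral>\<^sup>+t. ennreal (exp (- \<sigma> * \<bar>t\<bar>)) \<partial>lborel) = ?N"
    by (rule nn_integral_eq_integral[OF integrable_exp_neg_abs[OF assms(1)]]) simp
  have N1: "(\<integral>\<^sup>+x. ennreal (exp (- \<sigma> * \<bar>x - y\<bar>)) \<partial>lborel) = ?N" for y
    using nn_integral_real_affine[of "\<lambda>t. ennreal (exp (- \<sigma> * \<bar>t\<bar>))" 1 "-y"] N by simp
  have N2: "(\<integral>\<^sup>+y. ennreal (exp (- \<sigma> * \<bar>x - y\<bar>)) \<partial>lborel) = ?N" for x
    using N1[of x] by (simp add: abs_minus_commute)
  have "(\<integral>\<^sup>+x. \<integral>\<^sup>+y. ennreal (exp (- \<sigma> * \<bar>x - y\<bar>)) * h y \<partial>lborel \<partial>lborel)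
      = (\<integral>\<^sup>+y. \<integral>\<^sup>+x. ennreal (exp (- \<sigma> * \<bar>x - y\<bar>)) * h y \<partial>lborel \<partial>lborel)"
    by (rule lborel_pair.Fubini'[symmetric]) measurable
  also have "\<dots> = (\<integral>\<^sup>+y. ?N * h y \<partial>lborel)"
    by (intro nn_integral_cong, subst nn_integral_multc, measurable) (simp only: N1)
  also have "\<dots> = ?N * (\<integral>\<^sup>+y. h y \<partial>lborel)" by (rule nn_integral_cmult) simp
  finally show ?A .
  have "(\<integral>\<^sup>+y. ennreal (exp (- \<sigma> * \<bar>x - y\<bar>)) * h x \<partial>lborel) = ?N * h x" for x
    by (subst nn_integral_multc, measurable) (simp only: N2)
  then have "(\<integral>\<^sup>+x. \<integral>\<^sup>+y. ennreal (exp (- \<sigma> * \<bar>x - y\<bar>)) * h x \<partial>lborel \<partial>lborel) = (\<integral>\<^sup>+x. ?N * h x \<partial>lborel)"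
    by (intro nn_integral_cong) auto
  then show ?B by (simp add: nn_integral_cmult)
qed

lemma conv_measurable [measurable]:
  assumes "exp_decaying \<kappa>"
  shows "(\<lambda>x. cpair (kernel_at \<kappa> x) u) \<in> borel_measurable borel"
proof -
  have [measurable]: "\<kappa> \<in> borel_measurable borel" using assms by auto
  have "(\<lambda>x. \<integral>y. \<kappa> (x - y) * rep_L2 u y \<partial>lborel) \<in> borel_measurable borel"
    by (rule lborel.borel_measurable_lebesgue_integral) measurable
  then show ?thesis by (simp add: cpair_kernel_at[OF assms])
qed

text \<open>A case of Young's inequality. Square integrability belongs to the conclusion because
  \<open>conv_op\<close> goes through \<open>abs_L2\<close> and has a meaning only then.\<close>

lemma conv_norm_bound:
  assumes "exp_decaying \<kappa>"
  shows "\<exists>C>0. \<forall>u. square_integrable (\<lambda>x. cpair (kernel_at \<kappa> x) u) \<and> norm (conv_op \<kappa> u) \<le> C * norm u"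
proof -
  have [measurable]: "\<kappa> \<in> borel_measurable borel" using assms by auto
  obtain A \<sigma> where A: "A > 0" "\<sigma> > 0" "\<And>t. cmod (\<kappa> t) \<le> A * exp (- \<sigma> * \<bar>t\<bar>)"
    by (rule exp_decayingE[OF assms]) blast
  define N where "N = (\<integral>t. exp (- \<sigma> * \<bar>t\<bar>) \<partial>lborel)"
  have N0: "N \<ge> 0" unfolding N_def by (rule integral_nonneg_AE) auto
  have N1: "(\<integral>y. exp (- \<sigma> * \<bar>x - y\<bar>) \<partial>lborel) = N" for x
    using lborel_integral_real_affine[of "-1" "\<lambda>t. exp (- \<sigma> * \<bar>t\<bar>)" x] by (simp add: N_def)
  \<comment> \<open>Cauchy--Schwarz with the kernel split evenly between the two factors\<close>
  have pt: "ennreal ((cmod (cpair (kernel_at \<kappa> x) u))\<^sup>2)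
      \<le> ennreal (A\<^sup>2 * N) * (\<integral>\<^sup>+y. ennreal (exp (- \<sigma> * \<bar>x - y\<bar>)) * ennreal ((cmod (rep_L2 u y))\<^sup>2) \<partial>lborel)" for x u
  proof -
    let ?e = "\<lambda>y. exp (- (\<sigma> / 2) * \<bar>x - y\<bar>)"
    have e2: "?e y * ?e y = exp (- \<sigma> * \<bar>x - y\<bar>)" for y
    proof -
      have "- (\<sigma> / 2) * \<bar>x - y\<bar> + - (\<sigma> / 2) * \<bar>x - y\<bar> = - \<sigma> * \<bar>x - y\<bar>" by (simp add: field_simps)
      then show ?thesis by (simp only: mult_exp_exp)
    qed
    have e2': "(?e y)\<^sup>2 = exp (- \<sigma> * \<bar>x - y\<bar>)" for y unfolding power2_eq_square by (rule e2)
    have "exp_decaying (\<lambda>t. complex_of_real (exp (- (\<sigma> / 2) * \<bar>t\<bar>)))"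
      using A by (intro exp_decayingI[where A = 1 and \<sigma> = "\<sigma> / 2"]) auto
    then have s1: "square_integrable (\<lambda>y. complex_of_real (?e y))"
      using square_integrable_reflect_shift[OF square_integrable_exp_decaying] by blast
    have s2: "square_integrable (\<lambda>y. complex_of_real (?e y) * rep_L2 u y)"
      using A(2) by (intro square_integrable_bound[OF square_integrable_rep_L2[of u], where C = 1])
        (auto simp: norm_mult intro!: mult_left_le_one_le)
    have ik: "integrable lborel (\<lambda>y. \<kappa> (x - y) * rep_L2 u y)"
      by (intro integrable_mult_square_integrable square_integrable_rep_L2
          square_integrable_reflect_shift square_integrable_exp_decaying assms)
    have ie: "integrable lborel (\<lambda>y. complex_of_real (?e y) * (complex_of_real (?e y) * rep_L2 u y))"
      by (rule integrable_mult_square_integrable[OF s1 s2])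
    have "cmod (cpair (kernel_at \<kappa> x) u) \<le> (\<integral>y. cmod (\<kappa> (x - y) * rep_L2 u y) \<partial>lborel)"
      unfolding cpair_kernel_at[OF assms] by (rule integral_norm_bound)
    also have "\<dots> \<le> (\<integral>y. A * cmod (complex_of_real (?e y) * (complex_of_real (?e y) * rep_L2 u y)) \<partial>lborel)"
    proof (rule integral_mono)
      show "cmod (\<kappa> (x - y) * rep_L2 u y) \<le> A * cmod (complex_of_real (?e y) * (complex_of_real (?e y) * rep_L2 u y))" for y
        using mult_right_mono[OF A(3)[of "x - y"], of "cmod (rep_L2 u y)"]
        unfolding e2[symmetric] by (simp add: norm_mult ac_simps)
    qed (intro integrable_mult_right integrable_norm ik ie)+
    also have "\<dots> = A * (\<integral>y. cmod (complex_of_real (?e y)) * cmod (complex_of_real (?e y) * rep_L2 u y) \<partial>lborel)"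
      by (simp add: norm_mult)
    also have "\<dots> \<le> A * (norm (abs_L2 (\<lambda>y. complex_of_real (?e y))) * norm (abs_L2 (\<lambda>y. complex_of_real (?e y) * rep_L2 u y)))"
      using A(1) by (intro mult_left_mono Cauchy_Schwarz_abs_L2 s1 s2) simp
    finally have "(cmod (cpair (kernel_at \<kappa> x) u))\<^sup>2
        \<le> (A * (norm (abs_L2 (\<lambda>y. complex_of_real (?e y))) * norm (abs_L2 (\<lambda>y. complex_of_real (?e y) * rep_L2 u y))))\<^sup>2"
      by (rule power_mono) simp
    also have "\<dots> = A\<^sup>2 * N * (norm (abs_L2 (\<lambda>y. complex_of_real (?e y) * rep_L2 u y)))\<^sup>2"
      unfolding power_mult_distrib norm_abs_L2_square[OF s1]
      by (simp only: norm_of_real abs_exp_cancel e2' N1 mult.assoc)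
    finally have "ennreal ((cmod (cpair (kernel_at \<kappa> x) u))\<^sup>2)
        \<le> ennreal (A\<^sup>2 * N) * ennreal ((norm (abs_L2 (\<lambda>y. complex_of_real (?e y) * rep_L2 u y)))\<^sup>2)"
      using N0 by (simp add: ennreal_mult[symmetric] ennreal_leI)
    also have "ennreal ((norm (abs_L2 (\<lambda>y. complex_of_real (?e y) * rep_L2 u y)))\<^sup>2)
        = (\<integral>\<^sup>+y. ennreal (exp (- \<sigma> * \<bar>x - y\<bar>)) * ennreal ((cmod (rep_L2 u y))\<^sup>2) \<partial>lborel)"
      unfolding nn_integral_square_integrable[OF s2, symmetric]
      by (simp only: norm_mult norm_of_real abs_exp_cancel power_mult_distrib e2' ennreal_mult' exp_ge_zero)
    finally show ?thesis .
  qed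
  \<comment> \<open>The summand 1 makes the constant positive, since only \<open>N \<ge> 0\<close>
    has been shown.\<close>
  have main: "(\<integral>\<^sup>+x. ennreal ((cmod (cpair (kernel_at \<kappa> x) u))\<^sup>2) \<partial>lborel) \<le> ennreal (((A * N + 1) * norm u)\<^sup>2)" for u
  proof -
    have "(\<integral>\<^sup>+x. ennreal ((cmod (cpair (kernel_at \<kappa> x) u))\<^sup>2) \<partial>lborel)
        \<le> (\<integral>\<^sup>+x. ennreal (A\<^sup>2 * N) * (\<integral>\<^sup>+y. ennreal (exp (- \<sigma> * \<bar>x - y\<bar>)) * ennreal ((cmod (rep_L2 u y))\<^sup>2) \<partial>lborel) \<partial>lborel)"
      by (rule nn_integral_mono) (rule pt)
    also have "\<dots> = ennreal (A\<^sup>2 * N) * (ennreal N * (\<integral>\<^sup>+y. ennreal ((cmod (rep_L2 u y))\<^sup>2) \<partial>lborel))"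
      by (subst nn_integral_cmult, simp, subst nn_integral_exp_kernel(1)[OF A(2)], simp) (simp only: N_def)
    also have "\<dots> = ennreal ((A * N * norm u)\<^sup>2)"
      using nn_integral_square_integrable[OF square_integrable_rep_L2[of u]] N0
      by (simp add: ennreal_mult[symmetric]) (simp add: power2_eq_square ac_simps)
    also have "\<dots> \<le> ennreal (((A * N + 1) * norm u)\<^sup>2)"
      using N0 A(1) by (intro ennreal_leI power_mono mult_right_mono) auto
    finally show ?thesis .
  qed
  have "square_integrable (\<lambda>x. cpair (kernel_at \<kappa> x) u) \<and> norm (conv_op \<kappa> u) \<le> (A * N + 1) * norm u" for u
    using norm_abs_L2_le_nn_integral[OF conv_measurable[OF assms] _ main[of u]] A(1) N0
    by (simp add: conv_op_def)
  moreover have "A * N + 1 > 0" using A(1) N0 by (simp add: add_nonneg_pos)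
  ultimately show ?thesis by blast
qed

lemma square_integrable_conv: "exp_decaying \<kappa> \<Longrightarrow> square_integrable (\<lambda>x. cpair (kernel_at \<kappa> x) u)"
  using conv_norm_bound by blast

lemma bounded_clinear_conv_op:
  assumes "exp_decaying \<kappa>"
  shows "bounded_clinear (conv_op \<kappa>)"
proof -
  obtain C where "\<And>u. norm (conv_op \<kappa> u) \<le> C * norm u" using conv_norm_bound[OF assms] by blast
  then show ?thesis
    by (intro bounded_clinearI[of _ C])
      (simp_all add: conv_op_def cpair_simps abs_L2_add abs_L2_scaleC square_integrable_conv assms)
qed

text \<open>Fubini's theorem. The triple product is integrable on the plane because
  \<open>|f g| \<le> |f|^2 + |g|^2\<close> reduces it to the two one-variable estimates of
  \<open>nn_integral_exp_kernel\<close>.\<close>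

lemma cpair_conv_op:
  assumes "exp_decaying \<kappa>"
  shows "cpair u (conv_op \<kappa> v) = cpair (conv_op (\<lambda>t. \<kappa> (- t)) u) v"
proof -
  have [measurable]: "\<kappa> \<in> borel_measurable borel" using assms by auto
  obtain A \<sigma> where A: "A > 0" "\<sigma> > 0" "\<And>t. cmod (\<kappa> t) \<le> A * exp (- \<sigma> * \<bar>t\<bar>)"
    by (rule exp_decayingE[OF assms]) blast
  let ?f = "rep_L2 u" and ?g = "rep_L2 v"
  have "integrable (lborel \<Otimes>\<^sub>M lborel) (case_prod (\<lambda>x y. ?f x * \<kappa> (x - y) * ?g y))"
  proof (rule integrableI_bounded)
    have "(\<integral>\<^sup>+p. ennreal (norm (case_prod (\<lambda>x y. ?f x * \<kappa> (x - y) * ?g y) p)) \<partial>(lborel \<Otimes>\<^sub>M lborel))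
      = (\<integral>\<^sup>+x. \<integral>\<^sup>+y. ennreal (norm (?f x * \<kappa> (x - y) * ?g y)) \<partial>lborel \<partial>lborel)"
      by (subst lborel.nn_integral_fst[symmetric]) auto
    also have "\<dots> \<le> (\<integral>\<^sup>+x. \<integral>\<^sup>+y. ennreal A * (ennreal (exp (- \<sigma> * \<bar>x - y\<bar>)) * ennreal ((cmod (?f x))\<^sup>2)
        + ennreal (exp (- \<sigma> * \<bar>x - y\<bar>)) * ennreal ((cmod (?g y))\<^sup>2)) \<partial>lborel \<partial>lborel)"
    proof (intro nn_integral_mono)
      fix x y
      have "cmod (?f x) * cmod (?g y) \<le> (cmod (?f x))\<^sup>2 + (cmod (?g y))\<^sup>2"
        using sum_squares_bound[of "cmod (?f x)" "cmod (?g y)"]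
          mult_nonneg_nonneg[OF norm_ge_zero norm_ge_zero, of "?f x" "?g y"] by linarith
      then have "cmod (\<kappa> (x - y)) * (cmod (?f x) * cmod (?g y))
          \<le> (A * exp (- \<sigma> * \<bar>x - y\<bar>)) * ((cmod (?f x))\<^sup>2 + (cmod (?g y))\<^sup>2)"
        using A(1) by (intro mult_mono A(3)) auto
      then have "norm (?f x * \<kappa> (x - y) * ?g y)
          \<le> A * (exp (- \<sigma> * \<bar>x - y\<bar>) * (cmod (?f x))\<^sup>2 + exp (- \<sigma> * \<bar>x - y\<bar>) * (cmod (?g y))\<^sup>2)"
        by (simp add: norm_mult algebra_simps)
      from ennreal_leI[OF this]
      show "ennreal (norm (?f x * \<kappa> (x - y) * ?g y))
          \<le> ennreal A * (ennreal (exp (- \<sigma> * \<bar>x - y\<bar>)) * ennreal ((cmod (?f x))\<^sup>2)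
            + ennreal (exp (- \<sigma> * \<bar>x - y\<bar>)) * ennreal ((cmod (?g y))\<^sup>2))"
        using A(1) by (simp add: ennreal_mult ennreal_plus)
    qed
    also have "\<dots> = ennreal A * ((\<integral>\<^sup>+x. \<integral>\<^sup>+y. ennreal (exp (- \<sigma> * \<bar>x - y\<bar>)) * ennreal ((cmod (?f x))\<^sup>2) \<partial>lborel \<partial>lborel)
        + (\<integral>\<^sup>+x. \<integral>\<^sup>+y. ennreal (exp (- \<sigma> * \<bar>x - y\<bar>)) * ennreal ((cmod (?g y))\<^sup>2) \<partial>lborel \<partial>lborel))"
      by (simp add: nn_integral_cmult nn_integral_add)
    also have "\<dots> < \<infinity>"
      using nn_integral_square_integrable[OF square_integrable_rep_L2[of u]]
        nn_integral_square_integrable[OF square_integrable_rep_L2[of v]]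
      by (subst nn_integral_exp_kernel(2)[OF A(2)], simp, subst nn_integral_exp_kernel(1)[OF A(2)], simp)
        (simp add: ennreal_mult_less_top)
    finally show "(\<integral>\<^sup>+p. ennreal (norm (case_prod (\<lambda>x y. ?f x * \<kappa> (x - y) * ?g y) p)) \<partial>(lborel \<Otimes>\<^sub>M lborel)) < \<infinity>" .
  qed measurable
  from lborel_pair.Fubini_integral[OF this]
  have F: "(\<integral>x. \<integral>y. ?f x * \<kappa> (x - y) * ?g y \<partial>lborel \<partial>lborel) = (\<integral>y. \<integral>x. ?f x * \<kappa> (x - y) * ?g y \<partial>lborel \<partial>lborel)"
    by simp
  have "cpair u (conv_op \<kappa> v) = (\<integral>x. cpair (kernel_at \<kappa> x) v * ?f x \<partial>lborel)"
    unfolding conv_op_def cpair_commute[of u] by (rule cpair_abs_left[OF square_integrable_conv[OF assms]])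
  also have "\<dots> = (\<integral>x. \<integral>y. ?f x * \<kappa> (x - y) * ?g y \<partial>lborel \<partial>lborel)"
    by (simp add: cpair_kernel_at[OF assms] ac_simps flip: integral_mult_right_zero integral_mult_left_zero)
  also note F
  also have "(\<integral>y. \<integral>x. ?f x * \<kappa> (x - y) * ?g y \<partial>lborel \<partial>lborel)
      = (\<integral>y. cpair (kernel_at (\<lambda>t. \<kappa> (- t)) y) u * ?g y \<partial>lborel)"
  proof (rule Bochner_Integration.integral_cong[OF refl])
    fix y
    have "(\<integral>x. ?f x * \<kappa> (x - y) * ?g y \<partial>lborel) = (\<integral>x. ?f x * \<kappa> (x - y) \<partial>lborel) * ?g y"
      by (rule integral_mult_left_zero)
    then show "(\<integral>x. ?f x * \<kappa> (x - y) * ?g y \<partial>lborel) = cpair (kernel_at (\<lambda>t. \<kappa> (- t)) y) u * ?g y"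
      by (simp add: cpair_kernel_at[OF exp_decaying_reflect[OF assms]] mult.commute)
  qed
  also have "\<dots> = cpair (conv_op (\<lambda>t. \<kappa> (- t)) u) v"
    unfolding conv_op_def by (rule cpair_abs_left[symmetric, OF square_integrable_conv[OF exp_decaying_reflect[OF assms]]])
  finally show ?thesis .
qed

section \<open>The resolvent of the second derivative\<close>

text \<open>The Green's function of \<open>s^2 - d^2/dx^2\<close>, decaying when
  \<open>Re s > 0\<close>. The parameter is the root \<open>s\<close> itself, so the branch of the
  square root is chosen once, where \<open>s\<close> is introduced.\<close>

definition helmholtz_kernel :: "complex \<Rightarrow> real \<Rightarrow> complex" where
  "helmholtz_kernel s t = exp (- s * complex_of_real \<bar>t\<bar>) / (2 * s)"

text \<open>The derivative of \<open>helmholtz_kernel s\<close> away from 0. At 0, where it jumps,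
  \<open>sgn 0 = 0\<close> gives the value 0.\<close>

definition helmholtz_kernel' :: "complex \<Rightarrow> real \<Rightarrow> complex" where
  "helmholtz_kernel' s t = - complex_of_real (sgn t) * exp (- s * complex_of_real \<bar>t\<bar>) / 2"

abbreviation helmholtz :: "complex \<Rightarrow> L2 \<Rightarrow> L2" where
  "helmholtz s \<equiv> conv_op (helmholtz_kernel s)"

abbreviation helmholtz' :: "complex \<Rightarrow> L2 \<Rightarrow> L2" where
  "helmholtz' s \<equiv> conv_op (helmholtz_kernel' s)"

lemma exp_decaying_exp_abs:
  "Re s > 0 \<Longrightarrow> exp_decaying (\<lambda>t. exp (- s * complex_of_real \<bar>t\<bar>))"
  by (rule exp_decayingI[where A = 1 and \<sigma> = "Re s"]) auto

lemma exp_decaying_sgn_exp_abs: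
  "Re s > 0 \<Longrightarrow> exp_decaying (\<lambda>t. complex_of_real (sgn t) * exp (- s * complex_of_real \<bar>t\<bar>))"
  by (rule exp_decayingI[where A = 1 and \<sigma> = "Re s"]) (auto simp: norm_mult sgn_if)

lemma exp_decaying_helmholtz_kernel: "Re s > 0 \<Longrightarrow> exp_decaying (helmholtz_kernel s)"
  unfolding helmholtz_kernel_def
  by (rule exp_decayingI[where A = "1 / cmod (2 * s)" and \<sigma> = "Re s"]) (auto simp: norm_divide norm_mult)

lemma exp_decaying_helmholtz_kernel': "Re s > 0 \<Longrightarrow> exp_decaying (helmholtz_kernel' s)"
  unfolding helmholtz_kernel'_def
  by (rule exp_decayingI[where A = 1 and \<sigma> = "Re s"]) (auto simp: norm_divide norm_mult sgn_if)

lemma inv_helmholtz_eq: "inv_helmholtz = helmholtz 1"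
proof
  fix u
  have "complex_of_real (exp (- \<bar>t\<bar>) / 2) = helmholtz_kernel 1 t" for t
    by (simp add: helmholtz_kernel_def exp_of_real[symmetric])
  then show "inv_helmholtz u = helmholtz 1 u"
    by (simp only: inv_helmholtz_def conv_op_def cpair_kernel_at exp_decaying_helmholtz_kernel one_complex.sel zero_less_one)
qed

text \<open>On either side of \<open>y\<close> the kernel is a pure exponential, so each integrand
  is an exact derivative. With \<open>T\<close> beyond the support of \<open>\<psi>\<close>, the
  only boundary term is the one at \<open>y\<close>.\<close>

lemma half_line_integrals:
  assumes t: "test_function \<psi>" and T: "\<And>x. \<bar>x\<bar> > R \<Longrightarrow> \<psi> x = 0" "T > R" "T > \<bar>y\<bar>"
  shows "has_bochner_integral lborel (\<lambda>x. indicator {y..T} x *\<^sub>R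
      (exp (- s * complex_of_real (x - y)) * (complex_of_real (deriv \<psi> x) - s * complex_of_real (\<psi> x)))) (- complex_of_real (\<psi> y))"
    and "has_bochner_integral lborel (\<lambda>x. indicator {-T..y} x *\<^sub>R
      (exp (s * complex_of_real (x - y)) * (complex_of_real (deriv \<psi> x) + s * complex_of_real (\<psi> x)))) (complex_of_real (\<psi> y))"
proof -
  have z: "\<psi> T = 0" "\<psi> (- T) = 0" using T by auto
  have d: "(\<psi> has_vector_derivative deriv \<psi> x) (at x within A)" for x A
    using smooth_has_deriv[OF test_smooth[OF t]]
    by (simp add: has_real_derivative_iff_has_vector_derivative[symmetric] has_field_derivative_at_within)
  have dc: "((\<lambda>x. complex_of_real (\<psi> x)) has_vector_derivative complex_of_real (deriv \<psi> x)) (at x within A)" for x A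
    by (rule bounded_linear.has_vector_derivative[OF bounded_linear_of_real d])
  have de: "((\<lambda>x. exp (r * complex_of_real (x - y))) has_vector_derivative r * exp (r * complex_of_real (x - y))) (at x within A)" for r x A
  proof -
    have "((\<lambda>z. exp (r * (z - complex_of_real y))) has_field_derivative r * exp (r * (complex_of_real x - complex_of_real y)))
        (at (complex_of_real x))"
      by (auto intro!: derivative_eq_intros)
    from has_vector_derivative_real_field[OF this] show ?thesis
      by (auto intro: has_vector_derivative_at_within)
  qed
  have prod: "((\<lambda>x. exp (r * complex_of_real (x - y)) * complex_of_real (\<psi> x)) has_vector_derivative
     exp (r * complex_of_real (x - y)) * (complex_of_real (deriv \<psi> x) + r * complex_of_real (\<psi> x))) (at x within A)" for r x A
    by (rule has_vector_derivative_eq_rhs[OF has_vector_derivative_mult[OF de dc]]) (simp add: algebra_simps)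
  have ct: "continuous_on A (\<lambda>x. exp (r * complex_of_real (x - y)) * (complex_of_real (deriv \<psi> x) + r * complex_of_real (\<psi> x)))" for r A
    by (intro continuous_intros smooth_continuous smooth_deriv test_smooth t)
  show "has_bochner_integral lborel (\<lambda>x. indicator {y..T} x *\<^sub>R
      (exp (- s * complex_of_real (x - y)) * (complex_of_real (deriv \<psi> x) - s * complex_of_real (\<psi> x)))) (- complex_of_real (\<psi> y))"
    using has_bochner_integral_FTC_Icc[OF _ prod[of "-s"] ct[of _ "-s"], of y T] T(3) z by (simp add: abs_less_iff)
  show "has_bochner_integral lborel (\<lambda>x. indicator {-T..y} x *\<^sub>R
      (exp (s * complex_of_real (x - y)) * (complex_of_real (deriv \<psi> x) + s * complex_of_real (\<psi> x)))) (complex_of_real (\<psi> y))"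
    using has_bochner_integral_FTC_Icc[OF _ prod[of "s"] ct[of _ "s"], of "-T" y] T(3) z by (simp add: abs_less_iff)
qed

text \<open>In the sum of the two half-line integrals the boundary terms at \<open>y\<close> cancel,
  as the kernel is continuous there. In their difference they add up to \<open>2 \<psi>(y)\<close>:
  the jump of the derivative, that is, the Dirac mass in the equation of the Green's
  function.\<close>

lemma kernel_integrals_by_parts:
  assumes t: "test_function \<psi>" and s: "Re s > 0"
  shows "(\<integral>x. helmholtz_kernel s (x - y) * complex_of_real (deriv \<psi> x) \<partial>lborel)
       = - (\<integral>x. helmholtz_kernel' s (x - y) * complex_of_real (\<psi> x) \<partial>lborel)" (is ?A)
    and "(\<integral>x. helmholtz_kernel' s (x - y) * complex_of_real (deriv \<psi> x) \<partial>lborel)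
       = complex_of_real (\<psi> y) - s\<^sup>2 * (\<integral>x. helmholtz_kernel s (x - y) * complex_of_real (\<psi> x) \<partial>lborel)" (is ?B)
proof -
  have s0: "s \<noteq> 0" using s by auto
  obtain R where R: "R > 0" "\<And>x. \<bar>x\<bar> > R \<Longrightarrow> \<psi> x = 0" by (rule test_bounded[OF t]) blast
  obtain R' where R': "R' > 0" "\<And>x. \<bar>x\<bar> > R' \<Longrightarrow> deriv \<psi> x = 0" by (rule test_bounded[OF test_deriv[OF t]]) blast
  define T where "T = R + R' + \<bar>y\<bar>"
  define E where "E x = exp (- s * complex_of_real \<bar>x - y\<bar>)" for x
  define S where "S x = complex_of_real (sgn (x - y))" for x
  let ?p = "\<lambda>x. complex_of_real (\<psi> x)" and ?d = "\<lambda>x. complex_of_real (deriv \<psi> x)"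
  have zero: "\<psi> x = 0" "deriv \<psi> x = 0" if "\<bar>x\<bar> > T" for x
    using that R R' by (auto simp: T_def)
  have "T > R" "T > \<bar>y\<bar>" using R R' by (auto simp: T_def)
  note h = half_line_integrals[OF t R(2) this, of s]
  have "(\<lambda>x. indicator {y..T} x *\<^sub>R (exp (- s * complex_of_real (x - y)) * (?d x - s * ?p x)))
      = (\<lambda>x. indicator {y..T} x *\<^sub>R (E x * (?d x - s * ?p x)))"
    by (auto simp: E_def indicator_def)
  with h(1) have hR: "has_bochner_integral lborel (\<lambda>x. indicator {y..T} x *\<^sub>R (E x * (?d x - s * ?p x))) (- ?p y)"
    by metis
  have "(\<lambda>x. indicator {-T..y} x *\<^sub>R (exp (s * complex_of_real (x - y)) * (?d x + s * ?p x)))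
      = (\<lambda>x. indicator {-T..y} x *\<^sub>R (E x * (?d x + s * ?p x)))"
  proof
    fix x
    have "E x = exp (s * complex_of_real (x - y))" if "x \<le> y"
      using that by (simp add: E_def abs_of_nonpos algebra_simps)
    then show "indicator {-T..y} x *\<^sub>R (exp (s * complex_of_real (x - y)) * (?d x + s * ?p x))
        = indicator {-T..y} x *\<^sub>R (E x * (?d x + s * ?p x))"
      by (cases "x \<le> y") (simp_all add: indicator_def)
  qed
  with h(2) have hL: "has_bochner_integral lborel (\<lambda>x. indicator {-T..y} x *\<^sub>R (E x * (?d x + s * ?p x))) (?p y)"
    by metis
  have "E = (\<lambda>x. exp (- s * complex_of_real \<bar>y - x\<bar>))"
    unfolding E_def fun_eq_iff by (simp add: abs_minus_commute)
  then have sqE: "square_integrable E"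
    using square_integrable_reflect_shift[OF square_integrable_exp_decaying[OF exp_decaying_exp_abs[OF s]], of y] by simp
  have "S x = - complex_of_real (sgn (y - x))" for x by (simp add: S_def sgn_if)
  then have "(\<lambda>x. S x * E x) = (\<lambda>x. - 1 * (complex_of_real (sgn (y - x)) * exp (- s * complex_of_real \<bar>y - x\<bar>)))"
    by (simp add: E_def abs_minus_commute)
  then have sqSE: "square_integrable (\<lambda>x. S x * E x)"
    using square_integrable_scale[OF square_integrable_reflect_shift[OF
        square_integrable_exp_decaying[OF exp_decaying_sgn_exp_abs[OF s]], of y], of "- 1"] by simp
  have i: "integrable lborel (\<lambda>x. E x * ?p x)" "integrable lborel (\<lambda>x. E x * ?d x)"
    "integrable lborel (\<lambda>x. S x * E x * ?p x)" "integrable lborel (\<lambda>x. S x * E x * ?d x)"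
    by (intro integrable_mult_square_integrable sqE sqSE test_square_integrable test_deriv t)+
  \<comment> \<open>The closed intervals \<open>{y..T}\<close> and \<open>{-T..y}\<close> overlap in
    \<open>y\<close>, and there \<open>sgn\<close> is 0; this single point is discarded.\<close>
  have ne: "AE x in lborel. x \<noteq> y" by (rule AE_lborel_singleton)
  have [measurable]: "\<psi> \<in> borel_measurable borel" "deriv \<psi> \<in> borel_measurable borel"
    "E \<in> borel_measurable borel" "S \<in> borel_measurable borel"
    using t test_deriv[OF t] test_smooth sqE unfolding S_def by (auto, measurable)
  have "(\<integral>x. E x * ?d x - s * (S x * E x * ?p x) \<partial>lborel)
      = (\<integral>x. indicator {y..T} x *\<^sub>R (E x * (?d x - s * ?p x)) + indicator {-T..y} x *\<^sub>R (E x * (?d x + s * ?p x)) \<partial>lborel)"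
  proof (rule integral_cong_AE)
    show "AE x in lborel. E x * ?d x - s * (S x * E x * ?p x)
       = indicator {y..T} x *\<^sub>R (E x * (?d x - s * ?p x)) + indicator {-T..y} x *\<^sub>R (E x * (?d x + s * ?p x))"
      using ne
    proof eventually_elim
      case (elim x)
      consider "\<bar>x\<bar> > T" | "y < x" "\<bar>x\<bar> \<le> T" | "x < y" "\<bar>x\<bar> \<le> T" using elim by linarith
      then show ?case by cases (auto simp: zero indicator_def S_def algebra_simps)
    qed
  qed auto
  also have "\<dots> = - ?p y + ?p y"
    using hR hL by (simp add: has_bochner_integral_iff)
  finally have 1: "(\<integral>x. E x * ?d x \<partial>lborel) = s * (\<integral>x. S x * E x * ?p x \<partial>lborel)"
    using i by simp
  have "(\<integral>x. s * (E x * ?p x) - S x * E x * ?d x \<partial>lborel)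
      = (\<integral>x. indicator {-T..y} x *\<^sub>R (E x * (?d x + s * ?p x)) - indicator {y..T} x *\<^sub>R (E x * (?d x - s * ?p x)) \<partial>lborel)"
  proof (rule integral_cong_AE)
    show "AE x in lborel. s * (E x * ?p x) - S x * E x * ?d x
       = indicator {-T..y} x *\<^sub>R (E x * (?d x + s * ?p x)) - indicator {y..T} x *\<^sub>R (E x * (?d x - s * ?p x))"
      using ne
    proof eventually_elim
      case (elim x)
      consider "\<bar>x\<bar> > T" | "y < x" "\<bar>x\<bar> \<le> T" | "x < y" "\<bar>x\<bar> \<le> T" using elim by linarith
      then show ?case by cases (auto simp: zero indicator_def S_def algebra_simps)
    qed
  qed auto
  also have "\<dots> = ?p y - (- ?p y)"
    using hR hL by (simp add: has_bochner_integral_iff)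
  finally have 2: "s * (\<integral>x. E x * ?p x \<partial>lborel) - (\<integral>x. S x * E x * ?d x \<partial>lborel) = 2 * ?p y"
    using i by simp
  have k: "helmholtz_kernel s (x - y) * r = inverse (2 * s) * (E x * r)"
    "helmholtz_kernel' s (x - y) * r = - (1/2) * (S x * E x * r)" for x r
    by (auto simp: helmholtz_kernel_def helmholtz_kernel'_def E_def S_def field_simps)
  show ?A unfolding k integral_mult_right_zero 1 using s0 by (simp add: field_simps)
  show ?B unfolding k integral_mult_right_zero using 2 s0 by (simp add: field_simps power2_eq_square)
qed

text \<open>By transposition the reflected kernel acts on the test function instead of on
  \<open>u\<close>. There the classical integration by parts applies, so no regularity of
  \<open>u\<close> is involved.\<close>

lemma weak_deriv_helmholtz:
  assumes s: "Re s > 0"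
  shows "weak_deriv (helmholtz s u) (helmholtz' s u)"
    and "weak_deriv (helmholtz' s u) (s\<^sup>2 *\<^sub>C helmholtz s u - u)"
proof -
  note dec = exp_decaying_helmholtz_kernel[OF s] exp_decaying_helmholtz_kernel'[OF s]
  have val: "cpair (kernel_at (\<lambda>t. \<kappa> (- t)) y) (of_test \<psi>) = (\<integral>x. \<kappa> (x - y) * complex_of_real (\<psi> x) \<partial>lborel)"
    if "exp_decaying \<kappa>" "test_function \<psi>" for \<kappa> \<psi> y
    unfolding kernel_at_def of_test_def
    using square_integrable_reflect_shift[OF square_integrable_exp_decaying[OF exp_decaying_reflect[OF that(1)]], of y]
    by (subst cpair_abs_abs) (simp_all add: test_square_integrable that)
  have 1: "conv_op (\<lambda>t. helmholtz_kernel s (- t)) (of_test (deriv \<psi>))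
      = (-1) *\<^sub>C conv_op (\<lambda>t. helmholtz_kernel' s (- t)) (of_test \<psi>)"
    and 2: "conv_op (\<lambda>t. helmholtz_kernel' s (- t)) (of_test (deriv \<psi>))
      = of_test \<psi> - s\<^sup>2 *\<^sub>C conv_op (\<lambda>t. helmholtz_kernel s (- t)) (of_test \<psi>)"
    if t: "test_function \<psi>" for \<psi>
  proof -
    have sq: "square_integrable (\<lambda>y. cpair (kernel_at (\<lambda>t. helmholtz_kernel s (- t)) y) (of_test \<psi>))"
      "square_integrable (\<lambda>y. cpair (kernel_at (\<lambda>t. helmholtz_kernel' s (- t)) y) (of_test \<psi>))"
      by (intro square_integrable_conv exp_decaying_reflect dec)+
    show "conv_op (\<lambda>t. helmholtz_kernel s (- t)) (of_test (deriv \<psi>))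
      = (-1) *\<^sub>C conv_op (\<lambda>t. helmholtz_kernel' s (- t)) (of_test \<psi>)"
      unfolding conv_op_def abs_L2_scaleC[OF sq(2)]
      by (simp only: val dec t test_deriv kernel_integrals_by_parts[OF t s] mult_minus1)
    have "s\<^sup>2 *\<^sub>C conv_op (\<lambda>t. helmholtz_kernel s (- t)) (of_test \<psi>)
       = abs_L2 (\<lambda>y. s\<^sup>2 * cpair (kernel_at (\<lambda>t. helmholtz_kernel s (- t)) y) (of_test \<psi>))"
      unfolding conv_op_def by (rule abs_L2_scaleC[OF sq(1)])
    then have "of_test \<psi> - s\<^sup>2 *\<^sub>C conv_op (\<lambda>t. helmholtz_kernel s (- t)) (of_test \<psi>)
       = abs_L2 (\<lambda>y. complex_of_real (\<psi> y) - s\<^sup>2 * cpair (kernel_at (\<lambda>t. helmholtz_kernel s (- t)) y) (of_test \<psi>))"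
      by (simp add: of_test_def abs_L2_diff test_square_integrable t square_integrable_scale sq(1)[unfolded of_test_def])
    then show "conv_op (\<lambda>t. helmholtz_kernel' s (- t)) (of_test (deriv \<psi>))
      = of_test \<psi> - s\<^sup>2 *\<^sub>C conv_op (\<lambda>t. helmholtz_kernel s (- t)) (of_test \<psi>)"
      by (simp only: conv_op_def val dec t test_deriv kernel_integrals_by_parts[OF t s])
  qed
  show "weak_deriv (helmholtz s u) (helmholtz' s u)"
    unfolding weak_deriv_iff
    using 1 by (auto simp only: cpair_conv_op[OF dec(1)] cpair_conv_op[OF dec(2)] cpair_scaleC_left mult_minus1)
  show "weak_deriv (helmholtz' s u) (s\<^sup>2 *\<^sub>C helmholtz s u - u)"
    unfolding weak_deriv_iff
    using 2 by (auto simp only: cpair_conv_op[OF dec(1)] cpair_conv_op[OF dec(2)] cpair_simps minus_diff_eq)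
qed

lemma norm_indicator_L2:
  assumes "a \<le> b"
  shows "square_integrable (indicator {a..b})" "norm (abs_L2 (indicator {a..b})) = sqrt (b - a)"
proof -
  show s: "square_integrable (indicator {a..b})"
    by (rule square_integrable_compact_support[of _ 1 a b]) (auto simp: indicator_def)
  have "(cmod (indicator {a..b} x))\<^sup>2 = (indicator {a..b} x :: real)" for x
    by (auto simp: indicator_def)
  then have "(norm (abs_L2 (indicator {a..b})))\<^sup>2 = b - a"
    using assms by (simp add: norm_abs_L2_square[OF s])
  then show "norm (abs_L2 (indicator {a..b})) = sqrt (b - a)"
    by (metis norm_ge_zero real_sqrt_abs abs_of_nonneg)
qed

lemma norm_compact_support_le:
  assumes "f \<in> borel_measurable borel" "\<And>x. cmod (f x) \<le> M" "\<And>x. x \<notin> {a..b} \<Longrightarrow> f x = 0" "a \<le> b"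
  shows "norm (abs_L2 f) \<le> M * sqrt (b - a)"
proof -
  have M: "M \<ge> 0" using assms(2)[of 0] norm_ge_zero[of "f 0"] by linarith
  have "norm (abs_L2 f) \<le> M * norm (abs_L2 (indicator {a..b}))"
    using assms(2,3) M
    by (intro norm_abs_L2_le square_integrable_compact_support[OF assms(1-3)] norm_indicator_L2 assms(4))
      (auto simp: indicator_def)
  then show ?thesis by (simp add: norm_indicator_L2 assms(4))
qed

text \<open>Differentiability of translation in the norm of \<open>L2\<close>: the Taylor remainder
  is uniformly quadratic in the shift and supported in a fixed bounded interval. It lets a weak
  equation be tested against translates and become an ordinary differential equation in the
  shift.\<close>

lemma has_vector_derivative_of_test_shift:
  assumes t: "test_function \<psi>"
  shows "((\<lambda>t. of_test (\<lambda>x. \<psi> (x - t))) has_vector_derivative - of_test (\<lambda>x. deriv \<psi> (x - t))) (at t)"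
proof -
  obtain R where R: "R > 0" "\<And>x. \<bar>x\<bar> > R \<Longrightarrow> \<psi> x = 0" by (rule test_bounded[OF t]) blast
  obtain R' where R': "R' > 0" "\<And>x. \<bar>x\<bar> > R' \<Longrightarrow> deriv \<psi> x = 0" by (rule test_bounded[OF test_deriv[OF t]]) blast
  obtain M where M: "M > 0" "\<And>x. \<bar>deriv (deriv \<psi>) x\<bar> \<le> M" by (rule test_bounded[OF test_deriv[OF test_deriv[OF t]]]) blast
  have lip: "\<bar>deriv \<psi> x - deriv \<psi> y\<bar> \<le> M * \<bar>x - y\<bar>" for x y
    using field_differentiable_bound[of UNIV "deriv \<psi>" "deriv (deriv \<psi>)" M x y] M(2)
      smooth_has_deriv[OF smooth_deriv[OF test_smooth[OF t]]] by simp
  \<comment> \<open>The mean value inequality for \<open>\<psi>\<close> minus its tangent at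
    \<open>x\<close>, whose derivative is at most \<open>M |h|\<close> on the segment.\<close>
  have taylor: "\<bar>\<psi> (x - h) - \<psi> x + h * deriv \<psi> x\<bar> \<le> M * h\<^sup>2" for x h
  proof -
    let ?S = "closed_segment x (x - h)"
    have "norm ((\<psi> (x - h) - deriv \<psi> x * (x - h)) - (\<psi> x - deriv \<psi> x * x)) \<le> (M * \<bar>h\<bar>) * norm ((x - h) - x)"
    proof (rule field_differentiable_bound[where S = ?S and f' = "\<lambda>y. deriv \<psi> y - deriv \<psi> x"])
      fix z assume z: "z \<in> ?S"
      show "((\<lambda>y. \<psi> y - deriv \<psi> x * y) has_field_derivative deriv \<psi> z - deriv \<psi> x) (at z within ?S)"
        using has_field_derivative_at_within[OF DERIV_diff[OF
            smooth_has_deriv[OF test_smooth[OF t]] DERIV_cmult[OF DERIV_ident]]]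
        by simp
      have "\<bar>z - x\<bar> \<le> \<bar>h\<bar>" using z by (auto simp: closed_segment_eq_real_ivl split: if_splits)
      then show "norm (deriv \<psi> z - deriv \<psi> x) \<le> M * \<bar>h\<bar>"
        using order_trans[OF lip[of z x] mult_left_mono[of "\<bar>z - x\<bar>" "\<bar>h\<bar>" M]] M(1) by simp
    qed auto
    then show ?thesis by (simp add: algebra_simps power2_eq_square)
  qed
  \<comment> \<open>The length of an interval containing the supports of both translates of
    \<open>\<psi>\<close> and of the translated derivative; the summand 1 allows for shifts with
    \<open>|y - t| < 1\<close>.\<close>
  define L where "L = 2 * (R + R' + 1)"
  have bound: "norm (of_test (\<lambda>x. \<psi> (x - y)) - of_test (\<lambda>x. \<psi> (x - t)) - (y - t) *\<^sub>R - of_test (\<lambda>x. deriv \<psi> (x - t)))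
      \<le> M * (y - t)\<^sup>2 * sqrt L" if "\<bar>y - t\<bar> < 1" for y
  proof -
    let ?h = "y - t"
    let ?f = "\<lambda>x. complex_of_real (\<psi> (x - y) - \<psi> (x - t) + ?h * deriv \<psi> (x - t))"
    have [measurable]: "\<psi> \<in> borel_measurable borel" "deriv \<psi> \<in> borel_measurable borel"
      using t test_deriv[OF t] test_smooth by auto
    have ts: "test_function (\<lambda>x. \<psi> (x - y))" "test_function (\<lambda>x. \<psi> (x - t))" "test_function (\<lambda>x. deriv \<psi> (x - t))"
      by (intro test_shift test_deriv t)+
    have "of_test (\<lambda>x. \<psi> (x - y)) - of_test (\<lambda>x. \<psi> (x - t)) - ?h *\<^sub>R - of_test (\<lambda>x. deriv \<psi> (x - t))
       = of_test (\<lambda>x. \<psi> (x - y)) - of_test (\<lambda>x. \<psi> (x - t)) + complex_of_real ?h *\<^sub>C of_test (\<lambda>x. deriv \<psi> (x - t))"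
      by (simp add: scaleR_L2_eq)
    also have "\<dots> = abs_L2 ?f"
      unfolding of_test_def
      by (simp add: abs_L2_diff abs_L2_scaleC abs_L2_add test_square_integrable ts square_integrable_diff square_integrable_scale)
    finally have eq: "of_test (\<lambda>x. \<psi> (x - y)) - of_test (\<lambda>x. \<psi> (x - t)) - ?h *\<^sub>R - of_test (\<lambda>x. deriv \<psi> (x - t)) = abs_L2 ?f" .
    have "norm (abs_L2 ?f) \<le> M * ?h\<^sup>2 * sqrt ((t + (R + R' + 1)) - (t - (R + R' + 1)))"
    proof (rule norm_compact_support_le)
      show "cmod (?f x) \<le> M * ?h\<^sup>2" for x
        using taylor[of "x - t" ?h] unfolding norm_of_real by (simp add: algebra_simps)
      show "?f x = 0" if "x \<notin> {t - (R + R' + 1)..t + (R + R' + 1)}" for x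
      proof -
        have "\<bar>x - t\<bar> > R + R' + 1" using that unfolding atLeastAtMost_iff by linarith
        then have "\<bar>x - t\<bar> > R" "\<bar>x - y\<bar> > R" "\<bar>x - t\<bar> > R'" using \<open>\<bar>y - t\<bar> < 1\<close> R(1) R'(1) by linarith+
        then have "\<psi> (x - t) = 0" "\<psi> (x - y) = 0" "deriv \<psi> (x - t) = 0" by (auto intro: R(2) R'(2))
        then show ?thesis by simp
      qed
    qed (use R(1) R'(1) in auto)
    then show ?thesis unfolding eq L_def by (simp add: add.assoc)
  qed
  show ?thesis
    unfolding has_vector_derivative_def
  proof (rule has_derivativeI_sandwich[where e = 1 and H = "\<lambda>y. M * sqrt L * \<bar>y - t\<bar>"])
    have "((\<lambda>y. M * sqrt L * \<bar>y - t\<bar>) \<longlongrightarrow> M * sqrt L * \<bar>t - t\<bar>) (at t)"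
      by (intro tendsto_intros)
    then show "((\<lambda>y. M * sqrt L * \<bar>y - t\<bar>) \<longlongrightarrow> 0) (at t)" by simp
    fix y assume "y \<noteq> t" "dist y t < 1"
    then show "norm (of_test (\<lambda>x. \<psi> (x - y)) - of_test (\<lambda>x. \<psi> (x - t)) - (y - t) *\<^sub>R - of_test (\<lambda>x. deriv \<psi> (x - t))) / norm (y - t)
        \<le> M * sqrt L * \<bar>y - t\<bar>"
    proof -
      have "(y - t)\<^sup>2 = \<bar>y - t\<bar> * \<bar>y - t\<bar>" by (simp add: power2_eq_square)
      then have "M * (y - t)\<^sup>2 * sqrt L = M * sqrt L * \<bar>y - t\<bar> * norm (y - t)" by simp
      moreover have "norm (y - t) > 0" using \<open>y \<noteq> t\<close> by simp
      ultimately show ?thesis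
        using bound[of y] \<open>dist y t < 1\<close> by (simp only: dist_real_def pos_divide_le_eq)
    qed
  next
    show "bounded_linear (\<lambda>x. x *\<^sub>R - of_test (\<lambda>x. deriv \<psi> (x - t)))"
      by (rule bounded_linear_scaleR_left)
  qed simp
qed

text \<open>A nonzero solution of \<open>h' = s h\<close> has modulus
  \<open>|h 0| exp (t Re s)\<close>, which is unbounded in one of the two time directions.\<close>

lemma bounded_exponential_zero:
  fixes h :: "real \<Rightarrow> complex"
  assumes h: "\<And>t. (h has_vector_derivative s * h t) (at t)" and b: "\<And>t. cmod (h t) \<le> B" and s: "Re s \<noteq> 0"
  shows "h 0 = 0"
proof -
  have "((\<lambda>t. exp (- s * complex_of_real t) * h t) has_derivative (\<lambda>x. 0)) (at t within UNIV)" for t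
  proof -
    have "((\<lambda>z. exp (- s * z)) has_field_derivative - s * exp (- s * complex_of_real t)) (at (complex_of_real t))"
      by (auto intro!: derivative_eq_intros)
    from has_vector_derivative_mult[OF has_vector_derivative_real_field[OF this] h[of t]]
    have "((\<lambda>t. exp (- s * complex_of_real t) * h t) has_vector_derivative 0) (at t)"
      by (simp add: algebra_simps)
    then show ?thesis by (simp add: has_vector_derivative_def)
  qed
  then obtain c where c: "\<And>t. exp (- s * complex_of_real t) * h t = c"
    using has_derivative_zero_constant[of UNIV "\<lambda>t. exp (- s * complex_of_real t) * h t"] by auto
  have ht: "h t = h 0 * exp (s * complex_of_real t)" for t
  proof -
    have "exp (- s * complex_of_real t) * h t = h 0" using c[of t] c[of 0] by simp
    then show ?thesis by (simp add: exp_minus field_simps)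
  qed
  have le: "cmod (h 0) * exp (Re s * t) \<le> B" for t
    using b[of t] unfolding ht[of t] by (simp add: norm_mult)
  show ?thesis
  proof (rule ccontr)
    assume "h 0 \<noteq> 0"
    \<comment> \<open>At the time \<open>ln r / Re s\<close> the modulus of \<open>h\<close> would
      be \<open>B + 1\<close>.\<close>
    define r where "r = (B + 1) / cmod (h 0)"
    have "B \<ge> 0" using b[of 0] norm_ge_zero[of "h 0"] by linarith
    then have "r > 0" using \<open>h 0 \<noteq> 0\<close> by (simp add: r_def)
    then have "exp (Re s * (ln r / Re s)) = r" using s by simp
    then have "cmod (h 0) * r \<le> B" using le[of "ln r / Re s"] by simp
    then show False using \<open>h 0 \<noteq> 0\<close> by (simp add: r_def)
  qed
qed

text \<open>Smearing a weak solution of \<open>d'' = s\<^sup>2 d\<close> with translates of a test function gives a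
  bounded classical solution, which vanishes because \<open>s\<close> is not purely imaginary.\<close>

lemma weak_helmholtz_unique:
  assumes d: "weak_deriv d d'" "weak_deriv d' (s\<^sup>2 *\<^sub>C d)" and s: "Re s > 0"
  shows "d = 0"
proof (rule L2_zero_if_test_zero)
  fix \<psi> assume t: "test_function \<psi>"
  obtain M R where MR: "M > 0" "R > 0" "\<And>x. \<bar>\<psi> x\<bar> \<le> M" "\<And>x. \<bar>x\<bar> > R \<Longrightarrow> \<psi> x = 0" by (rule test_bounded[OF t]) blast
  have [measurable]: "\<psi> \<in> borel_measurable borel" using t test_smooth by auto
  let ?\<psi> = "\<lambda>t. of_test (\<lambda>x. \<psi> (x - t))"
  have bd: "norm (?\<psi> t) \<le> M * sqrt (2 * R)" for t
  proof -
    have "norm (abs_L2 (\<lambda>x. complex_of_real (\<psi> (x - t)))) \<le> M * sqrt ((t + R) - (t - R))"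
      using MR by (intro norm_compact_support_le) auto
    then show ?thesis by (simp add: of_test_def)
  qed
  have D: "((\<lambda>t. cpair (?\<psi> t) w) has_vector_derivative cpair (?\<psi> t) w') (at t)" if "weak_deriv w w'" for w w' t
  proof -
    have bl: "bounded_linear (\<lambda>v. cpair v w)"
      by (rule bounded_linear_intro[where K = "norm w"])
        (auto simp: cpair_simps scaleR_L2_eq scaleR_conv_of_real norm_cpair_le)
    from bounded_linear.has_vector_derivative[OF bl has_vector_derivative_of_test_shift[OF t]]
    have "((\<lambda>t. cpair (?\<psi> t) w) has_vector_derivative cpair (- of_test (\<lambda>x. deriv \<psi> (x - t))) w) (at t)" .
    moreover have "cpair (- of_test (\<lambda>x. deriv \<psi> (x - t))) w = cpair (?\<psi> t) w'"
      using that test_shift[OF t, of t] deriv_shift[OF test_smooth[OF t], of t]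
        cpair_scaleC_left[of "-1" "of_test (\<lambda>x. deriv \<psi> (x - t))" w]
      by (force simp: weak_deriv_iff)
    ultimately show ?thesis by simp
  qed
  let ?F = "\<lambda>t. cpair (?\<psi> t) d" and ?F' = "\<lambda>t. cpair (?\<psi> t) d'"
  have F: "(?F has_vector_derivative ?F' t) (at t)" for t by (rule D[OF d(1)])
  have F': "(?F' has_vector_derivative s\<^sup>2 * ?F t) (at t)" for t
    using D[OF d(2)] by (simp add: cpair_simps)
  have bF: "cmod (cpair (?\<psi> t) w) \<le> M * sqrt (2 * R) * norm w" for t w
    by (rule order_trans[OF norm_cpair_le]) (intro mult_right_mono bd, simp)
  \<comment> \<open>The factorization of \<open>d^2/dt^2 - s^2\<close>: the combinations
    \<open>F' + s F\<close> and \<open>F' - s F\<close> solve first-order equations with rates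
    \<open>s\<close> and \<open>- s\<close>, so boundedness kills both.\<close>
  have "?F' 0 + s * ?F 0 = 0"
  proof (rule bounded_exponential_zero)
    show "((\<lambda>t. ?F' t + s * ?F t) has_vector_derivative s * (?F' t + s * ?F t)) (at t)" for t
      by (rule has_vector_derivative_eq_rhs[OF has_vector_derivative_add[OF F' has_vector_derivative_mult_right[OF F]]])
        (simp add: algebra_simps power2_eq_square)
    show "cmod (?F' t + s * ?F t) \<le> M * sqrt (2 * R) * norm d' + cmod s * (M * sqrt (2 * R) * norm d)" for t
      by (rule order_trans[OF norm_triangle_ineq]) (auto simp: norm_mult intro!: add_mono bF mult_left_mono)
  qed (use s in simp)
  moreover have "?F' 0 - s * ?F 0 = 0"
  proof (rule bounded_exponential_zero)
    show "((\<lambda>t. ?F' t - s * ?F t) has_vector_derivative - s * (?F' t - s * ?F t)) (at t)" for t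
      by (rule has_vector_derivative_eq_rhs[OF has_vector_derivative_diff[OF F' has_vector_derivative_mult_right[OF F]]])
        (simp add: algebra_simps power2_eq_square)
    show "cmod (?F' t - s * ?F t) \<le> M * sqrt (2 * R) * norm d' + cmod s * (M * sqrt (2 * R) * norm d)" for t
      by (rule order_trans[OF norm_triangle_ineq4]) (auto simp: norm_mult intro!: add_mono bF mult_left_mono)
  qed (use s in simp)
  ultimately have "2 * s * ?F 0 = 0" by (simp add: algebra_simps)
  then show "cpair (of_test \<psi>) d = 0" using s by auto
qed

text \<open>The candidate and \<open>u\<close> differ by a weak solution of the homogeneous
  equation, which is zero. Besides inverting the operator on \<open>H2\<close>, applied to functions
  \<open>helmholtz s f\<close> with another parameter this yields the resolvent identity.\<close>

lemma helmholtz_weak_second_deriv: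
  assumes u: "weak_deriv u v" "weak_deriv v w" and s: "Re s > 0"
  shows "helmholtz s (s\<^sup>2 *\<^sub>C u - w) = u" "helmholtz' s (s\<^sup>2 *\<^sub>C u - w) = v"
proof -
  let ?f = "s\<^sup>2 *\<^sub>C u - w"
  have 1: "weak_deriv (helmholtz s ?f - u) (helmholtz' s ?f - v)"
    by (intro weak_deriv_diff weak_deriv_helmholtz u s)
  have "weak_deriv (helmholtz' s ?f - v) ((s\<^sup>2 *\<^sub>C helmholtz s ?f - ?f) - w)"
    by (intro weak_deriv_diff weak_deriv_helmholtz u s)
  then have 2: "weak_deriv (helmholtz' s ?f - v) (s\<^sup>2 *\<^sub>C (helmholtz s ?f - u))"
    by (simp add: L2.scale_right_diff_distrib)
  show 3: "helmholtz s ?f = u" using weak_helmholtz_unique[OF 1 2 s] by simp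
  show "helmholtz' s ?f = v"
    using weak_deriv_unique[OF weak_deriv_helmholtz(1)[OF s, of ?f]] u(1) unfolding 3 by simp
qed

lemma helmholtz_in_H2: "Re s > 0 \<Longrightarrow> helmholtz s u \<in> H2"
  unfolding H2_def using weak_deriv_helmholtz by blast

definition one_minus_Dxx :: "L2 \<Rightarrow> L2" where
  "one_minus_Dxx u = u - Dx (Dx u)"

lemma one_minus_Dxx_eq: "weak_deriv u v \<Longrightarrow> weak_deriv v w \<Longrightarrow> one_minus_Dxx u = u - w"
  by (simp add: one_minus_Dxx_def Dx_eq)

lemma one_minus_Dxx_helmholtz: "one_minus_Dxx (helmholtz 1 f) = f"
  using one_minus_Dxx_eq[OF weak_deriv_helmholtz[of 1]] by simp

lemma helmholtz_one_minus_Dxx: "u \<in> H2 \<Longrightarrow> helmholtz 1 (one_minus_Dxx u) = u"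
  using helmholtz_weak_second_deriv(1)[of u _ _ 1] by (auto simp: H2_def one_minus_Dxx_eq)

text \<open>The inverse of \<open>1 - r G\<close> with \<open>G = (1 - \<partial>\<^sub>x\<^sup>2)\<^sup>-\<^sup>1\<close> is \<open>1 + r (1 - r - \<partial>\<^sub>x\<^sup>2)\<^sup>-\<^sup>1\<close>.\<close>

lemma one_minus_helmholtz_inverse:
  assumes s: "Re s > 0" and r: "r = 1 - s\<^sup>2"
  shows "(f + r *\<^sub>C helmholtz s f) - r *\<^sub>C helmholtz 1 (f + r *\<^sub>C helmholtz s f) = f"
    and "(f - r *\<^sub>C helmholtz 1 f) + r *\<^sub>C helmholtz s (f - r *\<^sub>C helmholtz 1 f) = f"
proof -
  \<comment> \<open>The second weak derivative of \<open>helmholtz s f\<close> is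
    \<open>s^2 helmholtz s f - f\<close>, so the inversion formula with parameter 1 applies to it:
    one half of the resolvent identity.\<close>
  have "helmholtz 1 (1\<^sup>2 *\<^sub>C helmholtz s f - (s\<^sup>2 *\<^sub>C helmholtz s f - f)) = helmholtz s f"
    by (rule helmholtz_weak_second_deriv(1)[OF weak_deriv_helmholtz[OF s]]) simp
  also have "1\<^sup>2 *\<^sub>C helmholtz s f - (s\<^sup>2 *\<^sub>C helmholtz s f - f) = f + r *\<^sub>C helmholtz s f"
    by (simp add: r L2.scale_left_diff_distrib)
  finally show "(f + r *\<^sub>C helmholtz s f) - r *\<^sub>C helmholtz 1 (f + r *\<^sub>C helmholtz s f) = f" by simp
  have "helmholtz s (s\<^sup>2 *\<^sub>C helmholtz 1 f - (1\<^sup>2 *\<^sub>C helmholtz 1 f - f)) = helmholtz 1 f"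
    by (rule helmholtz_weak_second_deriv(1)[OF weak_deriv_helmholtz s]) simp_all
  also have "s\<^sup>2 *\<^sub>C helmholtz 1 f - (1\<^sup>2 *\<^sub>C helmholtz 1 f - f) = f - r *\<^sub>C helmholtz 1 f"
    by (simp add: r L2.scale_left_diff_distrib)
  finally show "(f - r *\<^sub>C helmholtz 1 f) + r *\<^sub>C helmholtz s (f - r *\<^sub>C helmholtz 1 f) = f" by simp
qed

section \<open>Perturbations of the identity of finite rank\<close>

interpretation L2_pair: vector_space_pair scaleC scaleC ..

text \<open>The coordinates of a common element with respect to \<open>B\<close> are supported in
  \<open>X\<close> and in \<open>B - X\<close> at once, hence vanish.\<close>

lemma span_Int_complement_basis:
  assumes "L2.independent B" "X \<subseteq> B"
  shows "L2.span X \<inter> L2.span (B - X) = {0}"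
proof -
  have "x = 0" if x: "x \<in> L2.span X" "x \<in> L2.span (B - X)" for x
  proof -
    have r: "L2.representation B x = L2.representation X x" "L2.representation B x = L2.representation (B - X) x"
      using L2.representation_extend[OF assms(1) x(1) assms(2)] L2.representation_extend[OF assms(1) x(2)] by auto
    have "L2.representation B x b = 0" for b
      using L2.representation_ne_zero[of X x b] L2.representation_ne_zero[of "B - X" x b] r by auto
    then show "x = 0"
      using L2.sum_nonzero_representation_eq[OF assms(1), of x] x(1) L2.span_mono[OF assms(2)] by auto
  qed
  then show ?thesis by (auto intro: L2.span_zero)
qed

lemma finite_dim_basis:
  assumes "L2.subspace W" "finite_dim W" "X \<subseteq> W" "L2.independent X"
  obtains B where "X \<subseteq> B" "L2.independent B" "L2.span B = W" "finite B" "card B = L2.dim W"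
proof -
  obtain B where B: "X \<subseteq> B" "B \<subseteq> W" "L2.independent B" "W \<subseteq> L2.span B"
    using L2.maximal_independent_subset_extend[OF assms(3,4)] by blast
  obtain F where "finite F" "W \<subseteq> L2.span F" using assms(2) by (auto simp: finite_dim_def)
  then have "finite B" using L2.independent_span_bound[of F B] B by auto
  moreover have "L2.span B = W"
    using B L2.span_minimal[OF B(2) assms(1)] by auto
  ultimately show ?thesis using that B L2.basis_card_eq_dim by metis
qed

text \<open>Rank-nullity in the form needed for an index. A basis of the kernel extends to a basis
  \<open>B\<close> of \<open>W\<close>; the images of the added vectors are independent and extend
  to a basis \<open>D\<close> of \<open>W\<close>. As \<open>B\<close> and \<open>D\<close> have
  equal size, as many vectors are added to the image as lie in the kernel basis.\<close>

lemma image_complement_dim: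
  assumes W: "L2.subspace W" "finite_dim W" and T: "Vector_Spaces.linear scaleC scaleC T" "T ` W \<subseteq> W"
  obtains W' where "L2.subspace W'" "W' \<subseteq> W" "T ` W \<inter> W' = {0}" "\<And>w. w \<in> W \<Longrightarrow> \<exists>x\<in>W. \<exists>y\<in>W'. w = T x + y"
    "L2.dim W' = L2.dim {w \<in> W. T w = 0}"
proof -
  interpret T: Vector_Spaces.linear scaleC scaleC T by (rule T(1))
  let ?K = "{w \<in> W. T w = 0}"
  have sK: "L2.subspace ?K"
    using W(1) by (auto simp: L2.subspace_def T.add T.scale)
  have fK: "finite_dim ?K" using W(2) by (auto simp: finite_dim_def)
  obtain Bk where Bk: "L2.independent Bk" "L2.span Bk = ?K" "finite Bk" "card Bk = L2.dim ?K"
    by (rule finite_dim_basis[OF sK fK, of "{}"]) (auto simp: L2.independent_empty)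
  have BkK: "Bk \<subseteq> ?K" using L2.span_superset[of Bk] Bk(2) by simp
  obtain B where B: "Bk \<subseteq> B" "L2.independent B" "L2.span B = W" "finite B" "card B = L2.dim W"
    by (rule finite_dim_basis[OF W, of Bk]) (use BkK Bk(1) in auto)
  let ?C = "B - Bk"
  have CW: "L2.span ?C \<subseteq> W" using L2.span_mono[of ?C B] B(3) by auto
  have inj: "inj_on T (L2.span ?C)"
  proof (rule T.inj_on_iff_eq_0[THEN iffD2])
    show "\<forall>x\<in>L2.span ?C. T x = 0 \<longrightarrow> x = 0"
      using span_Int_complement_basis[OF B(2,1)] CW Bk(2) by auto
  qed (rule L2.subspace_span)
  have iC: "L2.independent (T ` ?C)"
    using B(2) L2.independent_mono[of B ?C] inj by (intro T.independent_injective_image) auto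
  have cC: "card (T ` ?C) = card ?C"
    using inj_on_subset[OF inj L2.span_superset] by (rule card_image)
  have TW: "T ` W = L2.span (T ` ?C)"
  proof -
    have "T ` W = L2.span (T ` B)" using T.span_image[of B] B(3) by simp
    also have "T ` B = T ` ?C \<union> T ` Bk" using B(1) by auto
    also have "L2.span (T ` ?C \<union> T ` Bk) = L2.span (T ` ?C)"
    proof
      have "T ` ?C \<union> T ` Bk \<subseteq> L2.span (T ` ?C)"
      proof (intro Un_least)
        have "T b = 0" if "b \<in> Bk" for b using that BkK by blast
        then show "T ` Bk \<subseteq> L2.span (T ` ?C)" by (metis L2.span_zero image_subsetI)
      qed (rule L2.span_superset)
      then show "L2.span (T ` ?C \<union> T ` Bk) \<subseteq> L2.span (T ` ?C)"
        by (rule L2.span_minimal) (rule L2.subspace_span)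
    qed (intro L2.span_mono, auto)
    finally show ?thesis .
  qed
  have TCW: "T ` ?C \<subseteq> W" using T(2) TW L2.span_superset[of "T ` ?C"] by auto
  obtain D where D: "T ` ?C \<subseteq> D" "L2.independent D" "L2.span D = W" "finite D" "card D = L2.dim W"
    by (rule finite_dim_basis[OF W TCW iC]) blast
  let ?W' = "L2.span (D - T ` ?C)"
  have "L2.dim ?W' = card (D - T ` ?C)"
    using D(2) L2.independent_mono[of D "D - T ` ?C"] by (intro L2.dim_span_eq_card_independent) auto
  also have "\<dots> = card D - card ?C" using D(1,4) cC B(4) by (simp add: card_Diff_subset finite_subset)
  also have "\<dots> = card Bk" using B D(5) Bk(3) card_mono[OF B(4,1)] by (simp add: card_Diff_subset)
  finally have dim: "L2.dim ?W' = L2.dim ?K" using Bk(4) by simp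
  show ?thesis
  proof (rule that[OF _ _ _ _ dim])
    show "L2.subspace ?W'" by (rule L2.subspace_span)
    show "?W' \<subseteq> W" using L2.span_mono[of "D - T ` ?C" D] D(3) by auto
    show "T ` W \<inter> ?W' = {0}" unfolding TW by (rule span_Int_complement_basis[OF D(2,1)])
    fix w assume "w \<in> W"
    then have "w \<in> L2.span (T ` ?C \<union> (D - T ` ?C))" using D(1,3) by (simp add: Un_absorb1)
    then obtain a y where "w = a + y" "a \<in> L2.span (T ` ?C)" "y \<in> ?W'"
      unfolding L2.span_Un by blast
    moreover from this(2) obtain x where "x \<in> W" "a = T x" unfolding TW[symmetric] by (rule imageE)
    ultimately show "\<exists>x\<in>W. \<exists>y\<in>?W'. w = T x + y" by blast
  qed
qed

text \<open>Projection along \<open>V\<close> onto \<open>W2\<close> is injective on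
  \<open>W1\<close>. Applied both ways this makes codimension well defined, which the definite
  description in \<open>codim\<close> requires.\<close>

lemma complement_dim_le:
  assumes V: "L2.subspace V" and W1: "complement V W1" and W2: "complement V W2"
    and fin: "finite_dim W1" "finite_dim W2"
  shows "L2.dim W1 \<le> L2.dim W2"
proof -
  have s: "L2.subspace W1" "L2.subspace W2" using W1 W2 by (auto simp: complement_def)
  have uniq: "w = w'" if "w \<in> W2" "w' \<in> W2" "u - w \<in> V" "u - w' \<in> V" for u w w'
  proof -
    have "w - w' \<in> W2" using that s(2) by (simp add: L2.subspace_diff)
    moreover have "w - w' \<in> V" using L2.subspace_diff[OF V that(4,3)] by simp
    ultimately have "w - w' = 0" using W2 unfolding complement_def by blast
    then show ?thesis by simp
  qed
  have ex: "\<exists>w. w \<in> W2 \<and> u - w \<in> V" for u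
  proof -
    obtain v w where "v \<in> V" "w \<in> W2" "u = v + w" using W2 unfolding complement_def by blast
    then show ?thesis by (intro exI[of _ w]) simp
  qed
  \<comment> \<open>The component in \<open>W2\<close> is unique, so linearity of the chosen
    function follows from \<open>uniq\<close> alone.\<close>
  define \<pi> where "\<pi> u = (SOME w. w \<in> W2 \<and> u - w \<in> V)" for u
  have \<pi>: "\<pi> u \<in> W2" "u - \<pi> u \<in> V" for u
    using someI_ex[OF ex[of u]] by (auto simp: \<pi>_def)
  have lin: "Vector_Spaces.linear scaleC scaleC \<pi>"
  proof
    show "\<pi> (u + v) = \<pi> u + \<pi> v" for u v
    proof (rule uniq[of _ _ "u + v"])
      show "u + v - (\<pi> u + \<pi> v) \<in> V" using L2.subspace_add[OF V \<pi>(2)[of u] \<pi>(2)[of v]] by (simp add: algebra_simps)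
    qed (auto intro: \<pi> L2.subspace_add s)
    show "\<pi> (z *\<^sub>C u) = z *\<^sub>C \<pi> u" for z u
    proof (rule uniq[of _ _ "z *\<^sub>C u"])
      show "z *\<^sub>C u - z *\<^sub>C \<pi> u \<in> V" using L2.subspace_scale[OF V \<pi>(2)[of u], of z] by (simp add: L2.scale_right_diff_distrib)
    qed (auto intro: \<pi> L2.subspace_scale s)
  qed
  interpret \<pi>: Vector_Spaces.linear scaleC scaleC \<pi> by (rule lin)
  obtain B1 where B1: "L2.independent B1" "L2.span B1 = W1" "finite B1" "card B1 = L2.dim W1"
    by (rule finite_dim_basis[OF s(1) fin(1), of "{}"]) (auto simp: L2.independent_empty)
  obtain B2 where B2: "L2.independent B2" "L2.span B2 = W2" "finite B2" "card B2 = L2.dim W2"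
    by (rule finite_dim_basis[OF s(2) fin(2), of "{}"]) (auto simp: L2.independent_empty)
  have inj: "inj_on \<pi> (L2.span B1)"
  proof (rule \<pi>.inj_on_iff_eq_0[THEN iffD2])
    show "\<forall>x\<in>L2.span B1. \<pi> x = 0 \<longrightarrow> x = 0"
    proof (intro ballI impI)
      fix x assume "x \<in> L2.span B1" "\<pi> x = 0"
      then have "x \<in> V \<inter> W1" using \<pi>(2)[of x] B1(2) by simp
      then show "x = 0" using W1 by (auto simp: complement_def)
    qed
  qed (rule L2.subspace_span)
  have "L2.independent (\<pi> ` B1)" using B1(1) inj by (rule \<pi>.independent_injective_image)
  moreover have "\<pi> ` B1 \<subseteq> L2.span B2" using \<pi>(1) B2(2) by auto
  ultimately have "card (\<pi> ` B1) \<le> card B2" using L2.independent_span_bound[OF B2(3)] by blast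
  moreover have "card (\<pi> ` B1) = card B1"
    using inj_on_subset[OF inj L2.span_superset] by (rule card_image)
  ultimately show ?thesis using B1(4) B2(4) by simp
qed

lemma codim_eq:
  assumes "L2.subspace V" "complement V W" "finite_dim W"
  shows "codim V = L2.dim W"
  unfolding codim_def
proof (rule the_equality)
  show "has_codim V (L2.dim W)" using assms by (auto simp: has_codim_def)
  show "n = L2.dim W" if n: "has_codim V n" for n
    using n complement_dim_le[OF assms(1)] assms(2,3) by (auto simp: has_codim_def intro: antisym)
qed

text \<open>The span is the fixed-point set of the orthogonal projection onto it, which is
  continuous.\<close>

lemma closed_span_finite:
  fixes B :: "'a::real_inner set"
  assumes "finite B"
  shows "closed (span B)"
proof -
  obtain C where C: "finite C" "span C = span B" "pairwise orthogonal C"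
    using basis_orthogonal[OF assms] by blast
  \<comment> \<open>The orthogonal set \<open>C\<close> may contain 0; as division by zero gives 0,
    its term is harmless.\<close>
  define P where "P y = (\<Sum>c\<in>C. (inner y c / inner c c) *\<^sub>R c)" for y
  have PC: "P c = c" if "c \<in> C" for c
  proof -
    have "P c = (\<Sum>d\<in>C. if d = c then c else 0)"
      unfolding P_def
    proof (rule sum.cong[OF refl])
      fix d assume "d \<in> C"
      then have "d \<noteq> c \<Longrightarrow> inner c d = 0"
        using C(3) that by (auto simp: pairwise_def orthogonal_def)
      then show "(inner c d / inner d d) *\<^sub>R d = (if d = c then c else 0)" by auto
    qed
    then show ?thesis using C(1) that by simp
  qed
  have "subspace {y. P y = y}"
  proof (rule subspaceI)
    fix r :: real and x assume "x \<in> {y. P y = y}"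
    moreover have "P (r *\<^sub>R x) = r *\<^sub>R P x"
      unfolding P_def scaleR_right.sum by simp
    ultimately show "r *\<^sub>R x \<in> {y. P y = y}" by simp
  next
    fix x y assume "x \<in> {y. P y = y}" "y \<in> {y. P y = y}"
    moreover have "P (x + y) = P x + P y"
      unfolding P_def inner_add_left add_divide_distrib scaleR_add_left sum.distrib ..
    ultimately show "x + y \<in> {y. P y = y}" by simp
  qed (simp add: P_def)
  then have "span C \<subseteq> {y. P y = y}" using PC by (intro span_minimal) auto
  moreover have "{y. P y = y} \<subseteq> span C"
  proof
    fix y assume "y \<in> {y. P y = y}"
    then have "y = P y" by simp
    also have "P y \<in> span C" unfolding P_def by (intro span_sum span_scale span_base)
    finally show "y \<in> span C" .
  qed
  ultimately have "span B = {y. P y = y}" using C(2) by auto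
  moreover have "closed {y. P y = y}"
    unfolding P_def divide_inverse
    by (intro closed_Collect_eq continuous_on_sum continuous_on_scaleR continuous_on_mult_right
        continuous_on_inner continuous_on_const continuous_on_id)
  ultimately show ?thesis by simp
qed

text \<open>The complex span of \<open>B\<close> is the real span of \<open>B\<close> together with
  \<open>\<i> B\<close>, which brings the real result to bear.\<close>

lemma closed_finite_dim:
  assumes "L2.subspace W" "finite_dim W"
  shows "closed W"
proof -
  obtain B where B: "L2.span B = W" "finite B"
    by (rule finite_dim_basis[OF assms, of "{}"]) (auto simp: L2.independent_empty)
  let ?R = "span (B \<union> scaleC \<i> ` B)"
  have iR: "\<i> *\<^sub>C x \<in> ?R" if "x \<in> ?R" for x
    using that
  proof (induction rule: span_induct_alt)
    case base
    then show ?case by (simp add: span_zero)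
  next
    case (step r x y)
    have "\<i> *\<^sub>C x \<in> ?R"
    proof (cases "x \<in> B")
      case False
      then obtain b where "b \<in> B" "x = \<i> *\<^sub>C b" using step(1) by auto
      then have "\<i> *\<^sub>C x = - b" by simp
      then show ?thesis using \<open>b \<in> B\<close> by (simp add: span_base span_neg)
    qed (auto intro: span_base)
    then have "r *\<^sub>R (\<i> *\<^sub>C x) + \<i> *\<^sub>C y \<in> ?R" using step(2) by (intro span_add span_scale)
    then show ?case by (simp add: scaleR_L2_eq L2.scale_right_distrib mult.commute)
  qed
  have "L2.subspace ?R"
  proof (rule L2.subspaceI)
    fix z x assume x: "x \<in> ?R"
    have "z *\<^sub>C x = Re z *\<^sub>R x + Im z *\<^sub>R (\<i> *\<^sub>C x)"
      by (simp add: scaleR_L2_eq flip: L2.scale_left_distrib) (metis complex_eq mult.commute)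
    then show "z *\<^sub>C x \<in> ?R" using x iR[OF x] by (simp add: span_add span_scale)
  qed (auto intro: span_zero span_add)
  moreover have "B \<subseteq> ?R" by (auto intro: span_base)
  ultimately have "W \<subseteq> ?R" using B(1) L2.span_minimal by blast
  moreover have "?R \<subseteq> W"
  proof (rule span_minimal)
    show "B \<union> scaleC \<i> ` B \<subseteq> W" using B(1) by (auto intro: L2.span_base L2.span_scale)
    show "subspace W" using assms(1) by (auto simp: subspace_def L2.subspace_def scaleR_L2_eq)
  qed
  ultimately show ?thesis using closed_span_finite[of "B \<union> scaleC \<i> ` B"] B(2) by auto
qed

definition finite_rank :: "(L2 \<Rightarrow> L2) \<Rightarrow> bool" where
  "finite_rank F \<longleftrightarrow> bounded_clinear F \<and> finite_dim (range F)"

lemma subspace_range: "bounded_clinear A \<Longrightarrow> L2.subspace (range A)"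
  by (rule L2.subspaceI)
    (auto simp flip: bounded_clinear_add bounded_clinear_scaleC intro: rangeI bounded_clinear_zero[symmetric]
      intro!: image_eqI)

text \<open>With \<open>W\<close> the range of \<open>M\<close>, the operator \<open>1 + M\<close> preserves \<open>W\<close>, has its kernel in \<open>W\<close>, and
  \<open>y\<close> is in its range iff \<open>M y \<in> (1 + M) W\<close>; so everything reduces to rank-nullity on \<open>W\<close>.\<close>

lemma fredholm_one_plus_finite_rank:
  assumes M: "finite_rank M" and J: "bounded_clinear J" "inj J" "range J = D"
    and A: "\<And>f. A (J f) = f + M f"
  shows "fredholm D A" "fredholm_index D A = 0"
proof -
  have M': "bounded_clinear M" using M by (simp add: finite_rank_def)
  let ?T = "\<lambda>f. f + M f" and ?W = "range M"
  have T: "bounded_clinear ?T" by (rule bounded_clinear_plus[OF bounded_clinear_id M'])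
  have W: "L2.subspace ?W" "finite_dim ?W" using M subspace_range[OF M'] by (auto simp: finite_rank_def)
  have TW: "?T ` ?W \<subseteq> ?W" using W(1) by (auto simp: L2.subspace_def)
  obtain W' where W': "L2.subspace W'" "W' \<subseteq> ?W" "?T ` ?W \<inter> W' = {0}"
    "\<And>w. w \<in> ?W \<Longrightarrow> \<exists>x\<in>?W. \<exists>y\<in>W'. w = ?T x + y" "L2.dim W' = L2.dim {w \<in> ?W. ?T w = 0}"
    by (rule image_complement_dim[OF W bounded_clinear_linear[OF T] TW]) blast
  have K: "{w \<in> ?W. ?T w = 0} = {w. ?T w = 0}"
  proof -
    have "w \<in> ?W" if "?T w = 0" for w
    proof -
      have "M (- w) = - M w" using bounded_clinear_diff[OF M', of 0 w] bounded_clinear_zero[OF M'] by simp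
      then have "w = M (- w)" using that by (simp add: add_eq_0_iff2)
      then show ?thesis by (rule range_eqI)
    qed
    then show ?thesis by auto
  qed
  have R: "A ` D = range ?T" unfolding J(3)[symmetric] by (simp add: image_image A)
  have fW': "finite_dim W'" using W(2) W'(2) by (auto simp: finite_dim_def)
  have inW: "f \<in> ?W" if "?T f \<in> ?W" for f
    using L2.subspace_diff[OF W(1) that, of "M f"] by simp
  have comp: "complement (range ?T) W'"
    unfolding complement_def
  proof (intro conjI allI)
    have "u \<in> ?T ` ?W" if "u \<in> range ?T" "u \<in> W'" for u
    proof -
      from \<open>u \<in> range ?T\<close> obtain f where f: "u = ?T f" by (rule rangeE)
      have "u \<in> ?W" using \<open>u \<in> W'\<close> W'(2) by (rule subsetD[rotated])
      then have "f \<in> ?W" using f inW[of f] by simp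
      then show ?thesis using f by (rule image_eqI[rotated])
    qed
    moreover have "0 \<in> range ?T" by (rule range_eqI[of _ _ 0]) (simp add: bounded_clinear_zero[OF M'])
    ultimately show "range ?T \<inter> W' = {0}" using W'(1,3) L2.subspace_0 by blast
    fix u
    obtain x y where xy: "x \<in> ?W" "y \<in> W'" "- M u = ?T x + y"
    proof -
      have "- M u = M (- u)" using bounded_clinear_diff[OF M', of 0 u] bounded_clinear_zero[OF M'] by simp
      then have "- M u \<in> ?W" by (rule range_eqI)
      then show ?thesis using W'(4) that by blast
    qed
    \<comment> \<open>Every \<open>u\<close> agrees with \<open>(1 + M) u\<close> up to
      \<open>- M u\<close>, which lies in \<open>W\<close>, where \<open>W'\<close> already
      complements the image of \<open>W\<close>.\<close>
    have "u = ?T u + - M u" by simp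
    also have "\<dots> = ?T (u + x) + y" using xy(3) by (simp add: bounded_clinear_add[OF M'] algebra_simps)
    finally show "\<exists>v\<in>range ?T. \<exists>w\<in>W'. u = v + w" using xy(2) by (intro bexI[of _ y] bexI[of _ "?T (u + x)"]) simp_all
  qed (rule W'(1))
  have closed: "closed (range ?T)"
  proof -
    have "range ?T = M -` (?T ` ?W)"
    proof (intro set_eqI iffI)
      fix y assume "y \<in> range ?T"
      then obtain f where "y = ?T f" by (rule rangeE)
      then have "M y = ?T (M f)" by (simp add: bounded_clinear_add[OF M'])
      then show "y \<in> M -` (?T ` ?W)" by auto
    next
      fix y assume "y \<in> M -` (?T ` ?W)"
      then obtain w where "M y = ?T (M w)" by auto
      then have "?T (y - M w) = y" by (simp add: bounded_clinear_diff[OF M'] bounded_clinear_add[OF M'] algebra_simps)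
      then show "y \<in> range ?T" by (metis rangeI)
    qed
    moreover have "closed (?T ` ?W)"
    proof (rule closed_finite_dim)
      show "L2.subspace (?T ` ?W)"
        using W(1) bounded_clinear_linear[OF T] by (rule L2_pair.linear_subspace_image[rotated])
      show "finite_dim (?T ` ?W)" using TW W(2) by (auto simp: finite_dim_def)
    qed
    moreover have "continuous_on UNIV M"
      using bounded_clinear_bounded_linear[OF M'] by (rule linear_continuous_on)
    ultimately show ?thesis by (simp add: closed_vimage)
  qed
  \<comment> \<open>The injective linear \<open>J\<close> carries the kernel of \<open>1 + M\<close>
    onto that of \<open>A\<close>, so the dimension is preserved.\<close>
  have ker: "ker_on D A = J ` {w. ?T w = 0}"
    unfolding ker_on_def J(3)[symmetric] by (auto simp: A)
  have sK: "L2.subspace {w. ?T w = 0}"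
    by (auto simp: L2.subspace_def bounded_clinear_add[OF M'] bounded_clinear_scaleC[OF M'] add.assoc
      add_eq_0_iff bounded_clinear_zero[OF M'])
  have fK: "finite_dim {w. ?T w = 0}" using W(2) K by (auto simp: finite_dim_def)
  obtain B where B: "L2.independent B" "L2.span B = {w. ?T w = 0}" "finite B" "card B = L2.dim {w. ?T w = 0}"
    by (rule finite_dim_basis[OF sK fK, of "{}"]) (auto simp: L2.independent_empty)
  interpret J: Vector_Spaces.linear scaleC scaleC J by (rule bounded_clinear_linear[OF J(1)])
  have spJ: "ker_on D A = L2.span (J ` B)" unfolding ker J.span_image B(2) ..
  have "L2.independent (J ` B)" using B(1) inj_on_subset[OF J(2)] by (intro J.independent_injective_image) auto
  then have "L2.dim (ker_on D A) = card (J ` B)" unfolding spJ by (rule L2.dim_span_eq_card_independent)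
  also have "\<dots> = card B" using inj_on_subset[OF J(2)] by (intro card_image) auto
  finally have dk: "L2.dim (ker_on D A) = L2.dim W'" using B(4) W'(5) K by simp
  have "finite_dim (ker_on D A)" using spJ B(3) by (auto simp: finite_dim_def)
  moreover have "has_codim (range ?T) (L2.dim W')" using comp fW' by (auto simp: has_codim_def)
  ultimately show "fredholm D A" unfolding fredholm_def R using closed by blast
  show "fredholm_index D A = 0"
    unfolding fredholm_index_def R dk using codim_eq[OF subspace_range[OF T] comp fW'] by simp
qed

section \<open>Compact perturbations\<close>

text \<open>Norm limits of finite-rank operators. This form of compactness passes to sums and to
  compositions with bounded operators by plain estimates and leads directly to the splitting into a
  small and a finite-rank part.\<close>

definition approximable :: "(L2 \<Rightarrow> L2) \<Rightarrow> bool" where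
  "approximable K \<longleftrightarrow> bounded_clinear K \<and>
     (\<forall>e>0. \<exists>F. finite_rank F \<and> (\<forall>u. norm (K u - F u) \<le> e * norm u))"

lemma finite_dim_image:
  assumes "bounded_clinear A" "finite_dim S"
  shows "finite_dim (A ` S)"
proof -
  interpret A: Vector_Spaces.linear scaleC scaleC A by (rule bounded_clinear_linear[OF assms(1)])
  obtain B where B: "finite B" "S \<subseteq> L2.span B" using assms(2) by (auto simp: finite_dim_def)
  then have "A ` S \<subseteq> L2.span (A ` B)" unfolding A.span_image by blast
  then show ?thesis using B(1) by (auto simp: finite_dim_def)
qed

lemma finite_rank_compose:
  assumes "finite_rank F" "bounded_clinear A"
  shows "finite_rank (\<lambda>u. A (F u))" "finite_rank (\<lambda>u. F (A u))"
proof -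
  have F: "bounded_clinear F" "finite_dim (range F)" using assms(1) by (auto simp: finite_rank_def)
  have "range (\<lambda>u. A (F u)) = A ` range F" by auto
  then show "finite_rank (\<lambda>u. A (F u))"
    using finite_dim_image[OF assms(2) F(2)] bounded_clinear_compose[OF assms(2) F(1)] by (simp add: finite_rank_def)
  have "range (\<lambda>u. F (A u)) \<subseteq> range F" by auto
  then have "finite_dim (range (\<lambda>u. F (A u)))" using F(2) unfolding finite_dim_def by (meson order_trans)
  then show "finite_rank (\<lambda>u. F (A u))"
    using bounded_clinear_compose[OF F(1) assms(2)] by (simp add: finite_rank_def)
qed

lemma finite_rank_plus:
  assumes "finite_rank F" "finite_rank G"
  shows "finite_rank (\<lambda>u. F u + G u)"
proof -
  obtain B C where BC: "finite B" "range F \<subseteq> L2.span B" "finite C" "range G \<subseteq> L2.span C"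
    using assms by (auto simp: finite_rank_def finite_dim_def)
  have "F u + G u \<in> L2.span (B \<union> C)" for u
    using BC L2.span_mono[of B "B \<union> C"] L2.span_mono[of C "B \<union> C"] by (intro L2.span_add) auto
  then have "finite_dim (range (\<lambda>u. F u + G u))"
    unfolding finite_dim_def using BC by (intro exI[of _ "B \<union> C"]) auto
  then show ?thesis using assms by (simp add: finite_rank_def bounded_clinear_plus)
qed

lemma approximable_plus:
  assumes "approximable K" "approximable L"
  shows "approximable (\<lambda>u. K u + L u)"
  unfolding approximable_def
proof (intro conjI allI impI)
  fix e :: real assume "e > 0"
  then obtain F G where FG: "finite_rank F" "finite_rank G"
    "\<And>u. norm (K u - F u) \<le> e/2 * norm u" "\<And>u. norm (L u - G u) \<le> e/2 * norm u"
    using assms unfolding approximable_def by (meson half_gt_zero)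
  have "norm ((K u + L u) - (F u + G u)) \<le> e * norm u" for u
    using FG(3,4)[of u] norm_triangle_ineq[of "K u - F u" "L u - G u"] by (simp add: algebra_simps)
  then show "\<exists>F. finite_rank F \<and> (\<forall>u. norm (K u + L u - F u) \<le> e * norm u)"
    using finite_rank_plus[OF FG(1,2)] by blast
qed (use assms in \<open>auto simp: approximable_def bounded_clinear_plus\<close>)

lemma approximable_compose:
  assumes K: "approximable K" and A: "bounded_clinear A"
  shows "approximable (\<lambda>u. A (K u))" "approximable (\<lambda>u. K (A u))"
proof -
  have K': "bounded_clinear K" using K by (simp add: approximable_def)
  obtain C where C: "C > 0" "\<And>u. norm (A u) \<le> C * norm u" by (rule bounded_clinear_bound[OF A]) blast
  have ex: "\<exists>F. finite_rank F \<and> (\<forall>u. norm (K u - F u) \<le> e / C * norm u)" if "e > 0" for e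
    using K that C(1) unfolding approximable_def by (metis divide_pos_pos)
  show "approximable (\<lambda>u. A (K u))"
    unfolding approximable_def
  proof (intro conjI allI impI)
    fix e :: real assume "e > 0"
    then obtain F where F: "finite_rank F" "\<And>u. norm (K u - F u) \<le> e / C * norm u" using ex by blast
    have "norm (A (K u) - A (F u)) \<le> e * norm u" for u
      using C(2)[of "K u - F u"] mult_left_mono[OF F(2)[of u], of C] C(1)
      by (simp add: bounded_clinear_diff[OF A])
    then show "\<exists>F. finite_rank F \<and> (\<forall>u. norm (A (K u) - F u) \<le> e * norm u)"
      using finite_rank_compose(1)[OF F(1) A] by blast
  qed (rule bounded_clinear_compose[OF A K'])
  show "approximable (\<lambda>u. K (A u))"
    unfolding approximable_def
  proof (intro conjI allI impI)
    fix e :: real assume e: "e > 0"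
    then obtain F where F: "finite_rank F" "\<And>u. norm (K u - F u) \<le> e / C * norm u" using ex by blast
    have "norm (K (A u) - F (A u)) \<le> e * norm u" for u
      using F(2)[of "A u"] mult_left_mono[OF C(2)[of u], of "e / C"] C(1) e by simp
    then show "\<exists>F. finite_rank F \<and> (\<forall>u. norm (K (A u) - F u) \<le> e * norm u)"
      using finite_rank_compose(2)[OF F(1) A] by blast
  qed (rule bounded_clinear_compose[OF K' A])
qed

text \<open>Solving \<open>u + S u = g\<close> is a fixed-point problem for the contraction
  \<open>u \<mapsto> g - S u\<close>. Uniqueness of the fixed point gives linearity of the solution
  operator.\<close>

lemma one_plus_small_invertible:
  assumes S: "bounded_clinear S" "\<And>u. norm (S u) \<le> 1/2 * norm u"
  obtains Q where "bounded_clinear Q" "\<And>u. Q (u + S u) = u" "\<And>u. Q u + S (Q u) = u"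
proof -
  have ex: "\<exists>!u. g - S u = u" for g
  proof (rule banach_fix_type)
    show "\<forall>x y. dist (g - S x) (g - S y) \<le> 1/2 * dist x y"
    proof (intro allI)
      fix x y
      have "(g - S x) - (g - S y) = S (y - x)" by (simp add: bounded_clinear_diff[OF S(1)])
      then show "dist (g - S x) (g - S y) \<le> 1/2 * dist x y"
        using S(2)[of "y - x"] by (simp add: dist_norm norm_minus_commute)
    qed
  qed auto
  define Q where "Q g = (THE u. g - S u = u)" for g
  have Q: "g - S (Q g) = Q g" for g unfolding Q_def by (rule theI'[OF ex])
  have Qu: "Q g = u" if "g = u + S u" for g u
    using ex[of g] Q[of g] that by (metis add_diff_cancel_right')
  have Q2: "Q u + S (Q u) = u" for u using Q[of u] by (metis diff_add_cancel)
  have "bounded_clinear Q"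
  proof (rule bounded_clinearI[of _ 2])
    show "Q (u + v) = Q u + Q v" for u v
      using Q2[of u] Q2[of v] by (intro Qu) (simp add: bounded_clinear_add[OF S(1)] algebra_simps)
    show "Q (z *\<^sub>C u) = z *\<^sub>C Q u" for z u
      using Q2[of u] by (intro Qu) (simp add: bounded_clinear_scaleC[OF S(1)] flip: L2.scale_right_distrib)
    show "norm (Q u) \<le> 2 * norm u" for u
    proof -
      have "norm (Q u) \<le> norm u + norm (S (Q u))"
        using norm_triangle_ineq4[of u "S (Q u)"] unfolding Q[of u] .
      then show ?thesis using S(2)[of "Q u"] by linarith
    qed
  qed
  then show ?thesis using that Q2 Qu by blast
qed

text \<open>Write \<open>K = F + S\<close> with \<open>F\<close> of finite rank and \<open>S\<close>
  small, and let \<open>Q\<close> invert \<open>1 + S\<close>; then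
  \<open>1 + K = (1 + S) (1 + Q F)\<close>. Instead of removing the invertible left factor
  \<open>P (1 + S)\<close> from the range, its inverse is put into the parametrization of the
  domain. This conjugates everything into the identity plus a finite-rank operator, and the index of
  \<open>A\<close> is unaffected because the domain is the same.\<close>

lemma fredholm_invertible_times_one_plus_approximable:
  assumes K: "approximable K" and J: "bounded_clinear J" "inj J" "range J = D"
    and P: "bounded_clinear P" "bounded_clinear P'" "\<And>u. P (P' u) = u" "\<And>u. P' (P u) = u"
    and A: "\<And>f. A (J f) = P (f + K f)"
  shows "fredholm D A" "fredholm_index D A = 0"
proof -
  obtain F where F: "finite_rank F" "\<And>u. norm (K u - F u) \<le> 1/2 * norm u"
    using K unfolding approximable_def by (metis half_gt_zero zero_less_one)
  let ?S = "\<lambda>u. K u - F u"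
  have F': "bounded_clinear F" using F(1) by (simp add: finite_rank_def)
  have S: "bounded_clinear ?S" using K F' by (simp add: approximable_def bounded_clinear_minus)
  obtain Q where Q: "bounded_clinear Q" "\<And>u. Q (u + ?S u) = u" "\<And>u. Q u + ?S (Q u) = u"
    using one_plus_small_invertible[OF S F(2)] by blast
  let ?P = "\<lambda>u. P (u + ?S u)" and ?P' = "\<lambda>u. Q (P' u)"
  let ?M = "\<lambda>f. ?P (Q (F (?P' f)))"
  have P1: "bounded_clinear ?P" by (intro bounded_clinear_compose[OF P(1)] bounded_clinear_plus bounded_clinear_id S)
  have P1': "bounded_clinear ?P'" by (rule bounded_clinear_compose[OF Q(1) P(2)])
  have PP: "?P (?P' u) = u" "?P' (?P u) = u" for u by (simp_all only: Q P)
  have M: "finite_rank ?M"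
    by (intro finite_rank_compose(1)[OF _ P1] finite_rank_compose(1)[OF _ Q(1)] finite_rank_compose(2)[OF F(1) P1'])
  have J1: "bounded_clinear (\<lambda>f. J (?P' f))" by (rule bounded_clinear_compose[OF J(1) P1'])
  have inj: "inj (\<lambda>f. J (?P' f))"
    by (rule injI) (metis PP(1) J(2) injD)
  have range: "range (\<lambda>f. J (?P' f)) = D"
  proof -
    have "J u \<in> range (\<lambda>f. J (?P' f))" for u by (rule range_eqI[of _ _ "?P u"]) (simp only: PP)
    then show ?thesis using J(3) by blast
  qed
  have main: "A (J (?P' f)) = f + ?M f" for f
  proof -
    let ?g = "?P' f"
    have "?g + K ?g = (?g + Q (F ?g)) + ?S (?g + Q (F ?g))"
    proof -
      have "Q (F ?g) + ?S (Q (F ?g)) = F ?g" by (rule Q(3))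
      then show ?thesis by (simp add: bounded_clinear_add[OF S] algebra_simps)
    qed
    then have "A (J ?g) = ?P (?g + Q (F ?g))" unfolding A by (simp only:)
    also have "\<dots> = ?P ?g + ?P (Q (F ?g))" by (rule bounded_clinear_add[OF P1])
    finally show ?thesis by (simp only: PP)
  qed
  show "fredholm D A" "fredholm_index D A = 0"
    using fredholm_one_plus_finite_rank[OF M J1 inj range, of A] main by blast+
qed

section \<open>Compactness of a convolution followed by a multiplier vanishing at infinity\<close>

lemma bounded_clinear_rank_one: "bounded_clinear (\<lambda>u. cpair w u *\<^sub>C b)"
proof (rule bounded_clinearI[of _ "norm w * norm b"])
  show "norm (cpair w u *\<^sub>C b) \<le> norm w * norm b * norm u" for u
    using mult_right_mono[OF norm_cpair_le[of w u], of "norm b"] by (simp add: ac_simps)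
qed (simp_all add: cpair_simps L2.scale_left_distrib)

lemma finite_rank_sum:
  assumes "finite I"
  shows "finite_rank (\<lambda>u. \<Sum>i\<in>I. cpair (w i) u *\<^sub>C b i)"
  unfolding finite_rank_def
proof
  show "bounded_clinear (\<lambda>u. \<Sum>i\<in>I. cpair (w i) u *\<^sub>C b i)"
    using assms
  proof (induction I)
    case empty
    then show ?case by (auto intro: bounded_clinearI[of _ 0])
  next
    case (insert i I)
    then show ?case by (simp add: bounded_clinear_plus[OF bounded_clinear_rank_one])
  qed
  have "range (\<lambda>u. \<Sum>i\<in>I. cpair (w i) u *\<^sub>C b i) \<subseteq> L2.span (b ` I)"
    by (intro image_subsetI L2.span_sum L2.span_scale L2.span_base imageI)
  then show "finite_dim (range (\<lambda>u. \<Sum>i\<in>I. cpair (w i) u *\<^sub>C b i))"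
    using assms by (auto simp: finite_dim_def)
qed

lemma abs_L2_sum:
  assumes "finite I" "\<And>i. i \<in> I \<Longrightarrow> square_integrable (f i)"
  shows "square_integrable (\<lambda>x. \<Sum>i\<in>I. f i x) \<and> abs_L2 (\<lambda>x. \<Sum>i\<in>I. f i x) = (\<Sum>i\<in>I. abs_L2 (f i))"
  using assms
proof (induction I)
  case empty
  then show ?case by (simp add: abs_L2_zero square_integrable_zero)
next
  case (insert i I)
  then show ?case by (simp add: square_integrable_add abs_L2_add[symmetric])
qed

text \<open>Uniform norm continuity of the translated kernels: by Cauchy-Schwarz it bounds the
  oscillation of \<open>conv_op \<kappa> u\<close> on a small cell by a multiple of
  \<open>norm u\<close>, the same for all \<open>u\<close>.\<close>

definition kernel_equicontinuous :: "(real \<Rightarrow> complex) \<Rightarrow> bool" where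
  "kernel_equicontinuous \<kappa> \<longleftrightarrow>
     (\<forall>e>0. \<exists>d>0. \<forall>x y. \<bar>x - y\<bar> \<le> d \<longrightarrow> norm (kernel_at \<kappa> x - kernel_at \<kappa> y) \<le> e)"

text \<open>Cut \<open>m\<close> off to a bounded interval and replace the kernel by its values on a fine grid in \<open>x\<close>.\<close>

lemma approximable_mult_conv:
  assumes \<kappa>: "exp_decaying \<kappa>" "kernel_equicontinuous \<kappa>" and m: "multiplier m" "(m \<longlongrightarrow> 0) at_infinity"
  shows "approximable (\<lambda>u. mult_op m (conv_op \<kappa> u))"
  unfolding approximable_def
proof (intro conjI allI impI)
  show "bounded_clinear (\<lambda>u. mult_op m (conv_op \<kappa> u))"
    by (intro bounded_clinear_compose[OF bounded_clinear_mult_op] bounded_clinear_conv_op \<kappa> m)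
  fix e :: real assume e: "e > 0"
  obtain C where C: "C > 0" "\<And>u. norm (conv_op \<kappa> u) \<le> C * norm u"
    by (rule bounded_clinear_bound[OF bounded_clinear_conv_op[OF \<kappa>(1)]]) blast
  obtain Mm where Mm: "Mm > 0" "\<And>x. \<bar>m x\<bar> \<le> Mm" by (rule multiplierE[OF m(1)]) blast
  \<comment> \<open>Beyond \<open>R\<close> the multiplier is so small that this part of the
    operator contributes at most \<open>e/2\<close>.\<close>
  obtain R where R: "R > 0" "\<And>x. \<bar>x\<bar> > R \<Longrightarrow> \<bar>m x\<bar> \<le> e / (2 * C)"
  proof -
    have "e / (2 * C) > 0" using e C by simp
    from tendstoD[OF m(2) this] obtain b where b: "\<And>x. b \<le> \<bar>x\<bar> \<Longrightarrow> \<bar>m x\<bar> < e / (2 * C)"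
      by (auto simp: eventually_at_infinity)
    have "\<bar>m x\<bar> \<le> e / (2 * C)" if "\<bar>x\<bar> > max b 1" for x using b[of x] that by simp
    moreover have "max b 1 > 0" by linarith
    ultimately show ?thesis using that by blast
  qed
  \<comment> \<open>Chosen so that \<open>Mm * eps * sqrt (2 * R) = e / 2\<close>, the error of the
    grid on \<open>{-R..R}\<close>.\<close>
  define eps where "eps = e / (2 * Mm * sqrt (2 * R))"
  have eps: "eps > 0" using e Mm R by (simp add: eps_def)
  obtain h where h: "h > 0" "\<And>x y. \<bar>x - y\<bar> \<le> h \<Longrightarrow> norm (kernel_at \<kappa> x - kernel_at \<kappa> y) \<le> eps"
    using \<kappa>(2) eps unfolding kernel_equicontinuous_def by blast
  \<comment> \<open>The ceiling takes care of the negative end, where the floor of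
    \<open>- R / h\<close> is minus the ceiling of \<open>R / h\<close>.\<close>
  define N where "N = \<lceil>R / h\<rceil>"
  define m1 where "m1 x = m x * indicator {-R..R} x" for x
  define m2 where "m2 x = m x * indicator (- {-R..R}) x" for x
  have [measurable]: "m \<in> borel_measurable borel" using m(1) by auto
  have mm: "multiplier m1" "multiplier m2"
    unfolding m1_def m2_def
    by (intro multiplier_mult m(1) multiplier_indicator; simp)+
  define b where "b j = abs_L2 (\<lambda>x. complex_of_real (m1 x * indicator {x. \<lfloor>x / h\<rfloor> = j} x))" for j
  have [measurable]: "m1 \<in> borel_measurable borel" using mm by auto
  have bsq: "square_integrable (\<lambda>x. complex_of_real (m1 x * indicator {x. \<lfloor>x / h\<rfloor> = j} x))" for j
    by (rule square_integrable_compact_support[where M = Mm and a = "-R" and b = R])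
      (use Mm in \<open>auto simp: m1_def indicator_def less_imp_le\<close>)
  define F where "F u = (\<Sum>j\<in>{-N..N}. cpair (kernel_at \<kappa> (h * of_int j)) u *\<^sub>C b j)" for u
  have F: "finite_rank F" unfolding F_def by (rule finite_rank_sum) simp
  have grid: "\<lfloor>x / h\<rfloor> \<in> {-N..N}" if "x \<in> {-R..R}" for x
  proof -
    have "x / h \<le> R / h" "- (R / h) \<le> x / h" using that h(1) by (auto simp: field_simps)
    then have "\<lfloor>x / h\<rfloor> \<le> \<lfloor>R / h\<rfloor>" "\<lfloor>- (R / h)\<rfloor> \<le> \<lfloor>x / h\<rfloor>" by (auto intro: floor_mono)
    moreover have "\<lfloor>R / h\<rfloor> \<le> \<lceil>R / h\<rceil>" by (rule floor_le_ceiling)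
    moreover have "\<lfloor>- (R / h)\<rfloor> = - \<lceil>R / h\<rceil>" by (simp add: ceiling_def)
    ultimately show ?thesis unfolding N_def atLeastAtMost_iff by linarith
  qed
  have near: "\<bar>x - h * of_int \<lfloor>x / h\<rfloor>\<bar> \<le> h" for x
  proof -
    have "of_int \<lfloor>x / h\<rfloor> \<le> x / h" "x / h < of_int \<lfloor>x / h\<rfloor> + 1" by linarith+
    then have "h * of_int \<lfloor>x / h\<rfloor> \<le> h * (x / h)" "h * (x / h) < h * (of_int \<lfloor>x / h\<rfloor> + 1)"
      using h(1) by (intro mult_left_mono mult_strict_left_mono; simp)+
    moreover have "h * (x / h) = x" using h(1) by simp
    ultimately show ?thesis using h(1) by (simp add: algebra_simps)
  qed
  have "norm (mult_op m (conv_op \<kappa> u) - F u) \<le> e * norm u" for u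
  proof -
    let ?c = "\<lambda>x. cpair (kernel_at \<kappa> x) u"
    have sq: "square_integrable (\<lambda>x. complex_of_real (m1 x) * ?c x)"
      by (intro square_integrable_multiplier mm square_integrable_conv \<kappa>)
    \<comment> \<open>At each \<open>x\<close> in the interval exactly one cell is active, so the
      finite-rank operator samples the convolution at the grid point of that cell.\<close>
    have sum: "(\<Sum>j\<in>{-N..N}. ?c (h * of_int j) * complex_of_real (m1 x * indicator {x. \<lfloor>x / h\<rfloor> = j} x))
        = complex_of_real (m1 x) * ?c (h * of_int \<lfloor>x / h\<rfloor>)" for x
    proof (cases "x \<in> {-R..R}")
      case True
      have "(\<Sum>j\<in>{-N..N}. ?c (h * of_int j) * complex_of_real (m1 x * indicator {x. \<lfloor>x / h\<rfloor> = j} x))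
          = (\<Sum>j\<in>{-N..N}. if j = \<lfloor>x / h\<rfloor> then ?c (h * of_int \<lfloor>x / h\<rfloor>) * complex_of_real (m1 x) else 0)"
        by (intro sum.cong) (auto simp: indicator_def)
      then show ?thesis using grid[OF True] by (simp add: sum.delta mult.commute)
    qed (simp add: m1_def)
    have Feq: "F u = abs_L2 (\<lambda>x. complex_of_real (m1 x) * ?c (h * of_int \<lfloor>x / h\<rfloor>))"
      and Fsq: "square_integrable (\<lambda>x. complex_of_real (m1 x) * ?c (h * of_int \<lfloor>x / h\<rfloor>))"
      using abs_L2_sum[of "{-N..N}" "\<lambda>j x. ?c (h * of_int j) * complex_of_real (m1 x * indicator {x. \<lfloor>x / h\<rfloor> = j} x)"]
      unfolding F_def b_def sum by (simp_all only: abs_L2_scaleC[OF bsq] square_integrable_scale[OF bsq] finite_atLeastAtMost_int)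
    let ?d = "\<lambda>x. complex_of_real (m1 x) * ?c x - complex_of_real (m1 x) * ?c (h * of_int \<lfloor>x / h\<rfloor>)"
    have "norm (abs_L2 ?d) \<le> (Mm * (eps * norm u)) * sqrt (R - (-R))"
    proof (rule norm_compact_support_le)
      show "?d \<in> borel_measurable borel" using square_integrable_diff[OF sq Fsq] by auto
      show "cmod (?d x) \<le> Mm * (eps * norm u)" for x
      proof -
        have "?d x = complex_of_real (m1 x) * cpair (kernel_at \<kappa> x - kernel_at \<kappa> (h * of_int \<lfloor>x / h\<rfloor>)) u"
          by (simp add: cpair_simps right_diff_distrib)
        then have "cmod (?d x) = \<bar>m1 x\<bar> * cmod (cpair (kernel_at \<kappa> x - kernel_at \<kappa> (h * of_int \<lfloor>x / h\<rfloor>)) u)"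
          by (simp add: norm_mult)
        also have "\<dots> \<le> Mm * (eps * norm u)"
        proof (rule mult_mono)
          show "\<bar>m1 x\<bar> \<le> Mm" using Mm by (auto simp: m1_def indicator_def less_imp_le)
          show "cmod (cpair (kernel_at \<kappa> x - kernel_at \<kappa> (h * of_int \<lfloor>x / h\<rfloor>)) u) \<le> eps * norm u"
            by (rule order_trans[OF norm_cpair_le]) (intro mult_right_mono h(2) near, simp)
        qed (use Mm in auto)
        finally show ?thesis .
      qed
      show "?d x = 0" if "x \<notin> {-R..R}" for x using that by (simp add: m1_def)
    qed (use R in auto)
    then have 1: "norm (mult_op m1 (conv_op \<kappa> u) - F u) \<le> e / 2 * norm u"
      using R(1) Mm(1) e
      by (simp add: Feq conv_op_def mult_op_abs mm square_integrable_conv \<kappa> abs_L2_diff sq Fsq eps_def field_simps)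
    have "norm (mult_op m2 (conv_op \<kappa> u)) \<le> e / (2 * C) * norm (conv_op \<kappa> u)"
      using R(2) e C(1) by (intro norm_mult_op_le mm) (auto simp: m2_def indicator_def)
    also have "\<dots> \<le> e / (2 * C) * (C * norm u)"
      using e C by (intro mult_left_mono C(2)) auto
    finally have 2: "norm (mult_op m2 (conv_op \<kappa> u)) \<le> e / 2 * norm u" using C(1) by simp
    have "m = (\<lambda>x. m1 x + m2 x)" by (auto simp: m1_def m2_def indicator_def)
    then have "mult_op m (conv_op \<kappa> u) = mult_op m1 (conv_op \<kappa> u) + mult_op m2 (conv_op \<kappa> u)"
      using mult_op_add_left[OF mm] by simp
    then have "mult_op m (conv_op \<kappa> u) - F u = (mult_op m1 (conv_op \<kappa> u) - F u) + mult_op m2 (conv_op \<kappa> u)" by simp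
    then show ?thesis using norm_triangle_ineq[of "mult_op m1 (conv_op \<kappa> u) - F u" "mult_op m2 (conv_op \<kappa> u)"] 1 2
      by (simp add: algebra_simps)
  qed
  then show "\<exists>F. finite_rank F \<and> (\<forall>u. norm (mult_op m (conv_op \<kappa> u) - F u) \<le> e * norm u)"
    using F by blast
qed

text \<open>After factoring out \<open>exp (- |t|)\<close> what remains is \<open>exp y - 1\<close>
  with \<open>|y| \<le> |h|\<close>, estimated by the mean value inequality.\<close>

lemma exp_neg_abs_diff_le:
  fixes t h :: real
  shows "\<bar>exp (- \<bar>t + h\<bar>) - exp (- \<bar>t\<bar>)\<bar> \<le> \<bar>h\<bar> * exp \<bar>h\<bar> * exp (- \<bar>t\<bar>)"
proof -
  have e: "\<bar>exp y - 1\<bar> \<le> \<bar>h\<bar> * exp \<bar>h\<bar>" if "\<bar>y\<bar> \<le> \<bar>h\<bar>" for y :: real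
  proof -
    have "norm (exp y - exp 0) \<le> exp \<bar>h\<bar> * norm (y - 0)"
      using that by (intro field_differentiable_bound[where S = "{-\<bar>h\<bar>..\<bar>h\<bar>}" and f' = exp])
        (auto intro!: derivative_eq_intros)
    then have "\<bar>exp y - 1\<bar> \<le> exp \<bar>h\<bar> * \<bar>y\<bar>" by simp
    also have "\<dots> \<le> exp \<bar>h\<bar> * \<bar>h\<bar>" using that by simp
    finally show ?thesis by (simp add: mult.commute)
  qed
  have "exp (- \<bar>t + h\<bar>) - exp (- \<bar>t\<bar>) = (exp (\<bar>t\<bar> - \<bar>t + h\<bar>) - 1) * exp (- \<bar>t\<bar>)"
    by (simp add: left_diff_distrib flip: exp_add)
  then show ?thesis using e[of "\<bar>t\<bar> - \<bar>t + h\<bar>"] by (simp add: abs_mult mult_right_mono)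
qed

text \<open>The indicator in the hypothesis admits kernels that jump at 0, such as
  \<open>helmholtz_kernel' 1\<close>. Its \<open>L2\<close> norm is \<open>sqrt (2 |h|)\<close>,
  which still tends to 0, although the pointwise bound does not.\<close>

lemma kernel_equicontinuousI:
  assumes \<kappa>: "exp_decaying \<kappa>"
    and b: "\<And>t h. cmod (\<kappa> (t + h) - \<kappa> t) \<le> \<bar>h\<bar> * exp \<bar>h\<bar> * exp (- \<bar>t\<bar>) + indicator {-\<bar>h\<bar>..\<bar>h\<bar>} t"
  shows "kernel_equicontinuous \<kappa>"
proof -
  have ed: "exp_decaying (\<lambda>t. complex_of_real (exp (- \<bar>t\<bar>)))"
    by (rule exp_decayingI[where A = 1 and \<sigma> = 1]) auto
  define E where "E = sqrt (\<integral>t. (exp (- \<bar>t\<bar>))\<^sup>2 \<partial>lborel)"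
  have nE: "norm (abs_L2 (\<lambda>y. complex_of_real (exp (- \<bar>x - y\<bar>)))) = E"
    and sE: "square_integrable (\<lambda>y. complex_of_real (exp (- \<bar>x - y\<bar>)))" for x
  proof -
    show s: "square_integrable (\<lambda>y. complex_of_real (exp (- \<bar>x - y\<bar>)))"
      by (rule square_integrable_reflect_shift[OF square_integrable_exp_decaying[OF ed]])
    have "(norm (abs_L2 (\<lambda>y. complex_of_real (exp (- \<bar>x - y\<bar>)))))\<^sup>2 = (\<integral>y. (exp (- \<bar>x - y\<bar>))\<^sup>2 \<partial>lborel)"
      unfolding norm_abs_L2_square[OF s] by simp
    also have "\<dots> = (\<integral>t. (exp (- \<bar>t\<bar>))\<^sup>2 \<partial>lborel)"
      using lborel_integral_real_affine[of "-1" "\<lambda>t. (exp (- \<bar>t\<bar>))\<^sup>2" x] by simp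
    finally show "norm (abs_L2 (\<lambda>y. complex_of_real (exp (- \<bar>x - y\<bar>)))) = E"
      unfolding E_def by (metis norm_ge_zero real_sqrt_abs abs_of_nonneg)
  qed
  have est: "norm (kernel_at \<kappa> x - kernel_at \<kappa> y) \<le> \<bar>x - y\<bar> * exp \<bar>x - y\<bar> * E + sqrt (2 * \<bar>x - y\<bar>)" for x y
  proof -
    let ?h = "\<bar>x - y\<bar>"
    let ?g = "\<lambda>z. complex_of_real (?h * exp ?h) * complex_of_real (exp (- \<bar>y - z\<bar>)) + indicator {y - ?h..y + ?h} z"
    have sg: "square_integrable (\<lambda>z. complex_of_real (?h * exp ?h) * complex_of_real (exp (- \<bar>y - z\<bar>)))"
      by (rule square_integrable_scale[OF sE])
    have si: "square_integrable (indicator {y - ?h..y + ?h})" by (rule norm_indicator_L2) simp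
    have sk: "square_integrable (\<lambda>z. \<kappa> (x - z))" for x
      by (rule square_integrable_reflect_shift[OF square_integrable_exp_decaying[OF \<kappa>]])
    have "norm (kernel_at \<kappa> x - kernel_at \<kappa> y) = norm (abs_L2 (\<lambda>z. \<kappa> (x - z) - \<kappa> (y - z)))"
      by (simp add: kernel_at_def abs_L2_diff sk)
    also have "\<dots> \<le> 1 * norm (abs_L2 ?g)"
    proof (rule norm_abs_L2_le[OF square_integrable_diff[OF sk sk] square_integrable_add[OF sg si]])
      have "cmod (\<kappa> (x - z) - \<kappa> (y - z)) \<le> 1 * cmod (?g z)" for z
      proof -
        have "?g z = complex_of_real (?h * exp ?h * exp (- \<bar>y - z\<bar>) + indicator {-?h..?h} (y - z))"
          by (auto simp: indicator_def)
        then have "cmod (?g z) = ?h * exp ?h * exp (- \<bar>y - z\<bar>) + indicator {-?h..?h} (y - z)"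
          by (simp only: norm_of_real) simp
        then show ?thesis using b[of "y - z" "x - y"] by simp
      qed
      then show "AE z in lborel. cmod (\<kappa> (x - z) - \<kappa> (y - z)) \<le> 1 * cmod (?g z)" by (intro AE_I2)
    qed simp
    also have "abs_L2 ?g = abs_L2 (\<lambda>z. complex_of_real (?h * exp ?h) * complex_of_real (exp (- \<bar>y - z\<bar>))) + abs_L2 (indicator {y - ?h..y + ?h})"
      by (rule abs_L2_add[symmetric, OF sg si])
    also have "1 * norm \<dots> \<le> norm (abs_L2 (\<lambda>z. complex_of_real (?h * exp ?h) * complex_of_real (exp (- \<bar>y - z\<bar>)))) + norm (abs_L2 (indicator {y - ?h..y + ?h}))"
      by (simp only: mult_1) (rule norm_triangle_ineq)
    also have "\<dots> = ?h * exp ?h * E + sqrt (2 * ?h)"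
      unfolding abs_L2_scaleC[OF sE, symmetric] norm_scaleC nE norm_of_real using norm_indicator_L2(2)[of "y - ?h" "y + ?h"]
      by (simp add: abs_mult)
    finally show ?thesis .
  qed
  have lim: "((\<lambda>h. h * exp h * E + sqrt (2 * h)) \<longlongrightarrow> 0 * exp 0 * E + sqrt (2 * 0)) (at_right (0::real))"
    by (intro tendsto_intros)
  show ?thesis
    unfolding kernel_equicontinuous_def
  proof (intro allI impI)
    fix e :: real assume "e > 0"
    then have "eventually (\<lambda>h. h * exp h * E + sqrt (2 * h) < e) (at_right 0)"
      using lim by (intro order_tendstoD) auto
    then obtain d where d: "d > 0" "\<And>h. 0 < h \<Longrightarrow> h < d \<Longrightarrow> h * exp h * E + sqrt (2 * h) < e"
      unfolding eventually_at_right_field by auto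
    have "norm (kernel_at \<kappa> x - kernel_at \<kappa> y) \<le> e" if "\<bar>x - y\<bar> \<le> d / 2" for x y
    proof (cases "x = y")
      case False
      then have "\<bar>x - y\<bar> > 0" "\<bar>x - y\<bar> < d" using that d(1) by auto
      then show ?thesis using est[of x y] d(2)[of "\<bar>x - y\<bar>"] by linarith
    qed (use \<open>e > 0\<close> in simp)
    then show "\<exists>d>0. \<forall>x y. \<bar>x - y\<bar> \<le> d \<longrightarrow> norm (kernel_at \<kappa> x - kernel_at \<kappa> y) \<le> e"
      using d(1) by (intro exI[of _ "d / 2"]) auto
  qed
qed

lemma kernel_equicontinuous_helmholtz:
  "kernel_equicontinuous (helmholtz_kernel 1)" "kernel_equicontinuous (helmholtz_kernel' 1)"
proof -
  have k: "helmholtz_kernel 1 t = complex_of_real (exp (- \<bar>t\<bar>) / 2)"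
    "helmholtz_kernel' 1 t = complex_of_real (- sgn t * exp (- \<bar>t\<bar>) / 2)" for t
    by (simp_all add: helmholtz_kernel_def helmholtz_kernel'_def exp_of_real[symmetric])
  show "kernel_equicontinuous (helmholtz_kernel 1)"
  proof (rule kernel_equicontinuousI)
    fix t h :: real
    have "cmod (helmholtz_kernel 1 (t + h) - helmholtz_kernel 1 t) = \<bar>exp (- \<bar>t + h\<bar>) - exp (- \<bar>t\<bar>)\<bar> / 2"
      unfolding k of_real_diff[symmetric] norm_of_real by (simp flip: diff_divide_distrib)
    also have "\<dots> \<le> \<bar>exp (- \<bar>t + h\<bar>) - exp (- \<bar>t\<bar>)\<bar>" by simp
    also note exp_neg_abs_diff_le[of t h]
    finally show "cmod (helmholtz_kernel 1 (t + h) - helmholtz_kernel 1 t)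
        \<le> \<bar>h\<bar> * exp \<bar>h\<bar> * exp (- \<bar>t\<bar>) + indicator {-\<bar>h\<bar>..\<bar>h\<bar>} t"
      by (rule order_trans) (simp add: indicator_def)
  qed (simp add: exp_decaying_helmholtz_kernel)
  show "kernel_equicontinuous (helmholtz_kernel' 1)"
  proof (rule kernel_equicontinuousI)
    fix t h :: real
    have eq: "cmod (helmholtz_kernel' 1 (t + h) - helmholtz_kernel' 1 t) = \<bar>sgn (t + h) * exp (- \<bar>t + h\<bar>) - sgn t * exp (- \<bar>t\<bar>)\<bar> / 2"
      unfolding k of_real_diff[symmetric] norm_of_real by (simp add: field_simps)
    have pos: "\<bar>h\<bar> * exp \<bar>h\<bar> * exp (- \<bar>t\<bar>) \<ge> 0" by simp
    show "cmod (helmholtz_kernel' 1 (t + h) - helmholtz_kernel' 1 t)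
        \<le> \<bar>h\<bar> * exp \<bar>h\<bar> * exp (- \<bar>t\<bar>) + indicator {-\<bar>h\<bar>..\<bar>h\<bar>} t"
    \<comment> \<open>Only for \<open>|t| \<le> |h|\<close> can the sign change between
      \<open>t\<close> and \<open>t + h\<close>; there the crude bound 1 is covered by the
      indicator.\<close>
    proof (cases "\<bar>t\<bar> \<le> \<bar>h\<bar>")
      case True
      have s: "\<bar>sgn r * exp (- \<bar>r\<bar>)\<bar> \<le> 1" for r :: real by (auto simp: abs_mult sgn_if)
      have "cmod (helmholtz_kernel' 1 (t + h) - helmholtz_kernel' 1 t) \<le> 1"
        unfolding eq using s[of "t + h"] s[of t]
          abs_triangle_ineq4[of "sgn (t + h) * exp (- \<bar>t + h\<bar>)" "sgn t * exp (- \<bar>t\<bar>)"] by simp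
      moreover have "indicator {-\<bar>h\<bar>..\<bar>h\<bar>} t = (1::real)" using True by (simp add: indicator_def abs_le_iff)
      ultimately show ?thesis using pos by linarith
    next
      case False
      then have "sgn (t + h) = sgn t" "\<bar>sgn t\<bar> = 1" by (auto simp: sgn_if)
      then have "cmod (helmholtz_kernel' 1 (t + h) - helmholtz_kernel' 1 t) = \<bar>exp (- \<bar>t + h\<bar>) - exp (- \<bar>t\<bar>)\<bar> / 2"
        unfolding eq by (simp add: abs_mult flip: right_diff_distrib)
      also have "\<dots> \<le> \<bar>exp (- \<bar>t + h\<bar>) - exp (- \<bar>t\<bar>)\<bar>" by simp
    also note exp_neg_abs_diff_le[of t h]
      finally show ?thesis by (rule order_trans) (simp add: indicator_def)
    qed
  qed (simp add: exp_decaying_helmholtz_kernel')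
qed

section \<open>The linearized operator\<close>

lemma multiplier_if_tendsto:
  assumes "continuous_on UNIV m" "(m \<longlongrightarrow> l) at_infinity"
  shows "multiplier m"
proof -
  obtain b where b: "\<And>x. b \<le> \<bar>x\<bar> \<Longrightarrow> \<bar>m x - l\<bar> < 1"
    using tendstoD[OF assms(2), of 1] by (auto simp: eventually_at_infinity dist_real_def)
  have "compact (m ` {-b..b})" by (intro compact_continuous_image continuous_on_subset[OF assms(1)]) auto
  then obtain B where B: "\<And>x. x \<in> {-b..b} \<Longrightarrow> \<bar>m x\<bar> \<le> B"
    using compact_imp_bounded[THEN bounded_iff[THEN iffD1]] by (metis image_eqI real_norm_def)
  have "\<bar>m x\<bar> \<le> max B (\<bar>l\<bar> + 1)" for x
  proof (cases "b \<le> \<bar>x\<bar>")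
    case True
    then show ?thesis using b[of x] by linarith
  next
    case False
    then have "x \<in> {-b..b}" by auto
    from B[OF this] show ?thesis by linarith
  qed
  moreover have "m \<in> borel_measurable borel" using assms(1) by (rule borel_measurable_continuous_onI)
  ultimately show ?thesis by (auto simp: multiplier_def)
qed

lemma mult_op_scale: "multiplier m \<Longrightarrow> mult_op (\<lambda>x. r * m x) u = complex_of_real r *\<^sub>C mult_op m u"
  using mult_op_mult_op[OF multiplier_const, of m r u] by (simp add: mult_op_const)

lemma mult_op_diff_left:
  assumes "multiplier m" "multiplier n"
  shows "mult_op (\<lambda>x. m x - n x) u = mult_op m u - mult_op n u"
  using mult_op_add_left[OF multiplier_diff[OF assms] assms(2), of u] by (simp add: algebra_simps)

lemma inj_helmholtz: "inj (helmholtz 1)"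
  by (rule inj_on_inverseI[where g = one_minus_Dxx]) (rule one_minus_Dxx_helmholtz)

lemma range_helmholtz: "range (helmholtz 1) = H2"
proof
  show "H2 \<subseteq> range (helmholtz 1)"
    using helmholtz_one_minus_Dxx by (metis rangeI subsetI)
qed (auto intro: helmholtz_in_H2)

lemma bounded_clinear_helmholtz: "Re s > 0 \<Longrightarrow> bounded_clinear (helmholtz s)"
  by (intro bounded_clinear_conv_op exp_decaying_helmholtz_kernel)

text \<open>The principal root \<open>s\<close> of \<open>1 - r\<close> has
  \<open>Re s \<ge> 0\<close>, with equality only if \<open>1 - r\<close> is real and nonpositive,
  which the hypothesis excludes.\<close>

lemma one_minus_helmholtz_invertible:
  assumes "\<And>x. r = complex_of_real x \<Longrightarrow> x < 1"
  obtains Q where "bounded_clinear Q" "\<And>f. Q (f - r *\<^sub>C helmholtz 1 f) = f"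
    "\<And>f. Q f - r *\<^sub>C helmholtz 1 (Q f) = f"
proof -
  define s where "s = csqrt (1 - r)"
  have r: "r = 1 - s\<^sup>2" by (simp add: s_def)
  have "Re s \<noteq> 0"
  proof
    assume "Re s = 0"
    then have "s\<^sup>2 = complex_of_real (- (Im s)\<^sup>2)" by (simp add: complex_eq_iff power2_eq_square)
    then have "r = complex_of_real (1 + (Im s)\<^sup>2)" unfolding r by simp
    then have "1 + (Im s)\<^sup>2 < 1" by (rule assms)
    then show False by simp
  qed
  then have s: "Re s > 0" using csqrt_principal[of "1 - r"] by (auto simp: s_def)
  let ?Q = "\<lambda>f. f + r *\<^sub>C helmholtz s f"
  have "bounded_clinear ?Q"
    by (intro bounded_clinear_plus bounded_clinear_id bounded_clinear_scale bounded_clinear_helmholtz s)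
  then show ?thesis using that one_minus_helmholtz_inverse[OF s r] by blast
qed

text \<open>The hypothesis concerns the reversed polynomial, because
  \<open>1 + \<beta> t + \<gamma> t^2 = (1 - r1 t) (1 - r2 t)\<close> exactly when
  \<open>r1\<close>, \<open>r2\<close> are the roots of \<open>x^2 + \<beta> x + \<gamma>\<close>.
  Real roots below 1 are harmless.\<close>

lemma helmholtz_quadratic_invertible:
  assumes "\<And>x::real. x \<ge> 1 \<Longrightarrow> (complex_of_real x)\<^sup>2 + \<beta> * complex_of_real x + \<gamma> \<noteq> 0"
  obtains Q where "bounded_clinear Q"
    "\<And>f. Q (f + \<beta> *\<^sub>C helmholtz 1 f + \<gamma> *\<^sub>C helmholtz 1 (helmholtz 1 f)) = f"
    "\<And>f. Q f + \<beta> *\<^sub>C helmholtz 1 (Q f) + \<gamma> *\<^sub>C helmholtz 1 (helmholtz 1 (Q f)) = f"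
proof -
  define d where "d = csqrt (\<beta>\<^sup>2 - 4 * \<gamma>)"
  define r1 where "r1 = (- \<beta> + d) / 2"
  define r2 where "r2 = (- \<beta> - d) / 2"
  have d2: "d\<^sup>2 = \<beta>\<^sup>2 - 4 * \<gamma>" by (simp add: d_def)
  have sum: "r1 + r2 = - \<beta>" by (simp add: r1_def r2_def field_simps)
  have "4 * (r1 * r2) = \<beta>\<^sup>2 - d\<^sup>2" by (simp add: r1_def r2_def field_simps power2_eq_square)
  then have prod: "r1 * r2 = \<gamma>" by (simp add: d2)
  have b: "\<beta> = - (r1 + r2)" using sum by simp
  have root1: "r1\<^sup>2 + \<beta> * r1 + \<gamma> = 0" and root2: "r2\<^sup>2 + \<beta> * r2 + \<gamma> = 0"
    unfolding b prod[symmetric] by (simp_all add: algebra_simps power2_eq_square)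
  have less1: "x < 1" if "r = complex_of_real x" "r\<^sup>2 + \<beta> * r + \<gamma> = 0" for r x
  proof (rule ccontr)
    assume "\<not> x < 1"
    then have "x \<ge> 1" by simp
    from assms[OF this] that show False by simp
  qed
  obtain Q1 where Q1: "bounded_clinear Q1" "\<And>f. Q1 (f - r1 *\<^sub>C helmholtz 1 f) = f" "\<And>f. Q1 f - r1 *\<^sub>C helmholtz 1 (Q1 f) = f"
    using one_minus_helmholtz_invertible[OF less1[OF _ root1]] by blast
  obtain Q2 where Q2: "bounded_clinear Q2" "\<And>f. Q2 (f - r2 *\<^sub>C helmholtz 1 f) = f" "\<And>f. Q2 f - r2 *\<^sub>C helmholtz 1 (Q2 f) = f"
    using one_minus_helmholtz_invertible[OF less1[OF _ root2]] by blast
  have G: "bounded_clinear (helmholtz 1)" by (simp add: bounded_clinear_helmholtz)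
  have factor: "f + \<beta> *\<^sub>C helmholtz 1 f + \<gamma> *\<^sub>C helmholtz 1 (helmholtz 1 f)
      = (f - r2 *\<^sub>C helmholtz 1 f) - r1 *\<^sub>C helmholtz 1 (f - r2 *\<^sub>C helmholtz 1 f)" for f
    unfolding b prod[symmetric]
    by (simp add: bounded_clinear_diff[OF G] bounded_clinear_scaleC[OF G] L2.scale_right_diff_distrib
        L2.scale_left_distrib L2.scale_left_diff_distrib algebra_simps)
  show ?thesis
  proof (rule that[of "\<lambda>f. Q2 (Q1 f)"])
    show "bounded_clinear (\<lambda>f. Q2 (Q1 f))" by (rule bounded_clinear_compose[OF Q2(1) Q1(1)])
  qed (simp_all only: factor Q1 Q2)
qed

section \<open>Coefficients of the linearized operator and their limits at infinity\<close>

locale solitary_wave =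
  fixes c k :: real and \<phi> :: "real \<Rightarrow> real"
  assumes c_pos: "c > 0" and k_pos: "0 < k" and k_less: "k < sqrt c / 2"
    and profile: "solitary_profile c k \<phi>"
begin

lemma four_k2_less: "4 * k\<^sup>2 < c"
proof -
  have "(2 * k)\<^sup>2 < (sqrt c)\<^sup>2" using k_less k_pos by (intro power_strict_mono) auto
  then show ?thesis using c_pos by (simp add: power_mult_distrib)
qed

lemma k2_less: "k\<^sup>2 < c"
  using four_k2_less by (smt (verit) zero_le_power2)

lemma par_a_pos: "par_a c k > 0"
  using k_pos k2_less by (simp add: par_a_def)

lemma smooth_phi: "smooth \<phi>"
  using profile by (simp add: solitary_profile_def)

abbreviation "\<mu> \<equiv> momentum \<phi>"

lemma phi2_less: "(\<phi> x)\<^sup>2 < c"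
  using profile by (simp add: solitary_profile_def)

lemma mu_eq: "\<mu> x = par_a c k * (c - (\<phi> x)\<^sup>2) powr (-3/2)"
  using profile by (simp add: solitary_profile_def momentum_def)

lemma mu_pos: "\<mu> x > 0"
  using phi2_less[of x] par_a_pos by (simp add: mu_eq)

lemma smooth_mu: "smooth \<mu>"
proof -
  have "\<mu> = (\<lambda>x. \<phi> x - deriv (deriv \<phi>) x)" by (auto simp: momentum_def)
  then show ?thesis by (simp add: smooth_diff smooth_deriv smooth_phi)
qed

lemma phi_tendsto: "(\<phi> \<longlongrightarrow> k) at_infinity"
proof -
  obtain C d where d: "d > 0" "\<And>x. \<bar>\<phi> x - k\<bar> \<le> C * exp (- d * \<bar>x\<bar>)"
    using profile by (auto simp: solitary_profile_def)
  have "filterlim (\<lambda>x::real. d * norm x) at_top at_infinity"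
    using filterlim_tendsto_pos_mult_at_top[OF tendsto_const d(1) filterlim_norm_at_top] .
  then have "filterlim (\<lambda>x::real. - (d * norm x)) at_bot at_infinity" by (simp add: filterlim_uminus_at_top)
  then have "((\<lambda>x::real. exp (- (d * norm x))) \<longlongrightarrow> 0) at_infinity" by (rule filterlim_compose[OF exp_at_bot])
  then have "((\<lambda>x. C * exp (- d * \<bar>x\<bar>)) \<longlongrightarrow> C * 0) at_infinity" by (intro tendsto_mult tendsto_const) simp
  then have lim: "((\<lambda>x. C * exp (- d * \<bar>x\<bar>)) \<longlongrightarrow> 0) at_infinity" by simp
  have "((\<lambda>x. \<phi> x - k) \<longlongrightarrow> 0) at_infinity"
  proof (rule Lim_null_comparison[OF always_eventually lim], rule allI)
    show "norm (\<phi> x - k) \<le> C * exp (- d * \<bar>x\<bar>)" for x using d(2)[of x] by (simp only: real_norm_def)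
  qed
  then show ?thesis by (simp add: LIM_zero_iff)
qed

lemma phi_deriv_tendsto: "n \<ge> 1 \<Longrightarrow> ((deriv ^^ n) \<phi> \<longlongrightarrow> 0) at_infinity"
  unfolding at_infinity_eq_at_top_bot using profile
  by (intro filterlim_sup) (auto simp: solitary_profile_def)

lemma mu_tendsto: "(\<mu> \<longlongrightarrow> k) at_infinity"
proof -
  have "((\<lambda>x. \<phi> x - (deriv ^^ 2) \<phi> x) \<longlongrightarrow> k - 0) at_infinity"
    by (intro tendsto_diff phi_tendsto phi_deriv_tendsto) simp
  then show ?thesis by (simp add: momentum_def[abs_def] numeral_2_eq_2)
qed

lemma deriv_mu: "deriv \<mu> x = deriv \<phi> x - (deriv ^^ 3) \<phi> x"
  and deriv2_mu: "deriv (deriv \<mu>) x = (deriv ^^ 2) \<phi> x - (deriv ^^ 4) \<phi> x"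
proof -
  have 1: "deriv \<mu> = (\<lambda>x. deriv \<phi> x - deriv (deriv (deriv \<phi>)) x)"
    unfolding momentum_def[abs_def]
    by (intro deriv_eqI DERIV_diff smooth_has_deriv smooth_deriv smooth_phi)
  then show "deriv \<mu> x = deriv \<phi> x - (deriv ^^ 3) \<phi> x" by (simp add: numeral_3_eq_3)
  have "deriv (deriv \<mu>) = (\<lambda>x. deriv (deriv \<phi>) x - deriv (deriv (deriv (deriv \<phi>))) x)"
    unfolding 1 by (intro deriv_eqI DERIV_diff smooth_has_deriv smooth_deriv smooth_phi)
  then show "deriv (deriv \<mu>) x = (deriv ^^ 2) \<phi> x - (deriv ^^ 4) \<phi> x"
    by (simp add: eval_nat_numeral)
qed

lemma deriv_mu_tendsto: "(deriv \<mu> \<longlongrightarrow> 0) at_infinity" "(deriv (deriv \<mu>) \<longlongrightarrow> 0) at_infinity"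
proof -
  have "((\<lambda>x. (deriv ^^ 1) \<phi> x - (deriv ^^ 3) \<phi> x) \<longlongrightarrow> 0 - 0) at_infinity"
    by (intro tendsto_diff phi_deriv_tendsto) auto
  then show "(deriv \<mu> \<longlongrightarrow> 0) at_infinity" by (simp add: deriv_mu[abs_def])
  have "((\<lambda>x. (deriv ^^ 2) \<phi> x - (deriv ^^ 4) \<phi> x) \<longlongrightarrow> 0 - 0) at_infinity"
    by (intro tendsto_diff phi_deriv_tendsto) auto
  then show "(deriv (deriv \<mu>) \<longlongrightarrow> 0) at_infinity" by (simp add: deriv2_mu[abs_def])
qed

lemma mu_powr: "continuous_on UNIV (\<lambda>x. \<mu> x powr r)" "((\<lambda>x. \<mu> x powr r) \<longlongrightarrow> k powr r) at_infinity"
    "multiplier (\<lambda>x. \<mu> x powr r)"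
proof -
  show 1: "continuous_on UNIV (\<lambda>x. \<mu> x powr r)"
    using mu_pos by (intro continuous_intros smooth_continuous smooth_mu) (auto simp: less_imp_neq[symmetric])
  show 2: "((\<lambda>x. \<mu> x powr r) \<longlongrightarrow> k powr r) at_infinity"
    using k_pos by (intro tendsto_intros mu_tendsto) auto
  show "multiplier (\<lambda>x. \<mu> x powr r)" by (rule multiplier_if_tendsto[OF 1 2])
qed

text \<open>With \<open>p\<close> and \<open>q\<close> the operator reads
  \<open>- 2 (p u')' + q u + 2 omega0 G u\<close>, where \<open>G\<close> is the convolution
  term.\<close>

definition p :: "real \<Rightarrow> real" where "p x = \<mu> x powr (-8/3)"

definition q :: "real \<Rightarrow> real" where
  "q x = 2/3 * (8 * deriv (deriv \<mu>) x * \<mu> x powr (-11/3) - 44/3 * (deriv \<mu> x)\<^sup>2 * \<mu> x powr (-14/3)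
          + 15 * \<mu> x powr (-8/3)) - 2 * omega1 c k / 9 * \<mu> x powr (-4/3)"

definition p_inf :: real where "p_inf = k powr (-8/3)"

definition q_inf :: real where "q_inf = 10 * k powr (-8/3) - 2 * omega1 c k / 9 * k powr (-4/3)"

lemma p_pos: "p x > 0" and p_inf_pos: "p_inf > 0"
  using mu_pos[of x] k_pos by (auto simp: p_def p_inf_def)

text \<open>The exponents \<open>-3/2\<close> in the profile equation and \<open>-8/3\<close>
  multiply to 4, so this power of \<open>\<mu>\<close> is a polynomial in \<open>\<phi>\<close>.
  Smoothness and the derivative of \<open>p\<close> are obtained from this form, without
  differentiating real powers.\<close>

lemma p_poly: "p x = par_a c k powr (-8/3) * (c - (\<phi> x)\<^sup>2) ^ 4"
proof -
  have "c - (\<phi> x)\<^sup>2 > 0" using phi2_less[of x] by simp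
  then show ?thesis
    using par_a_pos by (simp add: p_def mu_eq powr_mult powr_powr)
qed

lemma smooth_p: "smooth p"
proof -
  have "p = (\<lambda>x. par_a c k powr (-8/3) * ((c - \<phi> x * \<phi> x) * (c - \<phi> x * \<phi> x) * ((c - \<phi> x * \<phi> x) * (c - \<phi> x * \<phi> x))))"
    by (auto simp: p_poly power2_eq_square power4_eq_xxxx)
  then show ?thesis by (auto intro!: smooth_cmult smooth_mult smooth_diff smooth_const smooth_phi)
qed

lemma p_multiplier: "multiplier p" "multiplier (deriv p)" and p_tendsto: "(p \<longlongrightarrow> p_inf) at_infinity"
  and deriv_p_tendsto: "(deriv p \<longlongrightarrow> 0) at_infinity"
proof -
  show "multiplier p" "(p \<longlongrightarrow> p_inf) at_infinity"
    using mu_powr(2,3)[of "-8/3"] by (simp_all add: p_def[abs_def] p_inf_def)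
  have "deriv p = (\<lambda>x. par_a c k powr (-8/3) * (4 * (c - (\<phi> x)\<^sup>2) ^ 3 * (- (2 * \<phi> x * deriv \<phi> x))))"
  proof (rule deriv_eqI)
    fix x
    note [derivative_intros] = smooth_has_deriv[OF smooth_phi]
    show "(p has_real_derivative par_a c k powr (-8/3) * (4 * (c - (\<phi> x)\<^sup>2) ^ 3 * (- (2 * \<phi> x * deriv \<phi> x)))) (at x)"
      unfolding p_poly[abs_def] by (auto intro!: derivative_eq_intros)
  qed
  moreover have "((\<lambda>x. par_a c k powr (-8/3) * (4 * (c - (\<phi> x)\<^sup>2) ^ 3 * (- (2 * \<phi> x * (deriv ^^ 1) \<phi> x)))) \<longlongrightarrow>
      par_a c k powr (-8/3) * (4 * (c - k\<^sup>2) ^ 3 * (- (2 * k * 0)))) at_infinity"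
    by (intro tendsto_intros phi_tendsto phi_deriv_tendsto) simp
  ultimately show 1: "(deriv p \<longlongrightarrow> 0) at_infinity" by simp
  show "multiplier (deriv p)"
    by (rule multiplier_if_tendsto[OF smooth_continuous[OF smooth_deriv[OF smooth_p]] 1])
qed

lemma q_tendsto: "(q \<longlongrightarrow> q_inf) at_infinity" and q_multiplier: "multiplier q"
  and potential_multiplier: "multiplier (\<lambda>x. 8 * deriv (deriv \<mu>) x * \<mu> x powr (-11/3)
      - 44/3 * (deriv \<mu> x)\<^sup>2 * \<mu> x powr (-14/3) + 15 * \<mu> x powr (-8/3))" (is "multiplier ?V")
proof -
  have V: "(?V \<longlongrightarrow> 8 * 0 * k powr (-11/3) - 44/3 * 0\<^sup>2 * k powr (-14/3) + 15 * k powr (-8/3)) at_infinity"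
    by (intro tendsto_intros mu_powr deriv_mu_tendsto)
  have "continuous_on UNIV ?V"
    by (intro continuous_on_add continuous_on_diff continuous_on_mult continuous_on_const continuous_on_power
        mu_powr(1) smooth_continuous[OF smooth_deriv[OF smooth_mu]]
        smooth_continuous[OF smooth_deriv[OF smooth_deriv[OF smooth_mu]]])
  from multiplier_if_tendsto[OF this V] show VM: "multiplier ?V" .
  have "((\<lambda>x. 2/3 * ?V x - 2 * omega1 c k / 9 * \<mu> x powr (-4/3)) \<longlongrightarrow>
     2/3 * (8 * 0 * k powr (-11/3) - 44/3 * 0\<^sup>2 * k powr (-14/3) + 15 * k powr (-8/3)) - 2 * omega1 c k / 9 * k powr (-4/3)) at_infinity"
    by (intro tendsto_diff tendsto_mult V tendsto_const mu_powr)
  then show "(q \<longlongrightarrow> q_inf) at_infinity" by (simp add: q_def[abs_def] q_inf_def)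
  show "multiplier q"
    unfolding q_def[abs_def] by (intro multiplier_diff multiplier_mult multiplier_const VM mu_powr)
qed

lemma inverse_p_tendsto: "((\<lambda>x. inverse (p x)) \<longlongrightarrow> inverse p_inf) at_infinity"
  and inverse_p_multiplier: "multiplier (\<lambda>x. inverse (p x))"
proof -
  show 1: "((\<lambda>x. inverse (p x)) \<longlongrightarrow> inverse p_inf) at_infinity"
    using p_inf_pos by (intro tendsto_inverse p_tendsto) auto
  have "continuous_on UNIV (\<lambda>x. inverse (p x))"
    using p_pos by (intro continuous_on_inverse smooth_continuous smooth_p) (auto simp: less_imp_neq[symmetric])
  then show "multiplier (\<lambda>x. inverse (p x))" using 1 by (rule multiplier_if_tendsto)
qed

lemma omega0_neg: "omega0 c k < 0"
  using par_a_pos by (simp add: omega0_def)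

text \<open>The left side is the value of the symbol at frequency 0, where it is smallest.
  Positivity is exactly the condition \<open>4 k^2 < c\<close>, that is,
  \<open>k < sqrt c / 2\<close>.\<close>

lemma sigma0_eq: "q_inf + 2 * omega0 c k = sigma0 c k" and sigma0_pos: "sigma0 c k > 0"
proof -
  \<comment> \<open>All fractional powers of \<open>k\<close> become powers of \<open>e\<close>,
    subject to the single relation \<open>k^2 e^3 = 1\<close>.\<close>
  define e where "e = k powr (-2/3)"
  have e: "k powr (-4/3) = e\<^sup>2" "k powr (-8/3) = e ^ 4" "k\<^sup>2 * e ^ 3 = 1"
  proof -
    show "k powr (-4/3) = e\<^sup>2" "k powr (-8/3) = e ^ 4"
      using k_pos by (simp_all add: e_def powr_powr flip: powr_numeral)
    have "e ^ 3 = k powr (-2)" using k_pos by (simp add: e_def powr_powr flip: powr_numeral)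
    then show "k\<^sup>2 * e ^ 3 = 1" using k_pos by (simp add: powr_minus)
  qed
  have pos: "c - k\<^sup>2 > 0" using k2_less by simp
  have a: "par_a c k powr (-2/3) = e / (c - k\<^sup>2)" "par_a c k powr (-4/3) = e\<^sup>2 / (c - k\<^sup>2)\<^sup>2"
  proof -
    show "par_a c k powr (-2/3) = e / (c - k\<^sup>2)"
      using pos k_pos by (simp add: par_a_def powr_mult powr_powr e_def powr_minus_divide)
    have "par_a c k powr (-4/3) = k powr (-4/3) * (c - k\<^sup>2) powr (-2)"
      using pos k_pos by (simp add: par_a_def powr_mult powr_powr)
    also have "(c - k\<^sup>2) powr (-2) = 1 / (c - k\<^sup>2)\<^sup>2" using pos by (simp add: powr_minus_divide)
    finally show "par_a c k powr (-4/3) = e\<^sup>2 / (c - k\<^sup>2)\<^sup>2" unfolding e(1) by simp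
  qed
  \<comment> \<open>The factor \<open>c - k^2\<close> split off here cancels one of the two in the
    denominator of \<open>a powr (-4/3)\<close>, leaving the common denominator of all
    terms.\<close>
  have E: "c * (2 * par_E c k + c) = (c - k\<^sup>2) * (c + 2 * k\<^sup>2)"
    using c_pos by (simp add: par_E_def field_simps power2_eq_square)
  have "omega1 c k = 9 * (c * (2 * par_E c k + c)) * (e\<^sup>2 / (c - k\<^sup>2)\<^sup>2)"
    unfolding omega1_def a(2) by simp
  also have "\<dots> = 9 * (c + 2 * k\<^sup>2) * e\<^sup>2 / (c - k\<^sup>2)"
    unfolding E using pos by (simp add: power2_eq_square)
  finally have o1: "omega1 c k = 9 * (c + 2 * k\<^sup>2) * e\<^sup>2 / (c - k\<^sup>2)" .
  \<comment> \<open>This rewrites \<open>omega0\<close> as a multiple of \<open>e^4\<close> like the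
    other two terms.\<close>
  have "e ^ 4 * k\<^sup>2 = (k\<^sup>2 * e ^ 3) * e" by (simp add: power4_eq_xxxx power3_eq_cube)
  then have e4: "e ^ 4 * k\<^sup>2 = e" using e(3) by simp
  have o0: "omega0 c k = - 9 * (e ^ 4 * k\<^sup>2) / (c - k\<^sup>2)" unfolding e4 omega0_def a(1) by simp
  have cancel: "2 * (9 * X * y / D) / 9 * y = 2 * (X * (y * y) / D)" for X y D :: real by simp
  have e22: "e\<^sup>2 * e\<^sup>2 = e ^ 4" by (simp add: power4_eq_xxxx power2_eq_square)
  have "q_inf + 2 * omega0 c k = 10 * e ^ 4 - 2 * ((c + 2 * k\<^sup>2) * e ^ 4 / (c - k\<^sup>2)) + 2 * (- 9 * (e ^ 4 * k\<^sup>2) / (c - k\<^sup>2))"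
    unfolding q_inf_def o1 o0 e cancel e22 ..
  also have "\<dots> = 8 * (c - 4 * k\<^sup>2) * e ^ 4 / (c - k\<^sup>2)"
  proof -
    define D where "D = c - k\<^sup>2"
    have D: "D \<noteq> 0" "k\<^sup>2 = c - D" using pos by (auto simp: D_def)
    then show ?thesis unfolding D(2) by (simp add: field_simps)
  qed
  also have "e ^ 4 = 1 / k powr (8/3)" unfolding e(2)[symmetric] using powr_minus_divide[of k "8/3"] by simp
  finally show "q_inf + 2 * omega0 c k = sigma0 c k" by (simp add: sigma0_def)
  show "sigma0 c k > 0" using pos k_pos four_k2_less by (simp add: sigma0_def)
qed

text \<open>\<open>Dx\<close> is a definite description, so the operator becomes computable only
  once weak derivatives are exhibited; the product rule expands the divergence term into
  \<open>p w + p' v\<close>.\<close>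

lemma novikov_L_eq:
  assumes "weak_deriv u v" "weak_deriv v w"
  shows "novikov_L c k \<phi> u = mult_op q u + complex_of_real (2 * omega0 c k) *\<^sub>C helmholtz 1 u
     - 2 *\<^sub>C (mult_op p w + mult_op (deriv p) v)"
proof -
  let ?V = "\<lambda>x. 8 * deriv (deriv \<mu>) x * \<mu> x powr (-11/3) - 44/3 * (deriv \<mu> x)\<^sup>2 * \<mu> x powr (-14/3) + 15 * \<mu> x powr (-8/3)"
  have D: "Dx (mult_op (\<lambda>x. \<mu> x powr (-8/3)) (Dx u)) = mult_op p w + mult_op (deriv p) v"
    using Dx_eq[OF weak_deriv_mult_op[OF smooth_p p_multiplier assms(2)]] Dx_eq[OF assms(1)]
    by (simp add: p_def[abs_def])
  have "q = (\<lambda>x. 2/3 * ?V x - (2 * omega1 c k / 9) * \<mu> x powr (-4/3))" by (auto simp: q_def)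
  then have Q: "mult_op q u = complex_of_real (2/3) *\<^sub>C mult_op ?V u
      - complex_of_real (2 * omega1 c k / 9) *\<^sub>C mult_op (\<lambda>x. \<mu> x powr (-4/3)) u"
    using mult_op_diff_left[OF multiplier_mult[OF multiplier_const potential_multiplier] multiplier_mult[OF multiplier_const mu_powr(3)]]
    by (simp only: mult_op_scale[OF potential_multiplier] mult_op_scale[OF mu_powr(3)])
  show ?thesis
    unfolding novikov_L_def Let_def D Q inv_helmholtz_eq
    by (simp add: scaleR_L2_eq L2.scale_right_distrib L2.scale_right_diff_distrib)
qed

lemma fredholm_off_essential:
  assumes z: "z \<notin> complex_of_real ` {sigma0 c k..}"
  shows "fredholm H2 (\<lambda>u. novikov_L c k \<phi> u - z *\<^sub>C u)"
    and "fredholm_index H2 (\<lambda>u. novikov_L c k \<phi> u - z *\<^sub>C u) = 0"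
proof -
  let ?w = "omega0 c k"
  let ?G = "helmholtz 1" and ?G' = "helmholtz' 1"
  \<comment> \<open>Since the second derivative of \<open>G f\<close> is \<open>G f - f\<close>,
    dividing \<open>(L - z) G f\<close> by \<open>2 p\<close> gives \<open>f\<close> plus
    coefficients times \<open>G f\<close>, \<open>G' f\<close> and \<open>G (G f)\<close>. The
    limits at infinity of the first and the last coefficient are \<open>\<beta>\<close> and
    \<open>\<gamma>\<close>; that of \<open>G' f\<close> tends to 0.\<close>
  define \<beta> where "\<beta> = complex_of_real (q_inf / (2 * p_inf) - 1) - z * complex_of_real (1 / (2 * p_inf))"
  define \<gamma> where "\<gamma> = complex_of_real (?w / p_inf)"
  \<comment> \<open>The deviations of these coefficients from their limits. The coefficient of
    \<open>G f\<close> is split into \<open>n1\<close> and \<open>n2\<close> because multipliers are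
    real while \<open>z\<close> is complex.\<close>
  define n1 where "n1 x = q x * inverse (p x) / 2 - q_inf * inverse p_inf / 2" for x
  define n2 where "n2 x = inverse (p x) / 2 - inverse p_inf / 2" for x
  define n3 where "n3 x = - deriv p x * inverse (p x)" for x
  define n4 where "n4 x = ?w * inverse (p x) - ?w * inverse p_inf" for x
  have n_lim: "(n1 \<longlongrightarrow> 0) at_infinity" "(n2 \<longlongrightarrow> 0) at_infinity" "(n3 \<longlongrightarrow> 0) at_infinity" "(n4 \<longlongrightarrow> 0) at_infinity"
  proof -
    have "(n1 \<longlongrightarrow> q_inf * inverse p_inf / 2 - q_inf * inverse p_inf / 2) at_infinity"
      unfolding n1_def[abs_def] by (intro tendsto_intros q_tendsto inverse_p_tendsto) auto
    moreover have "(n2 \<longlongrightarrow> inverse p_inf / 2 - inverse p_inf / 2) at_infinity"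
      unfolding n2_def[abs_def] by (intro tendsto_intros inverse_p_tendsto) auto
    moreover have "(n3 \<longlongrightarrow> - 0 * inverse p_inf) at_infinity"
      unfolding n3_def[abs_def] by (intro tendsto_mult tendsto_minus deriv_p_tendsto inverse_p_tendsto)
    moreover have "(n4 \<longlongrightarrow> ?w * inverse p_inf - ?w * inverse p_inf) at_infinity"
      unfolding n4_def[abs_def] by (intro tendsto_diff tendsto_mult tendsto_const inverse_p_tendsto)
    ultimately show "(n1 \<longlongrightarrow> 0) at_infinity" "(n2 \<longlongrightarrow> 0) at_infinity" "(n3 \<longlongrightarrow> 0) at_infinity" "(n4 \<longlongrightarrow> 0) at_infinity"
      by simp_all
  qed
  have n_mult: "multiplier n1" "multiplier n2" "multiplier n3" "multiplier n4"
  proof -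
    note ms = multiplier_diff multiplier_mult multiplier_const q_multiplier p_multiplier inverse_p_multiplier
    have "n1 = (\<lambda>x. (1/2) * (q x * inverse (p x)) - q_inf * inverse p_inf / 2)"
      "n2 = (\<lambda>x. (1/2) * inverse (p x) - inverse p_inf / 2)" "n3 = (\<lambda>x. (-1) * deriv p x * inverse (p x))"
      by (auto simp: n1_def n2_def n3_def)
    then show "multiplier n1" "multiplier n2" "multiplier n3" "multiplier n4"
      unfolding n4_def[abs_def] by (simp_all only:) (intro ms)+
  qed
  have dec: "exp_decaying (helmholtz_kernel 1)" "exp_decaying (helmholtz_kernel' 1)"
    by (simp_all add: exp_decaying_helmholtz_kernel exp_decaying_helmholtz_kernel')
  have G: "bounded_clinear ?G" "bounded_clinear ?G'" by (intro bounded_clinear_conv_op dec)+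
  define K0 where "K0 f = mult_op n1 (?G f) + (- z) *\<^sub>C mult_op n2 (?G f) + mult_op n3 (?G' f) + mult_op n4 (?G (?G f))" for f
  note compact = approximable_mult_conv[OF dec(1) kernel_equicontinuous_helmholtz(1)]
    approximable_mult_conv[OF dec(2) kernel_equicontinuous_helmholtz(2)]
  have K0: "approximable K0"
    unfolding K0_def[abs_def]
    by (intro approximable_plus compact n_mult n_lim
        approximable_compose(1)[OF _ bounded_clinear_cmult]
        approximable_compose(2)[OF _ G(1), where K = "\<lambda>u. mult_op n4 (?G u)"])
  obtain C' where C': "bounded_clinear C'"
    "\<And>f. C' (f + \<beta> *\<^sub>C ?G f + \<gamma> *\<^sub>C ?G (?G f)) = f" "\<And>f. C' f + \<beta> *\<^sub>C ?G (C' f) + \<gamma> *\<^sub>C ?G (?G (C' f)) = f"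
  proof (rule helmholtz_quadratic_invertible[of \<beta> \<gamma>])
    fix x :: real assume x: "x \<ge> 1"
    show "(complex_of_real x)\<^sup>2 + \<beta> * complex_of_real x + \<gamma> \<noteq> 0"
    proof
      assume 0: "(complex_of_real x)\<^sup>2 + \<beta> * complex_of_real x + \<gamma> = 0"
      \<comment> \<open>The symbol in the variable \<open>x = 1 + \<xi>^2\<close>; multiplying the
        quadratic by \<open>2 p_inf\<close> gives \<open>x (S - z)\<close>, so a root
        \<open>x \<ge> 1\<close> makes \<open>z\<close> a value of the symbol.\<close>
      define S where "S = 2 * p_inf * (x - 1) + q_inf + 2 * ?w / x"
      have "z = complex_of_real S"
      proof -
        have pc: "complex_of_real p_inf \<noteq> 0" "complex_of_real x \<noteq> 0" using p_inf_pos x by auto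
        have "2 * complex_of_real p_inf * ((complex_of_real x)\<^sup>2 + \<beta> * complex_of_real x + \<gamma>)
          = complex_of_real x * (complex_of_real S - z)"
          unfolding \<beta>_def \<gamma>_def S_def using pc by (simp add: field_simps power2_eq_square)
        then show ?thesis using 0 pc by simp
      qed
      moreover have "S \<ge> sigma0 c k"
      proof -
        have "2 * ?w / x \<ge> 2 * ?w" using omega0_neg x by (simp add: field_simps mult_le_cancel_left1)
        moreover have "2 * p_inf * (x - 1) \<ge> 0" using p_inf_pos x by simp
        ultimately show ?thesis unfolding S_def sigma0_eq[symmetric] by linarith
      qed
      ultimately show False using z by auto
    qed
  qed blast
  let ?C = "\<lambda>f. f + \<beta> *\<^sub>C ?G f + \<gamma> *\<^sub>C ?G (?G f)"
  have C: "bounded_clinear ?C"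
    by (intro bounded_clinear_plus bounded_clinear_id bounded_clinear_scale G bounded_clinear_compose[OF G(1) G(1)])
  let ?P = "\<lambda>f. mult_op (\<lambda>x. 2 * p x) (?C f)" and ?P' = "\<lambda>f. C' (mult_op (\<lambda>x. inverse (p x) / 2) f)"
  have m2: "multiplier (\<lambda>x. 2 * p x)" "multiplier (\<lambda>x. inverse (p x) / 2)"
    using multiplier_mult[OF multiplier_const p_multiplier(1), of 2]
      multiplier_mult[OF multiplier_const inverse_p_multiplier, of "1/2"] by simp_all
  have inv: "mult_op (\<lambda>x. 2 * p x) (mult_op (\<lambda>x. inverse (p x) / 2) u) = u"
    "mult_op (\<lambda>x. inverse (p x) / 2) (mult_op (\<lambda>x. 2 * p x) u) = u" for u
  proof -
    have "(\<lambda>x. 2 * p x * (inverse (p x) / 2)) = (\<lambda>x. 1)" "(\<lambda>x. inverse (p x) / 2 * (2 * p x)) = (\<lambda>x. 1)"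
      using p_pos by (auto simp: less_imp_neq[symmetric])
    then show "mult_op (\<lambda>x. 2 * p x) (mult_op (\<lambda>x. inverse (p x) / 2) u) = u"
      "mult_op (\<lambda>x. inverse (p x) / 2) (mult_op (\<lambda>x. 2 * p x) u) = u"
      by (simp_all only: mult_op_mult_op m2 mult_op_const of_real_1 L2.scale_one)
  qed
  have P: "bounded_clinear ?P" "bounded_clinear ?P'"
    by (intro bounded_clinear_compose[OF bounded_clinear_mult_op] C m2)
      (rule bounded_clinear_compose[OF C'(1) bounded_clinear_mult_op[OF m2(2)]])
  have PP: "?P (?P' u) = u" "?P' (?P u) = u" for u
    by (simp_all only: C' inv)
  \<comment> \<open>Chosen so that the constant-coefficient part applied to \<open>f + K f\<close>
    gives that part of \<open>f\<close> plus \<open>K0 f\<close>.\<close>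
  let ?K = "\<lambda>f. C' (K0 f)"
  have K: "approximable ?K" by (rule approximable_compose(1)[OF K0 C'(1)])
  have main: "novikov_L c k \<phi> (?G f) - z *\<^sub>C ?G f = ?P (f + ?K f)" for f
  proof -
    have "?C (f + ?K f) = ?C f + ?C (?K f)" by (rule bounded_clinear_add[OF C])
    also have "?C (?K f) = K0 f" by (rule C'(3))
    finally have 1: "?P (f + ?K f) = mult_op (\<lambda>x. 2 * p x) (?C f + K0 f)" by (simp only:)
    have 2: "novikov_L c k \<phi> (?G f) = mult_op q (?G f) + complex_of_real (2 * ?w) *\<^sub>C ?G (?G f)
       - 2 *\<^sub>C (mult_op p (?G f - f) + mult_op (deriv p) (?G' f))"
      using novikov_L_eq[OF weak_deriv_helmholtz[of 1]] by simp
    show ?thesis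
      unfolding 1 2
    \<comment> \<open>At almost every point the identity of operators becomes an identity of complex
      fractions in the values of \<open>f\<close>, \<open>G f\<close>, \<open>G' f\<close> and
      \<open>G (G f)\<close>.\<close>
    proof (rule L2_eqI)
      let ?g = "?G f" and ?gg = "?G (?G f)" and ?g' = "?G' f"
      show "AE x in lborel. rep_L2 (mult_op q ?g + complex_of_real (2 * ?w) *\<^sub>C ?gg
          - 2 *\<^sub>C (mult_op p (?g - f) + mult_op (deriv p) ?g') - z *\<^sub>C ?g) x
        = rep_L2 (mult_op (\<lambda>x. 2 * p x) (?C f + K0 f)) x"
        using AE_rep_mult_op[OF m2(1), of "?C f + K0 f"] AE_rep_L2_add[of "?C f" "K0 f"]
          AE_rep_L2_add[of "f + \<beta> *\<^sub>C ?g" "\<gamma> *\<^sub>C ?gg"] AE_rep_L2_add[of f "\<beta> *\<^sub>C ?g"]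
          AE_rep_L2_scaleC[of \<beta> ?g] AE_rep_L2_scaleC[of \<gamma> ?gg]
          AE_rep_L2_add[of "mult_op n1 ?g + (- z) *\<^sub>C mult_op n2 ?g + mult_op n3 ?g'" "mult_op n4 ?gg", folded K0_def]
          AE_rep_L2_add[of "mult_op n1 ?g + (- z) *\<^sub>C mult_op n2 ?g" "mult_op n3 ?g'"]
          AE_rep_L2_add[of "mult_op n1 ?g" "(- z) *\<^sub>C mult_op n2 ?g"] AE_rep_L2_scaleC[of "- z" "mult_op n2 ?g"]
          AE_rep_mult_op[OF n_mult(1), of ?g] AE_rep_mult_op[OF n_mult(2), of ?g]
          AE_rep_mult_op[OF n_mult(3), of ?g'] AE_rep_mult_op[OF n_mult(4), of ?gg]
          AE_rep_L2_diff[of "mult_op q ?g + complex_of_real (2 * ?w) *\<^sub>C ?gg - 2 *\<^sub>C (mult_op p (?g - f) + mult_op (deriv p) ?g')" "z *\<^sub>C ?g"]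
          AE_rep_L2_diff[of "mult_op q ?g + complex_of_real (2 * ?w) *\<^sub>C ?gg" "2 *\<^sub>C (mult_op p (?g - f) + mult_op (deriv p) ?g')"]
          AE_rep_L2_add[of "mult_op q ?g" "complex_of_real (2 * ?w) *\<^sub>C ?gg"]
          AE_rep_L2_scaleC[of "complex_of_real (2 * ?w)" ?gg] AE_rep_L2_scaleC[of z ?g]
          AE_rep_L2_scaleC[of 2 "mult_op p (?g - f) + mult_op (deriv p) ?g'"]
          AE_rep_L2_add[of "mult_op p (?g - f)" "mult_op (deriv p) ?g'"]
          AE_rep_mult_op[OF q_multiplier, of ?g] AE_rep_mult_op[OF p_multiplier(1), of "?g - f"]
          AE_rep_mult_op[OF p_multiplier(2), of ?g'] AE_rep_L2_diff[of ?g f]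
      proof eventually_elim
        case (elim x)
        have pc: "complex_of_real (p x) \<noteq> 0" "complex_of_real p_inf \<noteq> 0"
          using p_pos[of x] p_inf_pos by auto
        show ?case
          unfolding elim unfolding n1_def n2_def n3_def n4_def \<beta>_def \<gamma>_def
          using pc by (simp add: field_simps)
      qed
    qed
  qed
  show "fredholm H2 (\<lambda>u. novikov_L c k \<phi> u - z *\<^sub>C u)"
    "fredholm_index H2 (\<lambda>u. novikov_L c k \<phi> u - z *\<^sub>C u) = 0"
    using fredholm_invertible_times_one_plus_approximable[OF K G(1) inj_helmholtz range_helmholtz P PP,
        of "\<lambda>u. novikov_L c k \<phi> u - z *\<^sub>C u"] main by blast+
qed

end

section \<open>Weyl sequences\<close>

text \<open>The Banach-Steinhaus theorem for functionals: the closed sets of \<open>g\<close> on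
  which all of them are bounded by \<open>m\<close> exhaust the space, so by Baire one of these sets
  contains a ball.\<close>

lemma uniform_boundedness_inner:
  fixes X :: "nat \<Rightarrow> 'a::{real_inner, complete_space}"
  assumes "\<And>g. \<exists>B. \<forall>n. \<bar>inner (X n) g\<bar> \<le> B"
  obtains C where "\<And>n. norm (X n) \<le> C"
proof -
  define V where "V m = {g. \<forall>n. \<bar>inner (X n) g\<bar> \<le> real m}" for m :: nat
  have "closed {g. \<bar>inner (X n) g\<bar> \<le> real m}" for n m
    by (intro closed_Collect_le continuous_intros)
  moreover have "V m = (\<Inter>n. {g. \<bar>inner (X n) g\<bar> \<le> real m})" for m by (auto simp: V_def)
  ultimately have closed: "closed (V m)" for m by auto
  have cover: "(\<Union>m. V m) = UNIV"
  proof -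
    have "\<exists>m. g \<in> V m" for g
    proof -
      obtain B where B: "\<And>n. \<bar>inner (X n) g\<bar> \<le> B" using assms by blast
      obtain m :: nat where "B \<le> real m" using real_arch_simple by blast
      then show ?thesis using B by (auto simp: V_def intro: order_trans)
    qed
    then show ?thesis by auto
  qed
  have "\<exists>m. interior (V m) \<noteq> {}"
  proof (rule ccontr)
    assume "\<not> (\<exists>m. interior (V m) \<noteq> {})"
    then have "(euclidean :: 'a topology) interior_of \<Union>(range V) = {}"
      using Met_TC.metric_Baire_category_alt[of "range V"] closed complete_UNIV
      by auto
    then show False using cover by simp
  qed
  then obtain m g0 where "g0 \<in> interior (V m)" by blast
  then obtain r where r: "r > 0" "cball g0 r \<subseteq> V m"
    by (meson mem_interior_cball)
  have "norm (X n) \<le> 2 * real m / r" for n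
  proof (cases "X n = 0")
    case False
    \<comment> \<open>A vector of length \<open>r\<close> in the direction of \<open>X n\<close>, on
      which the functional equals \<open>r * norm (X n)\<close>; comparing the center of the ball
      with \<open>g0 + y\<close> costs the factor 2.\<close>
    let ?y = "(r / norm (X n)) *\<^sub>R X n"
    have "g0 + ?y \<in> cball g0 r" "g0 \<in> cball g0 r" using r(1) False by (auto simp: dist_norm)
    from this[THEN subsetD[OF r(2)]]
    have "\<bar>inner (X n) (g0 + ?y)\<bar> \<le> real m" "\<bar>inner (X n) g0\<bar> \<le> real m" by (simp_all add: V_def)
    then have "\<bar>inner (X n) ?y\<bar> \<le> 2 * real m" by (simp add: inner_add_right)
    moreover have "inner (X n) ?y = r * norm (X n)"
      using False by (simp add: dot_square_norm power2_eq_square)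
    ultimately show ?thesis using r(1) by (simp add: field_simps)
  qed (use r in simp)
  then show ?thesis by (rule that)
qed

text \<open>For a real test function the conjugation in the inner product changes only the imaginary
  part. This links the bilinear pairing to the inner product in which uniform boundedness is
  stated.\<close>

lemma inner_of_test: "test_function \<psi> \<Longrightarrow> inner (of_test \<psi>) g = Re (cpair (of_test \<psi>) g)"
proof -
  assume t: "test_function \<psi>"
  have s: "square_integrable (\<lambda>x. complex_of_real (\<psi> x))" by (rule test_square_integrable[OF t])
  have "inner (of_test \<psi>) (abs_L2 (rep_L2 g)) = (\<integral>x. Re (complex_of_real (\<psi> x) * cnj (rep_L2 g x)) \<partial>lborel)"
    unfolding of_test_def
    by (rule inner_L2.abs_eq) (auto simp: L2_eq_def s square_integrable_rep_L2)
  also have "\<dots> = (\<integral>x. Re (complex_of_real (\<psi> x) * rep_L2 g x) \<partial>lborel)" by simp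
  also have "\<dots> = Re (\<integral>x. complex_of_real (\<psi> x) * rep_L2 g x \<partial>lborel)"
    by (rule integral_Re[OF integrable_mult_square_integrable[OF s square_integrable_rep_L2]])
  also have "\<dots> = Re (cpair (of_test \<psi>) g)" by (simp add: of_test_def cpair_abs_left s)
  finally show ?thesis by simp
qed

lemma of_test_scale: "test_function \<psi> \<Longrightarrow> of_test (\<lambda>x. r * \<psi> x) = complex_of_real r *\<^sub>C of_test \<psi>"
  by (simp add: of_test_def abs_L2_scaleC test_square_integrable)

lemma norm_of_test_square: "test_function \<psi> \<Longrightarrow> (norm (of_test \<psi>))\<^sup>2 = (\<integral>x. (\<psi> x)\<^sup>2 \<partial>lborel)"
  unfolding of_test_def by (subst norm_abs_L2_square) (simp_all add: test_square_integrable)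

lemma norm_of_test_shift:
  assumes "test_function \<psi>"
  shows "norm (of_test (\<lambda>x. \<psi> (x - s))) = norm (of_test \<psi>)"
proof -
  have "(norm (of_test (\<lambda>x. \<psi> (x - s))))\<^sup>2 = (norm (of_test \<psi>))\<^sup>2"
    using lborel_integral_real_affine[of 1 "\<lambda>x. (\<psi> x)\<^sup>2" "-s"]
    by (simp add: norm_of_test_square assms test_shift)
  then show ?thesis by (simp add: power2_eq_iff_nonneg)
qed

lemma norm_mult_op_of_test_le:
  assumes "test_function \<psi>" "multiplier m" "e \<ge> 0" "\<And>x. \<psi> x \<noteq> 0 \<Longrightarrow> \<bar>m x\<bar> \<le> e"
  shows "norm (mult_op m (of_test \<psi>)) \<le> e * norm (of_test \<psi>)"
proof -
  have s: "square_integrable (\<lambda>x. complex_of_real (\<psi> x))" by (rule test_square_integrable[OF assms(1)])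
  have "cmod (complex_of_real (m x) * complex_of_real (\<psi> x)) \<le> e * cmod (complex_of_real (\<psi> x))" for x
    using assms(4)[of x] by (cases "\<psi> x = 0") (auto simp: norm_mult intro: mult_right_mono)
  then show ?thesis
    unfolding of_test_def mult_op_abs[OF assms(2) s]
    by (intro norm_abs_L2_le square_integrable_multiplier assms s) auto
qed

lemma tail_norm_tendsto_0: "((\<lambda>t. norm (mult_op (indicator {t..}) b)) \<longlongrightarrow> 0) at_top"
proof -
  have m: "multiplier (indicator {t..})" for t :: real
    by (rule multiplier_indicator) simp
  have "((\<lambda>t. \<integral>x. (cmod (complex_of_real (indicator {t..} x) * rep_L2 b x))\<^sup>2 \<partial>lborel) \<longlongrightarrow> (\<integral>x. 0 \<partial>(lborel :: real measure))) at_top"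
  proof (rule integral_dominated_convergence_at_top)
    show "integrable lborel (\<lambda>x. (cmod (rep_L2 b x))\<^sup>2)" by (rule integrable_square_rep_L2)
    show "eventually (\<lambda>t. AE x in lborel. norm ((cmod (complex_of_real (indicator {t..} x) * rep_L2 b x))\<^sup>2) \<le> (cmod (rep_L2 b x))\<^sup>2) at_top"
      by (auto simp: norm_mult indicator_def)
    show "AE x in lborel. ((\<lambda>t. (cmod (complex_of_real (indicator {t..} x) * rep_L2 b x))\<^sup>2) \<longlongrightarrow> 0) at_top"
    proof (rule AE_I2)
      fix x :: real
      have "eventually (\<lambda>t. (cmod (complex_of_real (indicator {t..} x) * rep_L2 b x))\<^sup>2 = 0) at_top"
        using eventually_gt_at_top[of x] by eventually_elim (simp add: indicator_def)
      then show "((\<lambda>t. (cmod (complex_of_real (indicator {t..} x) * rep_L2 b x))\<^sup>2) \<longlongrightarrow> 0) at_top"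
        by (rule tendsto_eventually)
    qed
  qed (auto intro!: borel_measurable_power)
  then have "((\<lambda>t. (norm (mult_op (indicator {t..}) b))\<^sup>2) \<longlongrightarrow> 0) at_top"
    by (simp add: mult_op_def norm_abs_L2_square square_integrable_multiplier[OF m square_integrable_rep_L2])
  from tendsto_real_sqrt[OF this] show ?thesis by simp
qed

text \<open>Weak convergence of translates to 0: a translate moved to \<open>s\<close> sees only the
  tail of \<open>b\<close> beyond \<open>s - R\<close>, whose norm tends to 0.\<close>

lemma cpair_shift_tendsto_0:
  assumes t: "test_function \<psi>"
  shows "((\<lambda>s. cpair (of_test (\<lambda>x. \<psi> (x - s))) b) \<longlongrightarrow> 0) at_top"
proof -
  obtain R where R: "R > 0" "\<And>x. \<bar>x\<bar> > R \<Longrightarrow> \<psi> x = 0" by (rule test_bounded[OF t]) blast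
  have m: "multiplier (indicator {t..})" for t :: real
    by (rule multiplier_indicator) simp
  have le: "norm (cpair (of_test (\<lambda>x. \<psi> (x - s))) b) \<le> norm (of_test \<psi>) * norm (mult_op (indicator {s - R..}) b)" for s
  proof -
    have "(\<lambda>x. indicator {s - R..} x * \<psi> (x - s)) = (\<lambda>x. \<psi> (x - s))"
    proof
      fix x show "indicator {s - R..} x * \<psi> (x - s) = \<psi> (x - s)"
        using R(2)[of "x - s"] by (cases "x \<ge> s - R") (auto simp: indicator_def)
    qed
    then have "of_test (\<lambda>x. \<psi> (x - s)) = mult_op (indicator {s - R..}) (of_test (\<lambda>x. \<psi> (x - s)))"
      using mult_op_of_test[OF test_shift[OF t] m] by simp
    then have "cpair (of_test (\<lambda>x. \<psi> (x - s))) b = cpair (of_test (\<lambda>x. \<psi> (x - s))) (mult_op (indicator {s - R..}) b)"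
      by (metis cpair_mult_op[OF m])
    then show ?thesis using norm_cpair_le norm_of_test_shift[OF t] by metis
  qed
  have "filterlim (\<lambda>s. s - R) at_top at_top"
  proof -
    have "filterlim (\<lambda>s. - R + s) at_top at_top"
      by (rule filterlim_tendsto_add_at_top[OF tendsto_const filterlim_ident])
    then show ?thesis by simp
  qed
  then have "((\<lambda>s. norm (of_test \<psi>) * norm (mult_op (indicator {s - R..}) b)) \<longlongrightarrow> norm (of_test \<psi>) * 0) at_top"
    by (intro tendsto_mult tendsto_const filterlim_compose[OF tail_norm_tendsto_0])
  then have "((\<lambda>s. norm (of_test \<psi>) * norm (mult_op (indicator {s - R..}) b)) \<longlongrightarrow> 0) at_top" by simp
  then show ?thesis by (rule Lim_null_comparison[OF always_eventually, rotated]) (rule allI, rule le)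
qed

text \<open>A cosine under a bump of width \<open>N\<close>. The residual carries a derivative of
  the bump, so its norm is of order \<open>sqrt N / N\<close>, while the norm of the wave is of
  order \<open>sqrt N\<close>. Test functions are real, so a cosine has to replace the complex
  exponential.\<close>

lemma approximate_wave:
  assumes e: "e > 0"
  obtains w where "test_function w" "norm (of_test w) = 1"
    "norm (of_test (\<lambda>x. deriv (deriv w) x + \<xi>\<^sup>2 * w x)) \<le> e"
proof -
  define h where "h x = bump_ramp (1 * x + 1) * bump_ramp ((-1) * x + 1)" for x
  have sh: "smooth h" unfolding h_def by (intro smooth_mult smooth_affine smooth_bump_ramp)
  have h0: "h x = 0" if "\<bar>x\<bar> > 1" for x using that by (auto simp: h_def bump_ramp_eq)
  have th: "test_function h" using sh h0 by (auto simp: test_function_iff)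
  \<comment> \<open>Each ramp is at least \<open>exp (-2)\<close> from \<open>1/2\<close> on, so the
    product is at least \<open>exp (-4)\<close> in the middle half.\<close>
  have hlow: "(h x)\<^sup>2 \<ge> exp (-8)" if "\<bar>x\<bar> \<le> 1/2" for x
  proof -
    have "bump_ramp y \<ge> exp (-2)" if "y \<ge> 1/2" for y
      using that by (auto simp: bump_ramp_eq field_simps)
    then have "h x \<ge> exp (-2) * exp (-2)" unfolding h_def using that by (intro mult_mono) (auto simp: abs_le_iff bump_ramp_bounds)
    then have "(h x)\<^sup>2 \<ge> (exp (-2) * exp (-2))\<^sup>2" by (intro power_mono) auto
    then show ?thesis by (simp add: power2_eq_square flip: exp_add)
  qed
  obtain M1 where M1: "M1 > 0" "\<And>x. \<bar>deriv h x\<bar> \<le> M1" by (rule test_bounded[OF test_deriv[OF th]]) blast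
  obtain M2 where M2: "M2 > 0" "\<And>x. \<bar>deriv (deriv h) x\<bar> \<le> M2" by (rule test_bounded[OF test_deriv[OF test_deriv[OF th]]]) blast
  have hd0: "deriv h x = 0" "deriv (deriv h) x = 0" if "\<bar>x\<bar> > 1" for x
  proof -
    have op: "open {x::real. \<bar>x\<bar> > 1}" by (intro open_Collect_less continuous_intros)
    have z: "deriv f x = 0" if "\<And>y. \<bar>y\<bar> > 1 \<Longrightarrow> f y = 0" "\<bar>x\<bar> > 1" for f :: "real \<Rightarrow> real" and x
      by (rule DERIV_imp_deriv, rule has_field_derivative_transform_within_open[OF DERIV_const[of 0] op])
        (use that in auto)
    show "deriv h x = 0" using z[OF h0 that] .
    show "deriv (deriv h) x = 0" using z[OF z[OF h0] that] .
  qed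
  \<comment> \<open>Bounds \<open>g''\<close> and \<open>2 \<xi> g'\<close>, the coefficients in
    \<open>W'' + \<xi>^2 W\<close>, once \<open>1 / N\<close> is taken out.\<close>
  define L where "L = M2 + 2 * \<bar>\<xi>\<bar> * M1"
  have L: "L > 0" using M1 M2 by (simp add: L_def add_pos_nonneg)
  \<comment> \<open>The normalized residual will come out as at most
    \<open>2 * L * exp 4 / N\<close>.\<close>
  obtain n :: nat where n: "real n > 2 * L * exp 4 / e" "n > 0"
  proof -
    obtain n :: nat where "real n > 2 * L * exp 4 / e" using reals_Archimedean2 by blast
    moreover have "2 * L * exp 4 / e > 0" using L e by simp
    ultimately have "n > 0" by (metis gr0I less_asym of_nat_0)
    then show ?thesis using that \<open>real n > 2 * L * exp 4 / e\<close> by blast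
  qed
  define N where "N = real n"
  have N: "N > 0" "N \<ge> 1" "N > 2 * L * exp 4 / e" using n by (auto simp: N_def)
  define g where "g x = h ((1 / N) * x + 0)" for x
  have sg: "smooth g" unfolding g_def by (rule smooth_affine[OF sh])
  have dg: "deriv g = (\<lambda>x. 1 / N * deriv h ((1 / N) * x + 0))"
    unfolding g_def by (intro deriv_eqI has_deriv_affine sh)
  have ddg: "deriv (deriv g) = (\<lambda>x. 1 / N * (1 / N * deriv (deriv h) ((1 / N) * x + 0)))"
    unfolding dg by (intro deriv_eqI DERIV_cmult has_deriv_affine smooth_deriv sh)
  have far: "\<bar>(1 / N) * x + 0\<bar> > 1" if "\<bar>x\<bar> > N" for x using that N by (simp add: abs_mult field_simps)
  have g0: "g x = 0" "deriv g x = 0" "deriv (deriv g) x = 0" if "\<bar>x\<bar> > N" for x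
    using h0[OF far[OF that]] hd0[OF far[OF that]] unfolding ddg unfolding dg g_def by simp_all
  have g_bounds: "\<bar>deriv g x\<bar> \<le> M1 / N" "\<bar>deriv (deriv g) x\<bar> \<le> M2 / N" for x
  proof -
    show "\<bar>deriv g x\<bar> \<le> M1 / N" using M1(2) N by (simp add: dg abs_mult divide_right_mono)
    have "\<bar>deriv (deriv g) x\<bar> \<le> M2 / (N * N)" unfolding ddg using M2(2) N by (simp add: abs_mult divide_right_mono)
    \<comment> \<open>The second derivative even decays like \<open>1 / N^2\<close>; weakening this
      with \<open>N \<ge> 1\<close> lets both terms share one factor \<open>1 / N\<close>.\<close>
    also have "\<dots> \<le> M2 / N" using M2(1) N by (intro divide_left_mono) (auto simp: mult_le_cancel_left1)
    finally show "\<bar>deriv (deriv g) x\<bar> \<le> M2 / N" .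
  qed
  define W where "W \<theta> x = cos (\<xi> * x - \<theta>) * g x" for \<theta> x
  have tg: "test_function g" using sg g0 by (auto simp: test_function_iff)
  have tW: "test_function (W \<theta>)" for \<theta>
    unfolding W_def by (rule test_mult_smooth[OF tg smooth_cos])
  have W2: "deriv (deriv (W \<theta>)) x + \<xi>\<^sup>2 * W \<theta> x = cos (\<xi> * x - \<theta>) * deriv (deriv g) x - 2 * \<xi> * sin (\<xi> * x - \<theta>) * deriv g x" for \<theta> x
  proof -
    note [derivative_intros] = smooth_has_deriv[OF sg] smooth_has_deriv[OF smooth_deriv[OF sg]]
    have d1: "deriv (W \<theta>) = (\<lambda>x. cos (\<xi> * x - \<theta>) * deriv g x - \<xi> * sin (\<xi> * x - \<theta>) * g x)"
      unfolding W_def[abs_def] by (rule deriv_eqI) (auto intro!: derivative_eq_intros)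
    have "deriv (deriv (W \<theta>)) = (\<lambda>x. cos (\<xi> * x - \<theta>) * deriv (deriv g) x - 2 * \<xi> * sin (\<xi> * x - \<theta>) * deriv g x
        - \<xi>\<^sup>2 * (cos (\<xi> * x - \<theta>) * g x))"
      unfolding d1 by (rule deriv_eqI) (auto intro!: derivative_eq_intros simp: power2_eq_square algebra_simps)
    then show ?thesis by (simp add: W_def)
  qed
  have err: "norm (of_test (\<lambda>x. deriv (deriv (W \<theta>)) x + \<xi>\<^sup>2 * W \<theta> x)) \<le> L / N * sqrt (2 * N)" for \<theta>
  proof -
    have [measurable]: "deriv g \<in> borel_measurable borel" "deriv (deriv g) \<in> borel_measurable borel"
      using smooth_deriv[OF sg] smooth_deriv[OF smooth_deriv[OF sg]] by auto
    have "norm (abs_L2 (\<lambda>x. complex_of_real (cos (\<xi> * x - \<theta>) * deriv (deriv g) x - 2 * \<xi> * sin (\<xi> * x - \<theta>) * deriv g x)))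
        \<le> L / N * sqrt (N - (- N))"
    proof (rule norm_compact_support_le)
      fix x
      have 1: "\<bar>cos (\<xi> * x - \<theta>) * deriv (deriv g) x\<bar> \<le> 1 * (M2 / N)"
        unfolding abs_mult by (intro mult_mono g_bounds) auto
      have "\<bar>sin (\<xi> * x - \<theta>) * deriv g x\<bar> \<le> 1 * (M1 / N)"
        unfolding abs_mult by (intro mult_mono g_bounds) auto
      then have "\<bar>2 * \<xi> * (sin (\<xi> * x - \<theta>) * deriv g x)\<bar> \<le> 2 * \<bar>\<xi>\<bar> * (1 * (M1 / N))"
        unfolding abs_mult[of "2 * \<xi>"] by (intro mult_mono) auto
      then have "\<bar>cos (\<xi> * x - \<theta>) * deriv (deriv g) x - 2 * \<xi> * sin (\<xi> * x - \<theta>) * deriv g x\<bar> \<le> M2 / N + 2 * \<bar>\<xi>\<bar> * (M1 / N)"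
        using 1 abs_triangle_ineq4[of "cos (\<xi> * x - \<theta>) * deriv (deriv g) x" "2 * \<xi> * (sin (\<xi> * x - \<theta>) * deriv g x)"]
        by (simp add: mult.assoc)
      then show "cmod (complex_of_real (cos (\<xi> * x - \<theta>) * deriv (deriv g) x - 2 * \<xi> * sin (\<xi> * x - \<theta>) * deriv g x)) \<le> L / N"
        unfolding norm_of_real by (simp add: L_def add_divide_distrib)
      show "complex_of_real (cos (\<xi> * x - \<theta>) * deriv (deriv g) x - 2 * \<xi> * sin (\<xi> * x - \<theta>) * deriv g x) = 0" if "x \<notin> {-N..N}"
      proof -
        have "\<bar>x\<bar> > N" using that by auto
        then show ?thesis by (simp add: g0)
      qed
    qed (use N in auto)
    then show ?thesis by (simp add: W2 of_test_def)
  qed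
  \<comment> \<open>the two phases share the mass of \<open>g\<close>, so one of them carries at least half of it\<close>
  have "N * exp (-8) \<le> (\<integral>x. (g x)\<^sup>2 \<partial>lborel)"
  proof -
    have "(\<integral>x. exp (-8) * indicator {-N/2..N/2} x \<partial>lborel) \<le> (\<integral>x. (g x)\<^sup>2 \<partial>lborel)"
    proof (rule integral_mono)
      show "integrable lborel (\<lambda>x. exp (-8) * indicator {-N/2..N/2} x :: real)"
        by (intro integrable_mult_right integrable_real_indicator) (auto simp: emeasure_lborel_Icc_eq)
      show "integrable lborel (\<lambda>x. (g x)\<^sup>2)"
        using test_square_integrable[OF tg] by (simp add: square_integrable_def)
      show "exp (-8) * indicator {-N/2..N/2} x \<le> (g x)\<^sup>2" for x
        using hlow[of "(1 / N) * x + 0"] N(1) by (auto simp: g_def indicator_def abs_le_iff field_simps)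
    qed
    then show ?thesis using N(1) by (simp add: mult.commute)
  qed
  also have "(\<integral>x. (g x)\<^sup>2 \<partial>lborel) = (norm (of_test (W 0)))\<^sup>2 + (norm (of_test (W (pi/2))))\<^sup>2"
  proof -
    have i: "integrable lborel (\<lambda>x. (W \<theta> x)\<^sup>2)" for \<theta>
      using test_square_integrable[OF tW] by (simp add: square_integrable_def)
    have "(norm (of_test (W 0)))\<^sup>2 + (norm (of_test (W (pi/2))))\<^sup>2 = (\<integral>x. (W 0 x)\<^sup>2 + (W (pi/2) x)\<^sup>2 \<partial>lborel)"
      using i by (simp add: norm_of_test_square tW)
    also have "(\<lambda>x. (W 0 x)\<^sup>2 + (W (pi/2) x)\<^sup>2) = (\<lambda>x. (g x)\<^sup>2)"
    proof
      fix x
      have "cos (\<xi> * x - pi / 2) = sin (\<xi> * x)" by (simp add: cos_diff)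
      then have "(W 0 x)\<^sup>2 + (W (pi/2) x)\<^sup>2 = ((cos (\<xi> * x))\<^sup>2 + (sin (\<xi> * x))\<^sup>2) * (g x)\<^sup>2"
        by (simp only: W_def power_mult_distrib distrib_right diff_0_right)
      then show "(W 0 x)\<^sup>2 + (W (pi/2) x)\<^sup>2 = (g x)\<^sup>2" by simp
    qed
    finally show ?thesis by simp
  qed
  finally obtain \<theta> where \<theta>: "(norm (of_test (W \<theta>)))\<^sup>2 \<ge> N * exp (-8) / 2"
    by (metis (no_types, lifting) field_sum_of_halves add_strict_mono not_le)
  define \<nu> where "\<nu> = norm (of_test (W \<theta>))"
  have nu2: "\<nu>\<^sup>2 \<ge> (sqrt (N / 2) * exp (-4))\<^sup>2"
    using \<theta> N(1) by (simp add: \<nu>_def power_mult_distrib power2_eq_square[of "exp (-4)"] flip: exp_add)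
  have nu: "\<nu> \<ge> sqrt (N / 2) * exp (-4)" by (rule power2_le_imp_le[OF nu2]) (simp add: \<nu>_def)
  have "sqrt (N / 2) * exp (-4) > 0" using N by simp
  then have nu0: "\<nu> > 0" using nu by linarith
  let ?w = "\<lambda>x. (1 / \<nu>) * W \<theta> x"
  have "test_function ?w" by (rule test_mult_smooth[OF tW smooth_const])
  moreover have "norm (of_test ?w) = 1"
    using nu0 unfolding of_test_scale[OF tW] norm_scaleC norm_of_real \<nu>_def by simp
  moreover have "norm (of_test (\<lambda>x. deriv (deriv ?w) x + \<xi>\<^sup>2 * ?w x)) \<le> e"
  proof -
    have "deriv ?w = (\<lambda>x. (1 / \<nu>) * deriv (W \<theta>) x)"
      by (intro deriv_eqI DERIV_cmult smooth_has_deriv test_smooth tW)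
    moreover have "deriv (\<lambda>x. (1 / \<nu>) * deriv (W \<theta>) x) = (\<lambda>x. (1 / \<nu>) * deriv (deriv (W \<theta>)) x)"
      by (intro deriv_eqI DERIV_cmult smooth_has_deriv smooth_deriv test_smooth tW)
    ultimately have eq: "(\<lambda>x. deriv (deriv ?w) x + \<xi>\<^sup>2 * ?w x) = (\<lambda>x. (1 / \<nu>) * (deriv (deriv (W \<theta>)) x + \<xi>\<^sup>2 * W \<theta> x))"
      by (simp add: distrib_left)
    have t2: "test_function (\<lambda>x. deriv (deriv (W \<theta>)) x + \<xi>\<^sup>2 * W \<theta> x)"
    proof -
      have "smooth (\<lambda>x. deriv (deriv (W \<theta>)) x + \<xi>\<^sup>2 * W \<theta> x)"
        by (intro smooth_add smooth_cmult smooth_deriv test_smooth tW)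
      moreover have "deriv (deriv (W \<theta>)) x + \<xi>\<^sup>2 * W \<theta> x = 0" if "\<bar>x\<bar> > N" for x
        unfolding W2 using that by (simp add: g0)
      ultimately show ?thesis unfolding test_function_iff by blast
    qed
    have "norm (of_test (\<lambda>x. deriv (deriv ?w) x + \<xi>\<^sup>2 * ?w x)) \<le> (1 / \<nu>) * (L / N * sqrt (2 * N))"
      unfolding eq of_test_scale[OF t2] norm_scaleC norm_of_real
      using nu0 mult_left_mono[OF err[of \<theta>], of "1 / \<nu>"] by simp
    also have "\<dots> \<le> (1 / (sqrt (N / 2) * exp (-4))) * (L / N * sqrt (2 * N))"
      using nu N L nu0 by (intro mult_right_mono divide_left_mono) auto
    also have "\<dots> = 2 * L * exp 4 / N"
    proof -
      have "sqrt (2 * N) = 2 * sqrt (N / 2)"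
      proof -
        have "2 * N = 4 * (N / 2)" by simp
        then have "sqrt (2 * N) = sqrt 4 * sqrt (N / 2)" by (metis real_sqrt_mult)
        then show ?thesis by simp
      qed
      then show ?thesis using N(1) by (simp add: exp_minus field_simps)
    qed
    also have "\<dots> \<le> e" using N e by (simp add: field_simps)
    finally show ?thesis .
  qed
  ultimately show ?thesis by (rule that)
qed

section \<open>Weyl functions of the linearized operator and its infinite codimension\<close>

context solitary_wave
begin

text \<open>With a test function on one side, both integrations by parts are instances of
  \<open>weak_deriv\<close>, the first against \<open>\<psi>\<close> and the second against
  \<open>p \<psi>'\<close>. The convolution is symmetric because its kernel is even.\<close>

lemma novikov_L_symmetric:
  assumes t: "test_function \<psi>" and h: "h \<in> H2"
  shows "cpair (of_test \<psi>) (novikov_L c k \<phi> h) = cpair (novikov_L c k \<phi> (of_test \<psi>)) h"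
proof -
  obtain v w where vw: "weak_deriv h v" "weak_deriv v w" using h by (auto simp: H2_def)
  have t': "test_function (deriv \<psi>)" by (rule test_deriv[OF t])
  note wd = weak_deriv_of_test[OF t] weak_deriv_of_test[OF t']
  have kernel: "(\<lambda>x. helmholtz_kernel 1 (- x)) = helmholtz_kernel 1" by (simp add: helmholtz_kernel_def fun_eq_iff)
  have G: "cpair (of_test \<psi>) (helmholtz 1 h) = cpair (helmholtz 1 (of_test \<psi>)) h"
    using cpair_conv_op[OF exp_decaying_helmholtz_kernel, of 1 "of_test \<psi>" h] unfolding kernel by simp
  have tp: "test_function (\<lambda>x. p x * deriv \<psi> x)" by (rule test_mult_smooth[OF t' smooth_p])
  have pd: "of_test (\<lambda>x. p x * deriv \<psi> x) = mult_op p (of_test (deriv \<psi>))"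
    by (rule mult_op_of_test[symmetric, OF t' p_multiplier(1)])
  have "cpair (of_test \<psi>) (mult_op p w + mult_op (deriv p) v) = - cpair (of_test (deriv \<psi>)) (mult_op p v)"
    using weak_deriv_mult_op[OF smooth_p p_multiplier vw(2)] t by (simp add: weak_deriv_iff)
  also have "\<dots> = - cpair (of_test (\<lambda>x. p x * deriv \<psi> x)) v"
    unfolding pd by (simp add: cpair_mult_op p_multiplier)
  also have "\<dots> = cpair (of_test (deriv (\<lambda>x. p x * deriv \<psi> x))) h"
    using vw(1) tp by (simp add: weak_deriv_iff)
  also have "of_test (deriv (\<lambda>x. p x * deriv \<psi> x)) = mult_op p (of_test (deriv (deriv \<psi>))) + mult_op (deriv p) (of_test (deriv \<psi>))"
    using weak_deriv_unique[OF weak_deriv_of_test[OF tp, unfolded pd] weak_deriv_mult_op[OF smooth_p p_multiplier wd(2)]] .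
  finally have 1: "cpair (of_test \<psi>) (mult_op p w + mult_op (deriv p) v)
      = cpair (mult_op p (of_test (deriv (deriv \<psi>))) + mult_op (deriv p) (of_test (deriv \<psi>))) h" .
  show ?thesis
    unfolding novikov_L_eq[OF vw] novikov_L_eq[OF wd]
    by (simp only: cpair_diff_right cpair_diff_left cpair_scaleC_left cpair_scaleC_right 1 G cpair_mult_op[OF q_multiplier]
      cpair_add_right[of _ "mult_op q h"] cpair_add_left[of "mult_op q (of_test \<psi>)"])
qed

text \<open>If \<open>e\<close> is the residual of the wave, then
  \<open>(1 + \<xi>^2) G \<psi> = \<psi> + G e\<close>, so the nonlocal term acts as multiplication
  by its symbol up to \<open>e\<close>. What is left is a multiplier evaluated on
  \<open>\<psi>\<close>, a term with \<open>p'\<close>, and a bounded operator applied to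
  \<open>e\<close>.\<close>

lemma novikov_L_approximate_wave:
  assumes t: "test_function \<psi>" and e: "e = of_test (\<lambda>x. deriv (deriv \<psi>) x + \<xi>\<^sup>2 * \<psi> x)"
  shows "novikov_L c k \<phi> (of_test \<psi>) - complex_of_real r *\<^sub>C of_test \<psi>
    = mult_op (\<lambda>x. q x + 2 * \<xi>\<^sup>2 * p x + (2 * omega0 c k / (1 + \<xi>\<^sup>2) - r)) (of_test \<psi>)
      - 2 *\<^sub>C mult_op (deriv p) (of_test (deriv \<psi>))
      + (complex_of_real (2 * omega0 c k / (1 + \<xi>\<^sup>2)) *\<^sub>C helmholtz 1 e - 2 *\<^sub>C mult_op p e)"
proof -
  let ?u = "of_test \<psi>" and ?u' = "of_test (deriv \<psi>)" and ?u'' = "of_test (deriv (deriv \<psi>))"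
  let ?w = "2 * omega0 c k / (1 + \<xi>\<^sup>2)"
  have t': "test_function (deriv \<psi>)" "test_function (deriv (deriv \<psi>))" by (intro test_deriv t)+
  note wd = weak_deriv_of_test[OF t] weak_deriv_of_test[OF t'(1)]
  have e': "e = ?u'' + complex_of_real (\<xi>\<^sup>2) *\<^sub>C ?u"
    unfolding e by (subst of_test_add) (auto intro: t' test_mult_smooth[OF t smooth_const] simp: of_test_scale[OF t])
  have nz: "1 + \<xi>\<^sup>2 \<noteq> 0" by (metis add_nonneg_eq_0_iff zero_le_one zero_le_power2 zero_neq_one)
  have G: "bounded_clinear (helmholtz 1)" by (simp add: bounded_clinear_helmholtz)
  have "helmholtz 1 (1\<^sup>2 *\<^sub>C ?u - ?u'') = ?u"
    by (rule helmholtz_weak_second_deriv(1)[OF wd]) simp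
  also have "1\<^sup>2 *\<^sub>C ?u - ?u'' = complex_of_real (1 + \<xi>\<^sup>2) *\<^sub>C ?u - e"
    unfolding e' by (simp add: L2.scale_left_distrib)
  finally have "complex_of_real (1 + \<xi>\<^sup>2) *\<^sub>C helmholtz 1 ?u = ?u + helmholtz 1 e"
    by (simp only: bounded_clinear_diff[OF G] bounded_clinear_scaleC[OF G] diff_eq_eq)
  then have "complex_of_real ?w *\<^sub>C (?u + helmholtz 1 e) = (complex_of_real ?w * complex_of_real (1 + \<xi>\<^sup>2)) *\<^sub>C helmholtz 1 ?u"
    by (metis L2.scale_scale)
  also have "complex_of_real ?w * complex_of_real (1 + \<xi>\<^sup>2) = complex_of_real (2 * omega0 c k)"
    unfolding of_real_mult[symmetric] using nz by simp
  finally have Gu: "complex_of_real (2 * omega0 c k) *\<^sub>C helmholtz 1 ?u = complex_of_real ?w *\<^sub>C ?u + complex_of_real ?w *\<^sub>C helmholtz 1 e"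
    by (simp only: L2.scale_right_distrib)
  have mp: "mult_op p ?u'' = mult_op p e - complex_of_real (\<xi>\<^sup>2) *\<^sub>C mult_op p ?u"
    unfolding e' by (simp add: bounded_clinear_add[OF bounded_clinear_mult_op[OF p_multiplier(1)]]
      bounded_clinear_scaleC[OF bounded_clinear_mult_op[OF p_multiplier(1)]])
  have h: "mult_op (\<lambda>x. q x + 2 * \<xi>\<^sup>2 * p x + (?w - r)) ?u
      = mult_op q ?u + complex_of_real (2 * \<xi>\<^sup>2) *\<^sub>C mult_op p ?u + complex_of_real (?w - r) *\<^sub>C ?u"
    using mult_op_add_left[OF multiplier_add[OF q_multiplier multiplier_mult[OF multiplier_const p_multiplier(1)]] multiplier_const, of "2 * \<xi>\<^sup>2" "?w - r" ?u]
      mult_op_add_left[OF q_multiplier multiplier_mult[OF multiplier_const p_multiplier(1)], of "2 * \<xi>\<^sup>2" ?u]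
    by (simp only: mult_op_const mult_op_scale[OF p_multiplier(1)])
  show ?thesis
    unfolding novikov_L_eq[OF wd] Gu mp h
    by (simp add: L2.scale_right_distrib L2.scale_right_diff_distrib L2.scale_left_diff_distrib algebra_simps)
qed

text \<open>The intermediate value theorem in the variable \<open>x = 1 + \<xi>^2\<close>, starting
  from \<open>sigma0\<close> at \<open>x = 1\<close>.\<close>

lemma symbol_attains:
  assumes "r \<ge> sigma0 c k"
  obtains \<xi> where "2 * p_inf * \<xi>\<^sup>2 + q_inf + 2 * omega0 c k / (1 + \<xi>\<^sup>2) = r"
proof -
  define S where "S x = 2 * p_inf * (x - 1) + q_inf + 2 * omega0 c k / x" for x
  \<comment> \<open>At this point the linear term alone accounts for \<open>r - sigma0\<close>, and
    \<open>2 omega0 / x\<close> has not decreased since \<open>x = 1\<close>, so the symbol has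
    reached \<open>r\<close>.\<close>
  define x0 where "x0 = 1 + (r - sigma0 c k) / (2 * p_inf)"
  have x0: "x0 \<ge> 1" using assms p_inf_pos by (simp add: x0_def)
  have "2 * p_inf * (x0 - 1) = r - sigma0 c k" using p_inf_pos by (simp add: x0_def)
  then have "S x0 = r - 2 * omega0 c k + 2 * omega0 c k / x0" unfolding S_def sigma0_eq[symmetric] by simp
  moreover have "2 * omega0 c k / x0 \<ge> 2 * omega0 c k" using omega0_neg x0 by (simp add: field_simps mult_le_cancel_left1)
  ultimately have "r \<le> S x0" by linarith
  moreover have "S 1 \<le> r" using assms by (simp add: S_def sigma0_eq)
  moreover have "continuous_on {1..x0} S" unfolding S_def[abs_def] by (intro continuous_intros) auto
  ultimately obtain x where x: "1 \<le> x" "x \<le> x0" "S x = r" using IVT'[of S 1 r x0] x0 by blast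
  have "(sqrt (x - 1))\<^sup>2 = x - 1" using x by simp
  then show ?thesis using x(3) by (intro that[of "sqrt (x - 1)"]) (simp add: S_def)
qed

text \<open>The order of choices matters: the profile \<open>w\<close> is fixed first, which
  controls the residual and fixes the norm of \<open>w'\<close>; only then is it moved out to where
  \<open>m\<close> and \<open>p'\<close> are small enough relative to that norm. The choice of
  \<open>\<xi>\<close> is what makes \<open>m\<close> vanish at infinity.\<close>

lemma weyl_sequence:
  assumes r: "r \<ge> sigma0 c k" and \<eta>: "\<eta> > 0" and B: "finite B"
  obtains \<psi> where "test_function \<psi>" "norm (of_test \<psi>) = 1"
    "norm (novikov_L c k \<phi> (of_test \<psi>) - complex_of_real r *\<^sub>C of_test \<psi>) \<le> \<eta>"
    "\<And>b. b \<in> B \<Longrightarrow> cmod (cpair (of_test \<psi>) b) \<le> \<eta>"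
proof -
  obtain \<xi> where \<xi>: "2 * p_inf * \<xi>\<^sup>2 + q_inf + 2 * omega0 c k / (1 + \<xi>\<^sup>2) = r" by (rule symbol_attains[OF r])
  define \<omega> where "\<omega> = 2 * omega0 c k / (1 + \<xi>\<^sup>2)"
  define m where "m x = q x + 2 * \<xi>\<^sup>2 * p x + (\<omega> - r)" for x
  have mm: "multiplier m"
    unfolding m_def[abs_def] by (intro multiplier_add multiplier_mult multiplier_const q_multiplier p_multiplier)
  have "(m \<longlongrightarrow> q_inf + 2 * \<xi>\<^sup>2 * p_inf + (\<omega> - r)) at_infinity"
    unfolding m_def[abs_def] by (intro tendsto_add tendsto_mult tendsto_const q_tendsto p_tendsto)
  moreover have "q_inf + 2 * \<xi>\<^sup>2 * p_inf + (\<omega> - r) = 0" using \<xi> by (simp add: \<omega>_def algebra_simps)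
  ultimately have m_lim: "(m \<longlongrightarrow> 0) at_infinity" by simp
  let ?E = "\<lambda>e. complex_of_real \<omega> *\<^sub>C helmholtz 1 e - 2 *\<^sub>C mult_op p e"
  have "bounded_clinear ?E"
    by (intro bounded_clinear_minus bounded_clinear_scale bounded_clinear_mult_op p_multiplier bounded_clinear_helmholtz) simp
  then obtain C where C: "C > 0" "\<And>e. norm (?E e) \<le> C * norm e" by (rule bounded_clinear_bound) blast
  have "\<eta> / (2 * C) > 0" using \<eta> C by simp
  then obtain w where w: "test_function w" "norm (of_test w) = 1"
    "norm (of_test (\<lambda>x. deriv (deriv w) x + \<xi>\<^sup>2 * w x)) \<le> \<eta> / (2 * C)"
    by (rule approximate_wave)
  obtain R where R: "R > 0" "\<And>x. \<bar>x\<bar> > R \<Longrightarrow> w x = 0" by (rule test_bounded[OF w(1)]) blast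
  obtain R' where R': "R' > 0" "\<And>x. \<bar>x\<bar> > R' \<Longrightarrow> deriv w x = 0" by (rule test_bounded[OF test_deriv[OF w(1)]]) blast
  \<comment> \<open>The total weight of the two terms that are small by translation: with
    \<open>\<delta> = \<eta> / (2 D)\<close> they contribute \<open>\<eta> / 2\<close>, as does the
    residual.\<close>
  define D where "D = 1 + 2 * norm (of_test (deriv w))"
  have D: "D > 0" by (simp add: D_def add_pos_nonneg)
  define \<delta> where "\<delta> = \<eta> / (2 * D)"
  have \<delta>: "\<delta> > 0" using \<eta> D by (simp add: \<delta>_def)
  obtain b1 where b1: "\<And>x. b1 \<le> \<bar>x\<bar> \<Longrightarrow> \<bar>m x\<bar> < \<delta>"
    using tendstoD[OF m_lim \<delta>] by (auto simp: eventually_at_infinity)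
  obtain b2 where b2: "\<And>x. b2 \<le> \<bar>x\<bar> \<Longrightarrow> \<bar>deriv p x\<bar> < \<delta>"
    using tendstoD[OF deriv_p_tendsto \<delta>] by (auto simp: eventually_at_infinity)
  have "eventually (\<lambda>s. \<forall>b\<in>B. cmod (cpair (of_test (\<lambda>x. w (x - s))) b) \<le> \<eta>) at_top"
  proof (rule eventually_ball_finite[OF B], rule ballI)
    fix b
    have "eventually (\<lambda>s. norm (cpair (of_test (\<lambda>x. w (x - s))) b) < \<eta>) at_top"
      using tendstoD[OF cpair_shift_tendsto_0[OF w(1)] \<eta>] by simp
    then show "eventually (\<lambda>s. cmod (cpair (of_test (\<lambda>x. w (x - s))) b) \<le> \<eta>) at_top"
      by eventually_elim simp
  qed
  moreover have "eventually (\<lambda>s. s \<ge> R + R' + \<bar>b1\<bar> + \<bar>b2\<bar>) at_top" by (rule eventually_ge_at_top)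
  ultimately have "eventually (\<lambda>s. (\<forall>b\<in>B. cmod (cpair (of_test (\<lambda>x. w (x - s))) b) \<le> \<eta>) \<and> s \<ge> R + R' + \<bar>b1\<bar> + \<bar>b2\<bar>) at_top"
    by (rule eventually_conj)
  \<comment> \<open>One shift serves all conditions: the supports of the moved wave and of its
    derivative lie beyond \<open>b1\<close> and \<open>b2\<close>, and all pairings with the finite
    set \<open>B\<close> are small.\<close>
  then obtain s where s: "\<And>b. b \<in> B \<Longrightarrow> cmod (cpair (of_test (\<lambda>x. w (x - s))) b) \<le> \<eta>" "s \<ge> R + R' + \<bar>b1\<bar> + \<bar>b2\<bar>"
    unfolding eventually_at_top_linorder by blast
  let ?\<psi> = "\<lambda>x. w (x - s)"
  have t: "test_function ?\<psi>" by (rule test_shift[OF w(1)])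
  have d1: "deriv ?\<psi> = (\<lambda>x. deriv w (x - s))" by (rule deriv_shift[OF test_smooth[OF w(1)]])
  have d2: "deriv (deriv ?\<psi>) = (\<lambda>x. deriv (deriv w) (x - s))"
    unfolding d1 by (rule deriv_shift[OF smooth_deriv[OF test_smooth[OF w(1)]]])
  let ?e = "of_test (\<lambda>x. deriv (deriv ?\<psi>) x + \<xi>\<^sup>2 * ?\<psi> x)"
  have te: "test_function (\<lambda>x. deriv (deriv w) x + \<xi>\<^sup>2 * w x)"
  proof -
    obtain R'' where R'': "\<And>x. \<bar>x\<bar> > R'' \<Longrightarrow> deriv (deriv w) x = 0"
      by (rule test_bounded[OF test_deriv[OF test_deriv[OF w(1)]]]) blast
    have "deriv (deriv w) x + \<xi>\<^sup>2 * w x = 0" if "\<bar>x\<bar> > max R R''" for x using that R'' R(2) by simp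
    moreover have "smooth (\<lambda>x. deriv (deriv w) x + \<xi>\<^sup>2 * w x)"
      by (intro smooth_add smooth_cmult smooth_deriv test_smooth w(1))
    ultimately show ?thesis unfolding test_function_iff by blast
  qed
  have ne: "norm ?e \<le> \<eta> / (2 * C)" unfolding d2 using norm_of_test_shift[OF te, of s] w(3) by simp
  have n1: "norm (mult_op m (of_test ?\<psi>)) \<le> \<delta> * norm (of_test ?\<psi>)"
  proof (rule norm_mult_op_of_test_le[OF t mm])
    fix x assume "w (x - s) \<noteq> 0"
    then have "\<bar>x - s\<bar> \<le> R" using R(2)[of "x - s"] by (meson not_less)
    then have "b1 \<le> \<bar>x\<bar>" using s(2) R(1) R'(1) by linarith
    then show "\<bar>m x\<bar> \<le> \<delta>" by (rule less_imp_le[OF b1])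
  qed (use \<delta> in simp)
  have n2: "norm (mult_op (deriv p) (of_test (deriv ?\<psi>))) \<le> \<delta> * norm (of_test (deriv ?\<psi>))"
    unfolding d1
  proof (rule norm_mult_op_of_test_le[OF test_shift[OF test_deriv[OF w(1)]] p_multiplier(2)])
    fix x assume "deriv w (x - s) \<noteq> 0"
    then have "\<bar>x - s\<bar> \<le> R'" using R'(2)[of "x - s"] by (meson not_less)
    then have "b2 \<le> \<bar>x\<bar>" using s(2) R(1) R'(1) by linarith
    then show "\<bar>deriv p x\<bar> \<le> \<delta>" by (rule less_imp_le[OF b2])
  qed (use \<delta> in simp)
  have nw: "norm (of_test ?\<psi>) = 1" "norm (of_test (deriv ?\<psi>)) = norm (of_test (deriv w))"
    unfolding d1 using norm_of_test_shift[OF w(1)] norm_of_test_shift[OF test_deriv[OF w(1)]] w(2) by simp_all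
  have eq: "novikov_L c k \<phi> (of_test ?\<psi>) - complex_of_real r *\<^sub>C of_test ?\<psi>
      = mult_op m (of_test ?\<psi>) - 2 *\<^sub>C mult_op (deriv p) (of_test (deriv ?\<psi>)) + ?E ?e"
    using novikov_L_approximate_wave[OF t refl, of r \<xi>] unfolding m_def[abs_def] \<omega>_def .
  have "norm (novikov_L c k \<phi> (of_test ?\<psi>) - complex_of_real r *\<^sub>C of_test ?\<psi>)
      \<le> norm (mult_op m (of_test ?\<psi>)) + norm (2 *\<^sub>C mult_op (deriv p) (of_test (deriv ?\<psi>))) + norm (?E ?e)"
    unfolding eq by (rule order_trans[OF norm_triangle_ineq]) (intro add_right_mono norm_triangle_ineq4)
  also have "\<dots> \<le> \<delta> * 1 + 2 * (\<delta> * norm (of_test (deriv w))) + \<eta> / 2"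
  proof (intro add_mono)
    show "norm (mult_op m (of_test ?\<psi>)) \<le> \<delta> * 1" using n1 nw by simp
    show "norm (2 *\<^sub>C mult_op (deriv p) (of_test (deriv ?\<psi>))) \<le> 2 * (\<delta> * norm (of_test (deriv w)))"
      using n2 unfolding nw norm_scaleC by simp
    have "norm (?E ?e) \<le> C * norm ?e" by (rule C(2))
    also have "\<dots> \<le> C * (\<eta> / (2 * C))" using C(1) by (intro mult_left_mono ne) simp
    finally show "norm (?E ?e) \<le> \<eta> / 2" using C(1) by simp
  qed
  also have "\<delta> * 1 + 2 * (\<delta> * norm (of_test (deriv w))) = \<delta> * D" by (simp add: D_def algebra_simps)
  also have "\<delta> * D + \<eta> / 2 = \<eta>" using D by (simp add: \<delta>_def)
  finally have "norm (novikov_L c k \<phi> (of_test ?\<psi>) - complex_of_real r *\<^sub>C of_test ?\<psi>) \<le> \<eta>" .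
  then show ?thesis using that[OF t nw(1)] s(1) by blast
qed

text \<open>If the range had a finite-dimensional complement \<open>W\<close>, then scaled Weyl functions chosen
  almost orthogonal to a basis of \<open>W\<close> would be weakly bounded but not bounded in norm.\<close>

lemma no_finite_codim:
  assumes r: "r \<ge> sigma0 c k"
  shows "\<not> has_codim ((\<lambda>u. novikov_L c k \<phi> u - complex_of_real r *\<^sub>C u) ` H2) n"
proof
  let ?A = "\<lambda>u. novikov_L c k \<phi> u - complex_of_real r *\<^sub>C u"
  assume "has_codim (?A ` H2) n"
  then obtain W where W: "complement (?A ` H2) W" "finite_dim W" by (auto simp: has_codim_def)
  obtain B where B: "finite B" "W \<subseteq> L2.span B" using W(2) by (auto simp: finite_dim_def)
  have "\<exists>\<psi>. test_function \<psi> \<and> norm (of_test \<psi>) = 1 \<and> norm (?A (of_test \<psi>)) \<le> 1 / real (Suc n)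
      \<and> (\<forall>b\<in>B. cmod (cpair (of_test \<psi>) b) \<le> 1 / real (Suc n))" for n
    by (rule weyl_sequence[OF r _ B(1), of "1 / real (Suc n)"]) auto
  then obtain \<psi> where \<psi>: "\<And>n. test_function (\<psi> n)" "\<And>n. norm (of_test (\<psi> n)) = 1"
    "\<And>n. norm (?A (of_test (\<psi> n))) \<le> 1 / real (Suc n)"
    "\<And>n b. b \<in> B \<Longrightarrow> cmod (cpair (of_test (\<psi> n)) b) \<le> 1 / real (Suc n)"
    by metis
  \<comment> \<open>The factor \<open>Suc n\<close> exactly compensates the bounds
    \<open>1 / Suc n\<close>, so weak bounds persist while the norms grow without limit.\<close>
  define X where "X n = real (Suc n) *\<^sub>R of_test (\<psi> n)" for n
  have Xp: "cpair (X n) g = real (Suc n) * cpair (of_test (\<psi> n)) g" for n g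
    by (simp add: X_def scaleR_L2_eq cpair_scaleC_left)
  have nX: "cmod (cpair (X n) g) = real (Suc n) * cmod (cpair (of_test (\<psi> n)) g)" for n g
    unfolding Xp norm_mult norm_of_real by simp
  \<comment> \<open>A subspace containing \<open>B\<close>, hence \<open>W\<close>, and by symmetry
    of the operator also its range; together these span the whole space.\<close>
  let ?Bd = "{g. \<exists>M. \<forall>n. cmod (cpair (X n) g) \<le> M}"
  have sub: "L2.subspace ?Bd"
  proof (rule L2.subspaceI)
    show "0 \<in> ?Bd" using cpair_scaleC_right[of _ 0 0] by (auto intro!: exI[of _ 0])
    fix f g assume "f \<in> ?Bd" "g \<in> ?Bd"
    then obtain M N where "\<And>n. cmod (cpair (X n) f) \<le> M" "\<And>n. cmod (cpair (X n) g) \<le> N" by blast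
    then have "cmod (cpair (X n) (f + g)) \<le> M + N" for n
      unfolding cpair_add_right by (meson add_mono norm_triangle_ineq order_trans)
    then show "f + g \<in> ?Bd" by blast
  next
    fix z f assume "f \<in> ?Bd"
    then obtain M where "\<And>n. cmod (cpair (X n) f) \<le> M" by blast
    then have "cmod (cpair (X n) (z *\<^sub>C f)) \<le> cmod z * M" for n
      unfolding cpair_scaleC_right norm_mult by (intro mult_left_mono) auto
    then show "z *\<^sub>C f \<in> ?Bd" by blast
  qed
  have "B \<subseteq> ?Bd"
  proof
    fix b assume "b \<in> B"
    then have "cmod (cpair (X n) b) \<le> 1" for n
      using \<psi>(4)[of b n] unfolding nX by (simp add: field_simps)
    then show "b \<in> ?Bd" by blast
  qed
  then have WB: "W \<subseteq> ?Bd" using L2.span_minimal[OF _ sub] B(2) by blast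
  have RB: "?A h \<in> ?Bd" if "h \<in> H2" for h
  proof -
    have "cmod (cpair (X n) (?A h)) \<le> norm h" for n
    proof -
      have "cpair (of_test (\<psi> n)) (?A h) = cpair (?A (of_test (\<psi> n))) h"
        by (simp add: cpair_simps novikov_L_symmetric[OF \<psi>(1) that])
      then have "cmod (cpair (of_test (\<psi> n)) (?A h)) \<le> 1 / real (Suc n) * norm h"
        using norm_cpair_le[of "?A (of_test (\<psi> n))" h] mult_right_mono[OF \<psi>(3)[of n], of "norm h"] by simp
      then show ?thesis unfolding nX by (simp add: field_simps)
    qed
    then show ?thesis by blast
  qed
  have "g \<in> ?Bd" for g
  proof -
    obtain v y where "v \<in> ?A ` H2" "y \<in> W" "g = v + y" using W(1) unfolding complement_def by blast
    then show ?thesis using RB WB L2.subspace_add[OF sub] by blast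
  qed
  then have "\<exists>M. \<forall>n. cmod (cpair (X n) g) \<le> M" for g by blast
  moreover have "\<bar>inner (X n) g\<bar> \<le> cmod (cpair (X n) g)" for n g
  proof -
    have "inner (X n) g = real (Suc n) * Re (cpair (of_test (\<psi> n)) g)"
      by (simp add: X_def inner_of_test[OF \<psi>(1)])
    then show ?thesis
      unfolding nX using mult_left_mono[OF abs_Re_le_cmod, of "real (Suc n)" "cpair (of_test (\<psi> n)) g"]
      by (simp add: abs_mult)
  qed
  ultimately have "\<exists>M. \<forall>n. \<bar>inner (X n) g\<bar> \<le> M" for g by (meson order_trans)
  then obtain C where C: "\<And>n. norm (X n) \<le> C" using uniform_boundedness_inner by blast
  obtain n :: nat where "C < real n" using reals_Archimedean2 by blast
  moreover have "norm (X n) = real (Suc n)" by (simp add: X_def \<psi>(2))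
  ultimately show False using C[of n] by simp
qed

end

theorem lemma3p2:
  fixes c k :: real and \<phi> :: "real \<Rightarrow> real"
  assumes "c > 0" and "0 < k" and "k < sqrt c / 2"
    and "solitary_profile c k \<phi>"
  shows "ess_spectrum H2 (novikov_L c k \<phi>) = complex_of_real ` {sigma0 c k..} \<and> sigma0 c k > 0"
proof -
  interpret solitary_wave c k \<phi> by unfold_locales (fact assms)+
  show ?thesis
  proof (intro conjI set_eqI iffI)
    fix z assume "z \<in> ess_spectrum H2 (novikov_L c k \<phi>)"
    then show "z \<in> complex_of_real ` {sigma0 c k..}"
      using fredholm_off_essential[of z] by (auto simp: ess_spectrum_def)
  next
    fix z assume "z \<in> complex_of_real ` {sigma0 c k..}"
    then obtain r where "z = complex_of_real r" "r \<ge> sigma0 c k" by auto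
    \<comment> \<open>Here the Fredholm property itself fails, by the absence of a finite
      codimension.\<close>
    then show "z \<in> ess_spectrum H2 (novikov_L c k \<phi>)"
      using no_finite_codim by (auto simp: ess_spectrum_def fredholm_def)
  qed (rule sigma0_pos)
qed

end
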